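(* For the game GoldenNugget the following hold. (i) If $h\in B$, then $\mathrm{rcf}(h)=\{1\mid 0\}$. (ii) If $h\in\widehat{AB_0}$, then $\mathrm{rcf}(h)=1$. (iii) If $h\in\mathcal{Q}\setminus\{0\}$, then $\mathrm{val}(h)$ is a number and $\mathrm{val}(h)\in[1/2,1)$. Furthermore, for all $n\ge 0$, $\mathrm{val}(F_{2n+3}-2)=s(n)$ and $\mathrm{val}(F_{2n+4}-2)=q(n)$. (iv) If $n\ge 1$ is an integer and $h\in G(n)$ (where $G(n)\subset AB_0$), then $\mathrm{rcf}(h)=\{1\mid s(n)\}$.
   Context: Number theory notation. Let $\phi=\frac{1+\sqrt5}{2}$, and for integers $n\ge 0$ let $A(n)=\lfloor n\phi\rfloor$, $B(n)=\lfloor n\phi^2\rfloor$; juxtaposition is composition ($AB(n)=A(B(n))$, $B^2(n)=B(B(n))$). $B=\{B(n): n\ge 1\}$; $AB_0=\{AB(n): n\ge 0\}$; $\widehat{AB_0}=\{AB(n)+1: n\ge 0\}$; $\widehat{B^2}=\{B^2(n)+1: n\ge 1\}$. Fibonacci numbers: $F_0=0$, $F_1=F_2=1$, $F_n=F_{n-1}+F_{n-2}$. $\mathcal{Q}=\widehat{B^2}\cup\{F_{2n+3}-2: n\ge 0\}$. For $i,n\ge 0$, $G_i(n)=\lfloor i\phi\rfloor F_{2n+2}+iF_{2n+1}+F_{2n+3}-2$, and for $n\ge 1$, $G(n)=\{G_i(n): i>0\}$. For $n\ge 0$, $s(n)=\frac23\cdot\frac{4^n-1}{4^n}$ and $q(n)=\frac23\cdot\frac{4^n+\frac12}{4^n}$.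 Game theory. Games are finite normal-play partizan games $G=\{G^{\mathcal L}\mid G^{\mathcal R}\}$ (sets of Left and Right options; a player unable to move loses), with the usual disjunctive sum, negative, and partial order: $G\ge H$ iff Left wins $G-H$ when Right moves first; $G=H$ iff $G\ge H$ and $H\ge G$. Dyadic rationals are identified with games in the usual way ($0=\{\,\mid\,\}$, $1=\{0\mid\,\}$, $\frac12=\{0\mid 1\}$, etc.); a game is a number if it equals a dyadic rational. The canonical form of a game is the unique equal game none of whose sub-positions has dominated or reversible options. Stops: if $G$ is a number, $L(G)=R(G)=G$; otherwise $L(G)=\max R(G^L)$ and $R(G)=\min L(G^R)$ over options. $G$ is hot if $L(G)>R(G)$. $G\ge_I H$ means $G-H\ge -x$ for every positive number $x$; $G=_I H$ ($G$, $H$ infinitesimally close) means $-x<G-H<x$ for every positive number $x$. A Left option $G^{L_1}$ is Inf-dominated by another Left option $G^{L_2}$ if $G^{L_2}\ge_I G^{L_1}$; a Right option $G^{R_1}$ is Inf-dominated by another Right option $G^{R_2}$ if $G^{R_1}\ge_I G^{R_2}$. A Left option $G^{L_1}$ is Inf-reversible if $G\ge_I G^{L_1R_1}$ for some Right option $G^{L_1R_1}$ of $G^{L_1}$; a Right option $G^{R_1}$ is Inf-reversible if $G^{R_1L_1}\ge_I G$ for some Left option $G^{R_1L_1}$ of $G^{R_1}$. A game $K$ is in reduced canonical form if every sub-position $H$ of $K$ (including $K$) either is a number in canonical form, or is hot with no Inf-dominated or Inf-reversible options. For every $G$ there is a unique $K$ in reduced canonical form with $G=_I K$ (a known theorem);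 it is denoted $\mathrm{rcf}(G)$. GoldenNugget: a position is a heap of $h\ge 0$ counters; Left's options are the heaps $h-a$ with $a\in\{A(i): i\ge 1\}$, $a\le h$, and Right's options are the heaps $h-b$ with $b\in\{B(i): i\ge 1\}$, $b\le h$. $\mathrm{val}(h)$ is the (canonical form) value of the heap of size $h$ and $\mathrm{rcf}(h)$ is its reduced canonical form. *)

theory Defs
  imports Complex_Main "HOL-Library.FSet" "HOL-Number_Theory.Fib"
begin

section \<open>Finite normal-play partizan games\<close>

text \<open>
  The HOL equality \<open>G = H\<close> on this type is identity of games as forms; equality of games
  in the sense of combinatorial game theory is the relation \<open>\<approx>\<close> below.
\<close>

datatype game = Game (left_opts: "game fset") (right_opts: "game fset")

lemma size_left_opts:
  assumes "g |\<in>| left_opts G"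
  shows "size g < size G"
proof (cases G)
  case (Game L R)
  have "Suc (size g) \<le> (\<Sum>x\<in>fset L. Suc (size x))"
    using assms Game by (intro member_le_sum) auto
  thus ?thesis by (simp add: Game size_fset_overloaded_simps)
qed

lemma size_right_opts:
  assumes "g |\<in>| right_opts G"
  shows "size g < size G"
proof (cases G)
  case (Game L R)
  have "Suc (size g) \<le> (\<Sum>x\<in>fset R. Suc (size x))"
    using assms Game by (intro member_le_sum) auto
  thus ?thesis by (simp add: Game size_fset_overloaded_simps)
qed

inductive left_wins_first :: "game \<Rightarrow> bool" and left_wins_second :: "game \<Rightarrow> bool" where
  "g |\<in>| left_opts G \<Longrightarrow> left_wins_second g \<Longrightarrow> left_wins_first G"
| "(\<And>g. g |\<in>| right_opts G \<Longrightarrow> left_wins_first g) \<Longrightarrow> left_wins_second G"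

primrec game_neg :: "game \<Rightarrow> game" where
  "game_neg (Game L R) = Game (game_neg |`| R) (game_neg |`| L)"

function game_add :: "game \<Rightarrow> game \<Rightarrow> game" where
  "game_add G H = Game
     ((\<lambda>g. game_add g H) |`| left_opts G |\<union>| (\<lambda>h. game_add G h) |`| left_opts H)
     ((\<lambda>g. game_add g H) |`| right_opts G |\<union>| (\<lambda>h. game_add G h) |`| right_opts H)"
  by auto
termination
  by (relation "measure (\<lambda>(G, H). size G + size H)") (auto intro: size_left_opts size_right_opts)

declare game_add.simps [simp del]

instantiation game :: "{zero, plus, uminus, minus, ord}"
begin

definition zero_game_def: "0 = Game {||} {||}"
definition plus_game_def: "G + H = game_add G H"
definition uminus_game_def: "- G = game_neg G"
definition minus_game_def: "G - H = G + (- H :: game)"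
definition less_eq_game_def: "H \<le> G \<longleftrightarrow> left_wins_second (G - H)"
definition less_game_def: "H < (G :: game) \<longleftrightarrow> H \<le> G \<and> \<not> G \<le> H"

instance ..

end

definition game_eq :: "game \<Rightarrow> game \<Rightarrow> bool" (infix "\<approx>" 50) where
  "G \<approx> H \<longleftrightarrow> G \<ge> H \<and> H \<ge> G"

inductive subposition :: "game \<Rightarrow> game \<Rightarrow> bool" where
  "subposition G G"
| "subposition H G \<Longrightarrow> K |\<in>| left_opts H |\<union>| right_opts H \<Longrightarrow> subposition K G"


section \<open>Numbers\<close>

definition dyadic :: "rat \<Rightarrow> bool" where
  "dyadic x \<longleftrightarrow> (\<exists>(m::int) (k::nat). x = of_int m / 2 ^ k)"

primrec nat_game :: "nat \<Rightarrow> game" where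
  "nat_game 0 = 0"
| "nat_game (Suc n) = Game {|nat_game n|} {||}"

definition int_game :: "int \<Rightarrow> game" where
  "int_game m = (if m \<ge> 0 then nat_game (nat m) else - nat_game (nat (- m)))"

text \<open>\<open>dyadic_game k m\<close> is the game identified with \<open>m / 2 ^ k\<close>.\<close>

primrec dyadic_game :: "nat \<Rightarrow> int \<Rightarrow> game" where
  "dyadic_game 0 m = int_game m"
| "dyadic_game (Suc k) m =
     (if even m then dyadic_game k (m div 2)
      else Game {|dyadic_game k ((m - 1) div 2)|} {|dyadic_game k ((m + 1) div 2)|})"

text \<open>The game identified with the dyadic rational \<open>x\<close>; unspecified if \<open>x\<close> is not dyadic.\<close>

definition num :: "rat \<Rightarrow> game" where
  "num x = (let k = (LEAST k. x * 2 ^ k \<in> \<int>) in dyadic_game k \<lfloor>x * 2 ^ k\<rfloor>)"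

definition is_number :: "game \<Rightarrow> bool" where
  "is_number G \<longleftrightarrow> (\<exists>x. dyadic x \<and> G \<approx> num x)"

definition number_value :: "game \<Rightarrow> rat" where
  "number_value G = (THE x. dyadic x \<and> G \<approx> num x)"


section \<open>Canonical forms\<close>

definition left_dominated :: "game \<Rightarrow> game \<Rightarrow> bool" where
  "left_dominated G g \<longleftrightarrow> (\<exists>g'. g' |\<in>| left_opts G \<and> g' \<noteq> g \<and> g' \<ge> g)"

definition right_dominated :: "game \<Rightarrow> game \<Rightarrow> bool" where
  "right_dominated G g \<longleftrightarrow> (\<exists>g'. g' |\<in>| right_opts G \<and> g' \<noteq> g \<and> g \<ge> g')"

definition left_reversible :: "game \<Rightarrow> game \<Rightarrow> bool" where
  "left_reversible G g \<longleftrightarrow> (\<exists>g'. g' |\<in>| right_opts g \<and> G \<ge> g')"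

definition right_reversible :: "game \<Rightarrow> game \<Rightarrow> bool" where
  "right_reversible G g \<longleftrightarrow> (\<exists>g'. g' |\<in>| left_opts g \<and> g' \<ge> G)"

definition canonical :: "game \<Rightarrow> bool" where
  "canonical K \<longleftrightarrow> (\<forall>H. subposition H K \<longrightarrow>
     (\<forall>g. g |\<in>| left_opts H \<longrightarrow> \<not> left_dominated H g \<and> \<not> left_reversible H g) \<and>
     (\<forall>g. g |\<in>| right_opts H \<longrightarrow> \<not> right_dominated H g \<and> \<not> right_reversible H g))"

definition canonical_form :: "game \<Rightarrow> game" where
  "canonical_form G = (THE K. canonical K \<and> G \<approx> K)"


section \<open>Stops and reduced canonical forms\<close>

text \<open>
  A game with no Left option or no Right option equals an integer, so \<open>Max\<close> and \<open>Min\<close>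
  are only ever taken over nonempty sets.
\<close>

function left_stop :: "game \<Rightarrow> rat" and right_stop :: "game \<Rightarrow> rat" where
  "left_stop G = (if is_number G then number_value G
     else Max (right_stop ` fset (left_opts G)))"
| "right_stop G = (if is_number G then number_value G
     else Min (left_stop ` fset (right_opts G)))"
  by pat_completeness auto
termination
  by (relation "measure (case_sum size size)") (auto intro: size_left_opts size_right_opts)

declare left_stop.simps [simp del] right_stop.simps [simp del]

definition hot :: "game \<Rightarrow> bool" where
  "hot G \<longleftrightarrow> left_stop G > right_stop G"

definition inf_ge :: "game \<Rightarrow> game \<Rightarrow> bool" (infix "\<ge>\<^sub>I" 50) where
  "G \<ge>\<^sub>I H \<longleftrightarrow> (\<forall>x. is_number x \<and> x > 0 \<longrightarrow> G - H \<ge> - x)"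

definition inf_eq :: "game \<Rightarrow> game \<Rightarrow> bool" (infix "=\<^sub>I" 50) where
  "G =\<^sub>I H \<longleftrightarrow> (\<forall>x. is_number x \<and> x > 0 \<longrightarrow> - x < G - H \<and> G - H < x)"

definition inf_left_dominated :: "game \<Rightarrow> game \<Rightarrow> bool" where
  "inf_left_dominated G g \<longleftrightarrow> (\<exists>g'. g' |\<in>| left_opts G \<and> g' \<noteq> g \<and> g' \<ge>\<^sub>I g)"

definition inf_right_dominated :: "game \<Rightarrow> game \<Rightarrow> bool" where
  "inf_right_dominated G g \<longleftrightarrow> (\<exists>g'. g' |\<in>| right_opts G \<and> g' \<noteq> g \<and> g \<ge>\<^sub>I g')"

definition inf_left_reversible :: "game \<Rightarrow> game \<Rightarrow> bool" where
  "inf_left_reversible G g \<longleftrightarrow> (\<exists>g'. g' |\<in>| right_opts g \<and> G \<ge>\<^sub>I g')"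

definition inf_right_reversible :: "game \<Rightarrow> game \<Rightarrow> bool" where
  "inf_right_reversible G g \<longleftrightarrow> (\<exists>g'. g' |\<in>| left_opts g \<and> g' \<ge>\<^sub>I G)"

definition reduced_canonical :: "game \<Rightarrow> bool" where
  "reduced_canonical K \<longleftrightarrow> (\<forall>H. subposition H K \<longrightarrow>
     (is_number H \<and> canonical H) \<or>
     (hot H \<and>
      (\<forall>g. g |\<in>| left_opts H \<longrightarrow> \<not> inf_left_dominated H g \<and> \<not> inf_left_reversible H g) \<and>
      (\<forall>g. g |\<in>| right_opts H \<longrightarrow> \<not> inf_right_dominated H g \<and> \<not> inf_right_reversible H g)))"

definition rcf :: "game \<Rightarrow> game" where
  "rcf G = (THE K. reduced_canonical K \<and> G =\<^sub>I K)"


section \<open>Wythoff sequences\<close>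

definition golden :: real where
  "golden = (1 + sqrt 5) / 2"

definition A :: "nat \<Rightarrow> nat" where
  "A n = nat \<lfloor>real n * golden\<rfloor>"

definition B :: "nat \<Rightarrow> nat" where
  "B n = nat \<lfloor>real n * golden ^ 2\<rfloor>"

definition B_set :: "nat set" where
  "B_set = {B n |n. n \<ge> 1}"

definition AB0 :: "nat set" where
  "AB0 = {A (B n) |n. n \<ge> 0}"

definition AB0_hat :: "nat set" where
  "AB0_hat = {A (B n) + 1 |n. n \<ge> 0}"

definition BB_hat :: "nat set" where
  "BB_hat = {B (B n) + 1 |n. n \<ge> 1}"

text \<open>
  In \<open>Q_set\<close> and \<open>G_elem\<close> the subtraction on natural numbers is never truncated, since
  \<open>fib (2 * n + 3) \<ge> 2\<close>.
\<close>

definition Q_set :: "nat set" where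
  "Q_set = BB_hat \<union> {fib (2 * n + 3) - 2 |n. n \<ge> 0}"

definition G_elem :: "nat \<Rightarrow> nat \<Rightarrow> nat" where
  "G_elem i n = nat \<lfloor>real i * golden\<rfloor> * fib (2 * n + 2) + i * fib (2 * n + 1) + fib (2 * n + 3) - 2"

definition G_set :: "nat \<Rightarrow> nat set" where
  "G_set n = {G_elem i n |i. i > 0}"

definition s :: "nat \<Rightarrow> rat" where
  "s n = 2 / 3 * ((4 ^ n - 1) / 4 ^ n)"

definition q :: "nat \<Rightarrow> rat" where
  "q n = 2 / 3 * ((4 ^ n + 1 / 2) / 4 ^ n)"


section \<open>GoldenNugget\<close>

definition left_heaps :: "nat \<Rightarrow> nat set" where
  "left_heaps h = {h - A i |i. i \<ge> 1 \<and> A i \<le> h}"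

definition right_heaps :: "nat \<Rightarrow> nat set" where
  "right_heaps h = {h - B i |i. i \<ge> 1 \<and> B i \<le> h}"

lemma A_pos: "i \<ge> 1 \<Longrightarrow> A i \<ge> 1"
proof -
  assume i: "i \<ge> 1"
  have "sqrt 5 \<ge> 1" by (rule real_le_rsqrt) simp
  hence "golden \<ge> 1" by (simp add: golden_def)
  with i have "1 * 1 \<le> real i * golden" by (intro mult_mono) auto
  thus "A i \<ge> 1" by (simp add: A_def le_nat_floor le_nat_iff le_floor_iff)
qed

lemma B_pos: "i \<ge> 1 \<Longrightarrow> B i \<ge> 1"
proof -
  assume i: "i \<ge> 1"
  have "sqrt 5 \<ge> 1" by (rule real_le_rsqrt) simp
  hence "golden \<ge> 1" by (simp add: golden_def)
  hence "golden ^ 2 \<ge> 1" by (rule one_le_power)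
  with i have "1 * 1 \<le> real i * golden ^ 2" by (intro mult_mono) auto
  thus "B i \<ge> 1" by (simp add: B_def le_nat_iff le_floor_iff)
qed

lemma left_heaps_less: "k \<in> left_heaps h \<Longrightarrow> k < h"
  using A_pos by (fastforce simp: left_heaps_def)

lemma right_heaps_less: "k \<in> right_heaps h \<Longrightarrow> k < h"
  using B_pos by (fastforce simp: right_heaps_def)

lemma finite_left_heaps: "finite (left_heaps h)"
  by (rule finite_subset[of _ "{..<h}"]) (auto dest: left_heaps_less)

lemma finite_right_heaps: "finite (right_heaps h)"
  by (rule finite_subset[of _ "{..<h}"]) (auto dest: right_heaps_less)

function heap :: "nat \<Rightarrow> game" where
  "heap h = Game (heap |`| Abs_fset (left_heaps h)) (heap |`| Abs_fset (right_heaps h))"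
  by auto
termination
  by (relation "measure id")
     (auto simp: Abs_fset_inverse finite_left_heaps finite_right_heaps
        dest: left_heaps_less right_heaps_less)

declare heap.simps [simp del]

definition val :: "nat \<Rightarrow> game" where
  "val h = canonical_form (heap h)"

definition rcf_heap :: "nat \<Rightarrow> game" where
  "rcf_heap h = rcf (heap h)"

end

theory Submission
  imports Defs
begin

text \<open>
  Place the heap \<open>h\<close> at the point \<open>(h + 1) \<phi> mod 1\<close> of the circle. Since \<open>A\<close> and \<open>B\<close> are the
  numbers with fractional part of \<open>m \<phi>\<close> above or below \<open>2 - \<phi>\<close>, every smaller heap is an option
  of exactly one player, determined by the arc between the two positions, and the classes of the
  theorem are arcs of the circle, up to the points \<open>F\<^bsub>2n+3\<^esub> - 2\<close> that separate the arcs of the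
  sets \<open>G(n)\<close>. All heaps lie between \<open>0\<close> and \<open>1\<close> up to infinitesimals; heaps in \<open>AB0_hat\<close> are
  infinitesimally close to \<open>1\<close>, because Right can only move within \<open>AB0_hat\<close> or to heaps from
  which Left returns to it. From a heap in \<open>Q\<close>, the smaller heaps of \<open>Q\<close> ahead are Left options, those behind are
  Right options, and every other option is irrelevant; hence heaps in \<open>Q\<close> are numbers, decreasing
  along the circle, each being the simplest number between the values of its neighbours. Best
  approximation by Fibonacci numbers identifies the neighbours of \<open>F\<^sub>m - 2\<close>, which gives \<open>s(n)\<close> and
  \<open>q(n)\<close>. A heap in \<open>G(n)\<close> is then the switch between \<open>1\<close> and the best point \<open>F\<^bsub>2n+3\<^esub> - 2\<close> Right
  can reach.
\<close>

section \<open>The ordered group of game values\<close>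

lemma left_opts_add [simp]:
  "left_opts (G + H) = (\<lambda>g. g + H) |`| left_opts G |\<union>| (\<lambda>h. G + h) |`| left_opts H"
  by (simp add: plus_game_def game_add.simps[of G H])

lemma right_opts_add [simp]:
  "right_opts (G + H) = (\<lambda>g. g + H) |`| right_opts G |\<union>| (\<lambda>h. G + h) |`| right_opts H"
  by (simp add: plus_game_def game_add.simps[of G H])

lemma left_opts_uminus [simp]: "left_opts (- G) = uminus |`| right_opts G" for G :: game
  by (cases G) (simp add: uminus_game_def[abs_def])

lemma right_opts_uminus [simp]: "right_opts (- G) = uminus |`| left_opts G" for G :: game
  by (cases G) (simp add: uminus_game_def[abs_def])

lemma opts_zero [simp]: "left_opts 0 = {||}" "right_opts 0 = {||}"
  by (simp_all add: zero_game_def)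

lemma game_induct [case_names game]:
  assumes "\<And>G. (\<And>g. g |\<in>| left_opts G \<Longrightarrow> P g) \<Longrightarrow> (\<And>g. g |\<in>| right_opts G \<Longrightarrow> P g) \<Longrightarrow> P G"
  shows "P G"
  by (induction G rule: measure_induct_rule[of size])
     (use assms size_left_opts size_right_opts in blast)

lemma game_induct2 [case_names game]:
  assumes "\<And>G H. (\<And>g. g |\<in>| left_opts G \<Longrightarrow> P g H) \<Longrightarrow> (\<And>g. g |\<in>| right_opts G \<Longrightarrow> P g H) \<Longrightarrow>
    (\<And>h. h |\<in>| left_opts H \<Longrightarrow> P G h) \<Longrightarrow> (\<And>h. h |\<in>| right_opts H \<Longrightarrow> P G h) \<Longrightarrow> P G H"
  shows "P G H"
proof (induction "(G, H)" arbitrary: G H rule: measure_induct_rule[of "\<lambda>(G, H). size G + size H"])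
  case less
  show ?case
    by (rule assms; rule less; simp add: size_left_opts size_right_opts)
qed

lemma fimage_cong_fset: "(\<And>x. x |\<in>| X \<Longrightarrow> f x = g x) \<Longrightarrow> f |`| X = g |`| X"
  by (rule fset.map_cong) simp_all

lemma game_eqI:
  "left_opts G = left_opts H \<Longrightarrow> right_opts G = right_opts H \<Longrightarrow> G = H"
  by (rule game.expand) simp

instance game :: comm_monoid_add
proof
  fix G H K :: game
  show comm: "G + H = H + G" for G H :: game
  proof (induction G H rule: game_induct2)
    case (game G H)
    have "(\<lambda>g. g + H) |`| left_opts G = (\<lambda>g. H + g) |`| left_opts G"
      "(\<lambda>h. G + h) |`| left_opts H = (\<lambda>h. h + G) |`| left_opts H"
      "(\<lambda>g. g + H) |`| right_opts G = (\<lambda>g. H + g) |`| right_opts G"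
      "(\<lambda>h. G + h) |`| right_opts H = (\<lambda>h. h + G) |`| right_opts H"
      by (rule fimage_cong_fset, erule game)+
    then show ?case
      by (intro game_eqI) (simp_all add: sup_commute)
  qed
  show "G + H + K = G + (H + K)"
  proof (induction "(G, H, K)" arbitrary: G H K
      rule: measure_induct_rule[of "\<lambda>(G, H, K). size G + size H + size K"])
    case less
    have "(\<lambda>g. g + H + K) |`| left_opts G = (\<lambda>g. g + (H + K)) |`| left_opts G"
      "(\<lambda>h. G + h + K) |`| left_opts H = (\<lambda>h. G + (h + K)) |`| left_opts H"
      "(\<lambda>k. G + H + k) |`| left_opts K = (\<lambda>k. G + (H + k)) |`| left_opts K"
      "(\<lambda>g. g + H + K) |`| right_opts G = (\<lambda>g. g + (H + K)) |`| right_opts G"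
      "(\<lambda>h. G + h + K) |`| right_opts H = (\<lambda>h. G + (h + K)) |`| right_opts H"
      "(\<lambda>k. G + H + k) |`| right_opts K = (\<lambda>k. G + (H + k)) |`| right_opts K"
      by (rule fimage_cong_fset, rule less, simp add: size_left_opts size_right_opts)+
    then show ?case
      by (intro game_eqI) (simp_all add: fimage_funion fimage_fimage comp_def sup_assoc)
  qed
  show "0 + G = G"
  proof (induction G rule: game_induct)
    case (game G)
    have "(\<lambda>g. 0 + g) |`| left_opts G = (\<lambda>g. g) |`| left_opts G"
      "(\<lambda>g. 0 + g) |`| right_opts G = (\<lambda>g. g) |`| right_opts G"
      by (rule fimage_cong_fset, erule game)+
    then show ?case
      by (intro game_eqI) (simp_all add: fset.map_ident)
  qed
qed

lemma game_minus_minus [simp]: "- (- G) = G" for G :: game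
proof (induction G rule: game_induct)
  case (game G)
  have "(\<lambda>g. - (- g)) |`| left_opts G = (\<lambda>g. g) |`| left_opts G"
    "(\<lambda>g. - (- g)) |`| right_opts G = (\<lambda>g. g) |`| right_opts G"
    by (rule fimage_cong_fset, erule game)+
  then show ?case
    by (intro game_eqI) (simp_all add: fimage_fimage comp_def fset.map_ident)
qed

lemma game_minus_add: "- (G + H) = - G + - H" for G H :: game
proof (induction G H rule: game_induct2)
  case (game G H)
  have "(\<lambda>g. - (g + H)) |`| left_opts G = (\<lambda>g. - g + - H) |`| left_opts G"
    "(\<lambda>h. - (G + h)) |`| left_opts H = (\<lambda>h. - G + - h) |`| left_opts H"
    "(\<lambda>g. - (g + H)) |`| right_opts G = (\<lambda>g. - g + - H) |`| right_opts G"
    "(\<lambda>h. - (G + h)) |`| right_opts H = (\<lambda>h. - G + - h) |`| right_opts H"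
    by (rule fimage_cong_fset, erule game)+
  then show ?case
    by (intro game_eqI) (simp_all add: fimage_funion fimage_fimage comp_def)
qed

lemma game_minus_zero [simp]: "- 0 = (0 :: game)"
  by (rule game_eqI) simp_all

lemma game_minus_diff: "- (G - H) = H - G" for G H :: game
  by (simp add: minus_game_def game_minus_add add.commute)

lemma left_wins_first_iff: "left_wins_first G \<longleftrightarrow> (\<exists>g. g |\<in>| left_opts G \<and> left_wins_second g)"
  by (subst left_wins_first.simps) blast

lemma left_wins_second_iff: "left_wins_second G \<longleftrightarrow> (\<forall>g. g |\<in>| right_opts G \<longrightarrow> left_wins_first g)"
  by (subst left_wins_second.simps) blast

lemma left_wins_first_uminus:
  "left_wins_first G \<longleftrightarrow> \<not> left_wins_second (- G)"
  "left_wins_first (- G) \<longleftrightarrow> \<not> left_wins_second G"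
proof (induction G rule: game_induct)
  case (game G)
  {
    case 1
    show ?case
      unfolding left_wins_first_iff[of G] left_wins_second_iff[of "- G"] using game by auto
  next
    case 2
    show ?case
      unfolding left_wins_first_iff[of "- G"] left_wins_second_iff[of G] using game by auto
  }
qed

lemma game_le_iff:
  "G \<le> H \<longleftrightarrow> (\<forall>g. g |\<in>| left_opts G \<longrightarrow> \<not> H \<le> g) \<and> (\<forall>h. h |\<in>| right_opts H \<longrightarrow> \<not> h \<le> G)"
  for G H :: game
proof -
  have "G \<le> H \<longleftrightarrow> (\<forall>x. x |\<in>| right_opts (H - G) \<longrightarrow> \<not> left_wins_second (- x))"
    unfolding less_eq_game_def left_wins_second_iff[of "H - G"] left_wins_first_uminus(1) ..
  also have "\<dots> \<longleftrightarrow> (\<forall>g. g |\<in>| left_opts G \<longrightarrow> \<not> left_wins_second (- (H - g))) \<and>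
      (\<forall>h. h |\<in>| right_opts H \<longrightarrow> \<not> left_wins_second (- (h - G)))"
    by (auto simp: minus_game_def)
  finally show ?thesis
    by (simp add: less_eq_game_def game_minus_diff)
qed

lemma game_refl: "G \<le> G" for G :: game
proof (induction G rule: game_induct)
  case (game G)
  then show ?case
    by (subst game_le_iff) (metis game_le_iff)
qed

lemma game_trans: "G \<le> H \<Longrightarrow> H \<le> K \<Longrightarrow> G \<le> K" for G H K :: game
proof (induction "(G, H, K)" arbitrary: G H K
    rule: measure_induct_rule[of "\<lambda>(G, H, K). size G + size H + size K"])
  case less
  show ?case
  proof (subst game_le_iff, intro conjI allI impI notI)
    fix g assume g: "g |\<in>| left_opts G" "K \<le> g"
    have "H \<le> g"
      by (rule less(1)[OF _ less(3) g(2)]) (simp add: size_left_opts g)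
    with less(2) g(1) show False
      by (subst (asm) game_le_iff) blast
  next
    fix k assume k: "k |\<in>| right_opts K" "k \<le> G"
    have "k \<le> H"
      by (rule less(1)[OF _ k(2) less(2)]) (simp add: size_right_opts k)
    with less(3) k(1) show False
      by (subst (asm) game_le_iff) blast
  qed
qed

lemma left_wins_second_add:
  "left_wins_second G \<Longrightarrow> left_wins_second H \<Longrightarrow> left_wins_second (G + H)"
proof (induction "(G, H)" arbitrary: G H rule: measure_induct_rule[of "\<lambda>(G, H). size G + size H"])
  case less
  have *: "left_wins_first (x + K)"
    if x: "left_wins_first x" and K: "left_wins_second K" and lt: "size x + size K < size G + size H"
    for x K
  proof -
    obtain y where y: "y |\<in>| left_opts x" "left_wins_second y"
      using x left_wins_first_iff by blast
    have "left_wins_second (y + K)"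
      by (rule less(1)) (use y K lt size_left_opts[OF y(1)] in auto)
    then show ?thesis
      using y left_wins_first_iff[of "x + K"] by auto
  qed
  show ?case
  proof (subst left_wins_second_iff, intro allI impI)
    fix x assume "x |\<in>| right_opts (G + H)"
    then consider g where "g |\<in>| right_opts G" "x = g + H" | h where "h |\<in>| right_opts H" "x = G + h"
      by auto
    then show "left_wins_first x"
    proof cases
      case 1
      then show ?thesis
        using * less(2,3) left_wins_second_iff[of G] size_right_opts by simp
    next
      case 2
      then have "left_wins_first (h + G)"
        using * less(2,3) left_wins_second_iff[of H] size_right_opts by simp
      then show ?thesis
        by (simp add: 2 add.commute)
    qed
  qed
qed

lemma game_add_left_mono: "G \<le> H \<Longrightarrow> K + G \<le> K + H" for G H K :: game
proof -
  assume "G \<le> H"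
  then have "left_wins_second ((H - G) + (K - K))"
    using game_refl[of K] by (intro left_wins_second_add) (simp_all add: less_eq_game_def)
  also have "(H - G) + (K - K) = (K + H) - (K + G)"
    by (simp add: minus_game_def game_minus_add ac_simps)
  finally show ?thesis
    by (simp add: less_eq_game_def)
qed

lemma game_uminus_le_uminus: "- G \<le> - H \<longleftrightarrow> H \<le> G" for G H :: game
  by (simp add: less_eq_game_def minus_game_def add.commute)

lemma game_diff_self: "G - G \<approx> 0"
proof -
  have "left_wins_second (G - G)"
    using game_refl[of G] by (simp add: less_eq_game_def)
  then show ?thesis
    using game_minus_diff[of G G]
    by (simp add: game_eq_def less_eq_game_def) (simp add: minus_game_def)
qed

text \<open>
  The values of games form an ordered abelian group; passing to this quotient makes its
  arithmetic available to the simplifier.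
\<close>

quotient_type gval = game / game_eq
proof (rule equivpI)
  show "reflp game_eq"
    by (simp add: reflp_def game_eq_def game_refl)
  show "symp game_eq"
    by (simp add: symp_def game_eq_def)
  show "transp game_eq"
    unfolding transp_def game_eq_def by (meson game_trans)
qed

instantiation gval :: ordered_ab_group_add
begin

lift_definition zero_gval :: gval is "0 :: game" .

lift_definition plus_gval :: "gval \<Rightarrow> gval \<Rightarrow> gval" is "(+) :: game \<Rightarrow> game \<Rightarrow> game"
proof -
  fix G G' H H' :: game
  have le: "K + M \<le> K' + M'" if "K \<le> K'" "M \<le> M'" for K K' M M' :: game
    using game_trans[OF game_add_left_mono[OF that(2), of K] game_add_left_mono[OF that(1), of M', unfolded add.commute[of M']]] .
  assume "G \<approx> G'" "H \<approx> H'"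
  then show "G + H \<approx> G' + H'"
    by (simp add: game_eq_def le)
qed

lift_definition uminus_gval :: "gval \<Rightarrow> gval" is "uminus :: game \<Rightarrow> game"
  by (simp add: game_eq_def game_uminus_le_uminus)

definition minus_gval :: "gval \<Rightarrow> gval \<Rightarrow> gval" where
  "minus_gval x y = x + - y"

lift_definition less_eq_gval :: "gval \<Rightarrow> gval \<Rightarrow> bool" is "(\<le>) :: game \<Rightarrow> game \<Rightarrow> bool"
  unfolding game_eq_def by (meson game_trans)

definition less_gval :: "gval \<Rightarrow> gval \<Rightarrow> bool" where
  "less_gval x y \<longleftrightarrow> x \<le> y \<and> \<not> y \<le> x"

instance
proof
  fix x y z :: gval
  show "x + y + z = x + (y + z)"
    by transfer (simp add: add.assoc game_eq_def game_refl)
  show "x + y = y + x"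
    by transfer (simp add: add.commute game_eq_def game_refl)
  show "0 + x = x"
    by transfer (simp add: game_eq_def game_refl)
  show "- x + x = 0"
    by transfer (metis game_diff_self minus_game_def add.commute)
  show "x - y = x + - y"
    by (rule minus_gval_def)
  show "x < y \<longleftrightarrow> x \<le> y \<and> \<not> y \<le> x"
    by (rule less_gval_def)
  show "x \<le> x"
    by transfer (rule game_refl)
  show "x \<le> y \<Longrightarrow> y \<le> z \<Longrightarrow> x \<le> z"
    by transfer (rule game_trans)
  show "x \<le> y \<Longrightarrow> y \<le> x \<Longrightarrow> x = y"
    by transfer (simp add: game_eq_def)
  show "x \<le> y \<Longrightarrow> z + x \<le> z + y"
    by transfer (rule game_add_left_mono)
qed

end

lift_definition gv :: "game \<Rightarrow> gval" is "\<lambda>G. G" .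

lemma gv_simps [simp]:
  "gv 0 = 0" "gv (G + H) = gv G + gv H" "gv (- G) = - gv G" "gv (G - H) = gv G - gv H"
proof -
  show *: "gv 0 = 0" "gv (G + H) = gv G + gv H" "gv (- G) = - gv G" for G H
    by (transfer, simp add: game_eq_def game_refl)+
  show "gv (G - H) = gv G - gv H"
    by (simp add: minus_game_def *)
qed

lemma gv_le_iff: "gv G \<le> gv H \<longleftrightarrow> G \<le> H"
  by transfer simp

lemma gv_less_iff: "gv G < gv H \<longleftrightarrow> G < H"
  by (simp add: less_gval_def less_game_def gv_le_iff)

lemma gv_eq_iff: "gv G = gv H \<longleftrightarrow> G \<approx> H"
  by transfer simp

lemma gv_not_left_opt_ge: "g |\<in>| left_opts G \<Longrightarrow> \<not> gv G \<le> gv g"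
  using game_le_iff[of G G] by (simp add: game_refl gv_le_iff)

lemma gv_not_right_opt_le: "g |\<in>| right_opts G \<Longrightarrow> \<not> gv g \<le> gv G"
  using game_le_iff[of G G] by (simp add: game_refl gv_le_iff)

lemma gv_le_rec:
  "gv G \<le> gv H \<longleftrightarrow> (\<forall>g. g |\<in>| left_opts G \<longrightarrow> \<not> gv H \<le> gv g) \<and>
     (\<forall>h. h |\<in>| right_opts H \<longrightarrow> \<not> gv h \<le> gv G)"
  unfolding gv_le_iff by (rule game_le_iff)

section \<open>Numbers\<close>

lemma nat_game_add: "nat_game m + nat_game n = nat_game (m + n)"
proof (induction "m + n" arbitrary: m n)
  case (Suc k)
  show ?case
    by (cases m; cases n; intro game_eqI)
       (use Suc(1)[of "m - 1" n] Suc(1)[of m "n - 1"] Suc(2) in auto)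
qed (simp add: zero_game_def[symmetric])

lemma gv_int_game: "gv (int_game (int a - int b)) = gv (nat_game a) - gv (nat_game b)"
proof (cases "a \<ge> b")
  case True
  have "gv (nat_game (a - b)) + gv (nat_game b) = gv (nat_game a)"
    using True by (simp add: nat_game_add flip: gv_simps)
  then show ?thesis
    using True by (simp add: int_game_def nat_diff_distrib' flip: eq_diff_eq)
next
  case False
  have "gv (nat_game (b - a)) + gv (nat_game a) = gv (nat_game b)"
    using False by (simp add: nat_game_add flip: gv_simps)
  then show ?thesis
    using False by (auto simp: int_game_def nat_diff_distrib' algebra_simps)
qed

lemma gv_int_game_add: "gv (int_game m) + gv (int_game n) = gv (int_game (m + n))"
proof -
  obtain a b c d where "m = int a - int b" "n = int c - int d"
    by (metis int_diff_cases)
  moreover from this have "m + n = int (a + c) - int (b + d)"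
    by simp
  ultimately show ?thesis
    by (simp only: gv_int_game flip: nat_game_add) simp
qed

lemma opts_int_game:
  "g |\<in>| left_opts (int_game m) \<Longrightarrow> g = int_game (m - 1)"
  "g |\<in>| right_opts (int_game m) \<Longrightarrow> g = int_game (m + 1)"
proof -
  have nat_opts: "x |\<in>| left_opts (nat_game n) \<Longrightarrow> n > 0 \<and> x = nat_game (n - 1)"
      "x |\<notin>| right_opts (nat_game n)" for x n
    by (cases n; simp)+
  show "g |\<in>| left_opts (int_game m) \<Longrightarrow> g = int_game (m - 1)"
    by (auto simp: int_game_def nat_opts nat_diff_distrib dest!: nat_opts(1) split: if_splits)
  show "g |\<in>| right_opts (int_game m) \<Longrightarrow> g = int_game (m + 1)"
    by (auto simp: int_game_def nat_opts nat_diff_distrib dest!: nat_opts(1) split: if_splits)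
qed

abbreviation dv :: "nat \<Rightarrow> int \<Rightarrow> gval" where
  "dv k m \<equiv> gv (dyadic_game k m)"

lemma dv_properties:
  shows dv_add: "dv k m + dv k n = dv k (m + n)"
    and dv_step: "dv k m < dv k (m + 1)"
    and dv_left_opt: "g |\<in>| left_opts (dyadic_game k m) \<Longrightarrow> gv g \<le> dv k (m - 1)"
    and dv_right_opt: "g |\<in>| right_opts (dyadic_game k m) \<Longrightarrow> dv k (m + 1) \<le> gv g"
proof (induction k arbitrary: m n g)
  case 0
  have pos: "gv (int_game 1) > 0"
  proof -
    have "gv 0 \<le> gv (int_game 1)"
      by (subst gv_le_rec) (simp add: int_game_def)
    moreover have "\<not> gv (int_game 1) \<le> gv 0"
      by (rule gv_not_left_opt_ge) (simp add: int_game_def)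
    ultimately show ?thesis
      by (simp add: less_le_not_le)
  qed
  {
    case 1
    show ?case by (simp add: gv_int_game_add )
  next
    case 2
    show ?case using pos by (simp flip: gv_int_game_add)
  next
    case 3
    then show ?case by (auto simp: game_refl dest: opts_int_game)
  next
    case 4
    then show ?case by (auto simp: game_refl dest: opts_int_game)
  }
next
  case (Suc k)
  note IH = Suc.IH
  define X where "X a = dyadic_game (Suc k) (2 * a + 1)" for a
  have X_opts: "left_opts (X a) = {|dyadic_game k a|}" "right_opts (X a) = {|dyadic_game k (a + 1)|}" for a
    by (simp_all add: X_def add.commute)
  have X_gt: "dv k a < gv (X a)" for a
  proof -
    have not: "\<not> gv (X a) \<le> dv k a"
      by (rule gv_not_left_opt_ge) (simp add: X_opts)
    moreover have "dv k a \<le> gv (X a)"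
    proof (subst gv_le_rec, intro conjI allI impI)
      fix g assume "g |\<in>| left_opts (dyadic_game k a)"
      then have "gv g \<le> dv k a"
        using IH(3)[of g a] IH(2)[of "a - 1"] by (metis diff_add_cancel less_imp_le order_trans)
      then show "\<not> gv (X a) \<le> gv g"
        using not by (meson order_trans)
    next
      fix h assume "h |\<in>| right_opts (X a)"
      then show "\<not> gv h \<le> dv k a"
        using IH(2)[of a] by (auto simp: X_opts less_le_not_le)
    qed
    ultimately show ?thesis
      by (simp add: less_le_not_le)
  qed
  have X_less: "gv (X a) < dv k (a + 1)" for a
  proof -
    have not: "\<not> dv k (a + 1) \<le> gv (X a)"
      by (rule gv_not_right_opt_le) (simp add: X_opts)
    moreover have "gv (X a) \<le> dv k (a + 1)"
    proof (subst gv_le_rec, intro conjI allI impI)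
      fix g assume "g |\<in>| left_opts (X a)"
      then show "\<not> dv k (a + 1) \<le> gv g"
        using IH(2)[of a] by (auto simp: X_opts less_le_not_le)
    next
      fix h assume "h |\<in>| right_opts (dyadic_game k (a + 1))"
      then have "dv k (a + 1) \<le> gv h"
        using IH(4)[of h "a + 1"] IH(2)[of "a + 1"] by (meson less_imp_le order_trans)
      then show "\<not> gv h \<le> gv (X a)"
        using not by (meson order_trans)
    qed
    ultimately show ?thesis
      by (simp add: less_le_not_le)
  qed
  have even: "dyadic_game (Suc k) (2 * a) = dyadic_game k a" for a
    by simp
  have split: "\<exists>a. m = 2 * a \<or> m = 2 * a + 1" for m :: int
    by presburger
  have add_X: "dv k m + gv (X n) = gv (X (m + n))" for m n
  proof (rule antisym)
    have less: "dv k m + gv (X n) < dv k (m + n + 1)"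
      using add_strict_left_mono[OF X_less[of n], of "dv k m"] by (simp add: IH(1) algebra_simps)
    have gt: "dv k (m + n) < dv k m + gv (X n)"
      using add_strict_left_mono[OF X_gt[of n], of "dv k m"] by (simp add: IH(1) algebra_simps)
    show "dv k m + gv (X n) \<le> gv (X (m + n))"
    proof (subst gv_simps(2)[symmetric], subst gv_le_rec, intro conjI allI impI)
      fix g assume "g |\<in>| left_opts (dyadic_game k m + X n)"
      then consider c where "c |\<in>| left_opts (dyadic_game k m)" "g = c + X n"
        | "g = dyadic_game k m + dyadic_game k n"
        by (auto simp: X_opts)
      then have "gv g \<le> dv k (m + n)"
      proof cases
        case 1
        then show ?thesis
          using add_mono[OF IH(3)[of c m] less_imp_le[OF X_less[of n]]] IH(1)[of "m - 1" "n + 1"]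
          by simp
      qed (simp add: IH(1))
      then show "\<not> gv (X (m + n)) \<le> gv g"
        using X_gt[of "m + n"] by (meson less_le_not_le order_trans)
    next
      fix h assume "h |\<in>| right_opts (X (m + n))"
      then show "\<not> gv h \<le> gv (dyadic_game k m + X n)"
        using less by (simp add: X_opts less_le_not_le)
    qed
    show "gv (X (m + n)) \<le> dv k m + gv (X n)"
    proof (subst gv_simps(2)[symmetric], subst gv_le_rec, intro conjI allI impI)
      fix g assume "g |\<in>| right_opts (dyadic_game k m + X n)"
      then consider c where "c |\<in>| right_opts (dyadic_game k m)" "g = c + X n"
        | "g = dyadic_game k m + dyadic_game k (n + 1)"
        by (auto simp: X_opts)
      then have "dv k (m + n + 1) \<le> gv g"
      proof cases
        case 1
        then show ?thesis
          using add_mono[OF IH(4)[of c m] less_imp_le[OF X_gt[of n]]] IH(1)[of "m + 1" "n"]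
          by (simp add: algebra_simps)
      qed (simp add: IH(1) algebra_simps)
      then show "\<not> gv g \<le> gv (X (m + n))"
        using X_less[of "m + n"] by (meson less_le_not_le order_trans)
    next
      fix h assume "h |\<in>| left_opts (X (m + n))"
      then show "\<not> gv (dyadic_game k m + X n) \<le> gv h"
        using gt by (simp add: X_opts less_le_not_le)
    qed
  qed
  have X_add_X: "gv (X m) + gv (X n) = dv k (m + n + 1)" for m n
  proof (rule antisym)
    have less: "gv (X m) + gv (X n) < dv k (m + n + 2)"
      using add_strict_mono[OF X_less[of m] X_less[of n]] by (simp add: IH(1) algebra_simps)
    have gt: "dv k (m + n) < gv (X m) + gv (X n)"
      using add_strict_mono[OF X_gt[of m] X_gt[of n]] by (simp add: IH(1) algebra_simps)
    have X_bounds: "dv k (m + n) < gv (X (m + n))" "gv (X (m + n)) < dv k (m + n + 1)"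
      "gv (X (m + n + 1)) < dv k (m + n + 2)" "dv k (m + n + 1) < gv (X (m + n + 1))"
      using X_gt[of "m + n"] X_less[of "m + n"] X_less[of "m + n + 1"] X_gt[of "m + n + 1"]
      by (simp_all add: add.assoc)
    show "gv (X m) + gv (X n) \<le> dv k (m + n + 1)"
    proof (subst gv_simps(2)[symmetric], subst gv_le_rec, intro conjI allI impI)
      fix g assume "g |\<in>| left_opts (X m + X n)"
      then have "g = X n + dyadic_game k m \<or> g = X m + dyadic_game k n"
        by (auto simp: X_opts add.commute)
      then have "gv g = gv (X (m + n))"
        using add_X[of m n] add_X[of n m] by (metis add.commute gv_simps(2))
      then show "\<not> dv k (m + n + 1) \<le> gv g"
        using X_bounds by (simp add: less_le_not_le)
    next
      fix h assume "h |\<in>| right_opts (dyadic_game k (m + n + 1))"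
      then have "dv k (m + n + 2) \<le> gv h"
        using IH(4)[of h "m + n + 1"] by (simp add: add.assoc)
      then show "\<not> gv h \<le> gv (X m + X n)"
        using less by (simp add: less_le_not_le) (meson order_trans)
    qed
    show "dv k (m + n + 1) \<le> gv (X m) + gv (X n)"
    proof (subst gv_simps(2)[symmetric], subst gv_le_rec, intro conjI allI impI)
      fix g assume "g |\<in>| right_opts (X m + X n)"
      then have "g = X n + dyadic_game k (m + 1) \<or> g = X m + dyadic_game k (n + 1)"
        by (auto simp: X_opts add.commute)
      moreover have "m + 1 + n = m + n + 1" "n + 1 + m = m + n + 1"
        by simp_all
      ultimately have "gv g = gv (X (m + n + 1))"
        using add_X[of "m + 1" n] add_X[of "n + 1" m] by (metis add.commute gv_simps(2))
      then show "\<not> gv g \<le> dv k (m + n + 1)"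
        using X_bounds by (simp add: less_le_not_le)
    next
      fix h assume "h |\<in>| left_opts (dyadic_game k (m + n + 1))"
      then have "gv h \<le> dv k (m + n)"
        using IH(3)[of h "m + n + 1"] by simp
      then show "\<not> gv (X m + X n) \<le> gv h"
        using gt by (simp add: less_le_not_le) (meson order_trans)
    qed
  qed
  {
    case 1
    have odd: "dyadic_game (Suc k) (2 * a + 1) = X a" for a
      by (simp only: X_def)
    obtain a b where "m = 2 * a \<or> m = 2 * a + 1" "n = 2 * b \<or> n = 2 * b + 1"
      using split by meson
    then consider "m = 2 * a" "n = 2 * b" "m + n = 2 * (a + b)"
      | "m = 2 * a + 1" "n = 2 * b" "m + n = 2 * (a + b) + 1"
      | "m = 2 * a" "n = 2 * b + 1" "m + n = 2 * (a + b) + 1"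
      | "m = 2 * a + 1" "n = 2 * b + 1" "m + n = 2 * (a + b + 1)"
      by fastforce
    then show ?case
    proof cases
      case 1
      show ?thesis unfolding 1(3) unfolding 1 even by (rule IH(1))
    next
      case 2
      show ?thesis unfolding 2(3) unfolding 2 even odd by (metis add_X add.commute)
    next
      case 3
      show ?thesis unfolding 3(3) unfolding 3 even odd by (rule add_X)
    next
      case 4
      show ?thesis unfolding 4(3) unfolding 4 even odd by (rule X_add_X)
    qed
  next
    case 2
    obtain a where "m = 2 * a \<or> m = 2 * a + 1"
      using split by meson
    moreover have "2 * a + 1 + 1 = 2 * (a + 1)"
      by simp
    ultimately show ?case
      using X_gt[of a] X_less[of a] by (metis X_def even)
  next
    case 3
    obtain a where "m = 2 * a \<or> m = 2 * a + 1"
      using split by meson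
    then show ?case
    proof
      assume m: "m = 2 * a"
      have "gv g \<le> dv k (a - 1)"
        using 3 IH(3)[of g a] by (simp only: m even)
      also have "\<dots> < gv (X (a - 1))"
        by (rule X_gt)
      also have "X (a - 1) = dyadic_game (Suc k) (m - 1)"
        by (simp only: X_def m) (simp add: algebra_simps)
      finally show ?thesis
        by simp
    next
      assume "m = 2 * a + 1"
      then show ?thesis
        using 3 by (simp add: game_refl)
    qed
  next
    case 4
    obtain a where "m = 2 * a \<or> m = 2 * a + 1"
      using split by meson
    then show ?case
    proof
      assume m: "m = 2 * a"
      have "dyadic_game (Suc k) (m + 1) = X a"
        by (simp only: X_def m)
      also have "gv \<dots> < dv k (a + 1)"
        by (rule X_less)
      also have "\<dots> \<le> gv g"
        using 4 IH(4)[of g a] by (simp only: m even)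
      finally show ?thesis
        by simp
    next
      assume m: "m = 2 * a + 1"
      moreover have "(2 * a + 2) div 2 = a + 1"
        by presburger
      ultimately show ?thesis
        using 4 by (simp add: game_refl)
    qed
  }
qed

lemma dyadic_game_eq_num: "dyadic_game k m = num (of_int m / 2 ^ k)"
proof (induction k arbitrary: m)
  case 0
  have "(LEAST k. (of_int m :: rat) * 2 ^ k \<in> \<int>) = 0"
    by (rule Least_equality) auto
  then show ?case
    by (simp add: num_def)
next
  case (Suc k)
  show ?case
  proof (cases "even m")
    case True
    then obtain a where "m = 2 * a" by blast
    then show ?thesis
      by (simp add: Suc)
  next
    case False
    have "(LEAST j. (of_int m :: rat) / 2 ^ Suc k * 2 ^ j \<in> \<int>) = Suc k"
    proof (rule Least_equality)
      fix j assume "(of_int m :: rat) / 2 ^ Suc k * 2 ^ j \<in> \<int>"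
      then obtain z where z: "(of_int m :: rat) / 2 ^ Suc k * 2 ^ j = of_int z"
        by (elim Ints_cases)
      show "Suc k \<le> j"
      proof (rule ccontr)
        assume "\<not> Suc k \<le> j"
        then have "(2 :: rat) ^ Suc k = 2 ^ j * 2 ^ Suc (k - j)"
          by (simp add: Suc_diff_le flip: power_add)
        with z have "(of_int m :: rat) = of_int (z * 2 ^ Suc (k - j))"
          by (simp add: field_simps)
        then have "m = z * 2 ^ Suc (k - j)"
          by (simp only: of_int_eq_iff)
        with False show False
          by simp
      qed
    qed simp
    then have "num (of_int m / 2 ^ Suc k) = dyadic_game (Suc k) \<lfloor>(of_int m :: rat) / 2 ^ Suc k * 2 ^ Suc k\<rfloor>"
      unfolding num_def by (simp only: Let_def)
    also have "(of_int m :: rat) / 2 ^ Suc k * 2 ^ Suc k = of_int m"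
      by simp
    finally show ?thesis
      by (simp only: floor_of_int)
  qed
qed

lemma dyadic_common:
  assumes "dyadic x" "dyadic y"
  obtains k m n where "x = of_int m / 2 ^ k" "y = of_int n / 2 ^ k"
proof -
  obtain m i n j where xy: "x = of_int m / 2 ^ i" "y = of_int n / 2 ^ j"
    using assms by (auto simp: dyadic_def)
  show thesis
    by (rule that[of "m * 2 ^ j" "i + j" "n * 2 ^ i"]) (simp_all add: xy power_add)
qed

lemma dyadic_add: "dyadic x \<Longrightarrow> dyadic y \<Longrightarrow> dyadic (x + y)"
proof -
  assume "dyadic x" "dyadic y"
  then obtain k m n where "x = of_int m / 2 ^ k" "y = of_int n / 2 ^ k"
    by (rule dyadic_common)
  then have "x + y = of_int (m + n) / 2 ^ k"
    by (simp add: add_divide_distrib)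
  then show ?thesis
    unfolding dyadic_def by blast
qed

lemma dyadic_uminus: "dyadic x \<Longrightarrow> dyadic (- x)"
  unfolding dyadic_def by (metis of_int_minus minus_divide_left)

lemma dyadic_diff: "dyadic x \<Longrightarrow> dyadic y \<Longrightarrow> dyadic (x - y)"
  using dyadic_add[OF _ dyadic_uminus] by simp

lemma dyadic_half: "dyadic x \<Longrightarrow> dyadic (x / 2)"
  unfolding dyadic_def by (metis divide_divide_eq_left power_Suc2)

lemma dyadic_of_int [simp]: "dyadic (of_int m)"
  unfolding dyadic_def by (metis div_by_1 power_0)

lemma dyadic_0_1 [simp]: "dyadic 0" "dyadic 1"
  using dyadic_of_int[of 0] dyadic_of_int[of 1] by (simp_all del: dyadic_of_int)

lemma dyadic_power [simp]: "dyadic (1 / 2 ^ n)"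
  unfolding dyadic_def by (metis of_int_1)

lemma gv_num_add:
  "dyadic x \<Longrightarrow> dyadic y \<Longrightarrow> gv (num (x + y)) = gv (num x) + gv (num y)"
  by (erule (1) dyadic_common)
     (simp add: dv_add flip: dyadic_game_eq_num of_int_add add_divide_distrib)

lemma num_0 [simp]: "num 0 = 0"
  using dyadic_game_eq_num[of 0 0] by (simp add: int_game_def)

lemma gv_num_uminus: "dyadic x \<Longrightarrow> gv (num (- x)) = - gv (num x)"
  using gv_num_add[of x "- x"] by (simp add: dyadic_uminus eq_neg_iff_add_eq_0 add.commute)

lemma gv_num_diff:
  "dyadic x \<Longrightarrow> dyadic y \<Longrightarrow> gv (num (x - y)) = gv (num x) - gv (num y)"
  using gv_num_add[of x "- y"] by (simp add: dyadic_uminus gv_num_uminus)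

lemma dv_less: "m < n \<Longrightarrow> dv k m < dv k n"
proof (induction n rule: int_gr_induct)
  case base
  show ?case by (rule dv_step)
next
  case (step n)
  then show ?case
    using dv_step[of k n] by (meson less_trans)
qed

lemma gv_num_less_iff:
  assumes "dyadic x" "dyadic y"
  shows "gv (num x) < gv (num y) \<longleftrightarrow> x < y"
proof -
  have less: "gv (num x) < gv (num y)" if "x < y" "dyadic x" "dyadic y" for x y
  proof -
    obtain k m n where xy: "x = of_int m / 2 ^ k" "y = of_int n / 2 ^ k"
      using \<open>dyadic x\<close> \<open>dyadic y\<close> by (rule dyadic_common)
    with \<open>x < y\<close> have "m < n"
      by (simp add: divide_less_cancel)
    then show ?thesis
      unfolding xy dyadic_game_eq_num[symmetric] by (rule dv_less)
  qed
  consider "x < y" | "x = y" | "y < x"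
    by linarith
  then show ?thesis
  proof cases
    case 1
    then show ?thesis
      using less[OF 1 assms] by simp
  next
    case 2
    then show ?thesis
      by simp
  next
    case 3
    then show ?thesis
      using less[OF 3 assms(2,1)] by (simp add: less_le_not_le)
  qed
qed

lemma gv_num_eq_iff: "dyadic x \<Longrightarrow> dyadic y \<Longrightarrow> gv (num x) = gv (num y) \<longleftrightarrow> x = y"
  by (metis gv_num_less_iff less_irrefl linorder_neqE)

lemma gv_num_le_iff: "dyadic x \<Longrightarrow> dyadic y \<Longrightarrow> gv (num x) \<le> gv (num y) \<longleftrightarrow> x \<le> y"
  by (metis gv_num_less_iff gv_num_eq_iff le_less)

lemma opts_dyadic_game:
  assumes "g |\<in>| left_opts (dyadic_game k m) |\<union>| right_opts (dyadic_game k m)"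
  shows "\<exists>j n. g = dyadic_game j n"
  using assms
proof (induction k arbitrary: m)
  case 0
  then have "g = dyadic_game 0 (m - 1) \<or> g = dyadic_game 0 (m + 1)"
    by (auto dest: opts_int_game)
  then show ?case
    by blast
qed (auto split: if_splits)

lemma left_opt_num:
  assumes "dyadic x" "g |\<in>| left_opts (num x)"
  obtains y where "dyadic y" "g = num y" "y < x"
proof -
  obtain m k where x: "x = of_int m / 2 ^ k"
    using assms(1) by (auto simp: dyadic_def)
  have g: "g |\<in>| left_opts (dyadic_game k m)"
    using assms(2) by (simp add: dyadic_game_eq_num x)
  with opts_dyadic_game[of g k m] obtain j n where "g = dyadic_game j n"
    by auto
  then have y: "g = num (of_int n / 2 ^ j)"
    by (simp add: dyadic_game_eq_num)
  have "gv g < dv k m"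
    using dv_left_opt[OF g] dv_step[of k "m - 1"] by simp
  then have "of_int n / 2 ^ j < x"
    unfolding y dyadic_game_eq_num x[symmetric]
    by (subst (asm) gv_num_less_iff) (use assms(1) in \<open>auto simp: dyadic_def\<close>)
  then show thesis
    using that[OF _ y] by (auto simp: dyadic_def)
qed

lemma right_opt_num:
  assumes "dyadic x" "g |\<in>| right_opts (num x)"
  obtains y where "dyadic y" "g = num y" "x < y"
proof -
  obtain m k where x: "x = of_int m / 2 ^ k"
    using assms(1) by (auto simp: dyadic_def)
  have g: "g |\<in>| right_opts (dyadic_game k m)"
    using assms(2) by (simp add: dyadic_game_eq_num x)
  with opts_dyadic_game[of g k m] obtain j n where "g = dyadic_game j n"
    by auto
  then have y: "g = num (of_int n / 2 ^ j)"
    by (simp add: dyadic_game_eq_num)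
  have "dv k m < gv g"
    using dv_right_opt[OF g] dv_step[of k m] by simp
  then have "x < of_int n / 2 ^ j"
    unfolding y dyadic_game_eq_num x[symmetric]
    by (subst (asm) gv_num_less_iff) (use assms(1) in \<open>auto simp: dyadic_def\<close>)
  then show thesis
    using that[OF _ y] by (auto simp: dyadic_def)
qed

lemma num_midpoint:
  "num ((2 * of_int m + 1) / 2 ^ Suc k) = Game {|num (of_int m / 2 ^ k)|} {|num (of_int (m + 1) / 2 ^ k)|}"
proof -
  have "num ((2 * of_int m + 1) / 2 ^ Suc k) = dyadic_game (Suc k) (2 * m + 1)"
    by (subst dyadic_game_eq_num) simp
  also have "\<dots> = Game {|dyadic_game k m|} {|dyadic_game k (m + 1)|}"
  proof -
    have "(2 * m + 2) div 2 = m + 1"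
      by presburger
    then show ?thesis
      by (simp add: add.commute)
  qed
  finally show ?thesis
    by (simp only: dyadic_game_eq_num)
qed

text \<open>
  A weak form of the simplicity theorem: of the numbers between the Left and the Right
  options, the one of smallest form equals the game.
\<close>

lemma is_numberI_between:
  assumes "dyadic y"
    and "\<And>g. g |\<in>| left_opts G \<Longrightarrow> \<not> gv (num y) \<le> gv g"
    and "\<And>g. g |\<in>| right_opts G \<Longrightarrow> \<not> gv g \<le> gv (num y)"
  shows "is_number G"
  using assms
proof (induction y rule: measure_induct_rule[of "\<lambda>y. size (num y)"])
  case (less y)
  consider "gv G = gv (num y)" | "\<not> gv G \<le> gv (num y)" | "\<not> gv (num y) \<le> gv G"
    by (meson antisym)
  then show ?case
  proof cases
    case 1
    then show ?thesis
      using less.prems(1) by (auto simp: is_number_def gv_eq_iff)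
  next
    case 2
    then obtain z where z: "z |\<in>| right_opts (num y)" "gv z \<le> gv G"
      using less.prems(2) gv_le_rec[of G "num y"] by blast
    obtain x where x: "dyadic x" "z = num x" "y < x"
      using less.prems(1) z(1) by (rule right_opt_num)
    have "gv (num y) \<le> gv (num x)"
      using x less.prems(1) by (simp add: gv_num_le_iff)
    show ?thesis
    proof (rule less.IH[of x])
      show "size (num x) < size (num y)"
        using size_right_opts[OF z(1)] by (simp add: x)
      show "dyadic x" by fact
      show "\<not> gv (num x) \<le> gv g" if "g |\<in>| left_opts G" for g
        using \<open>gv (num y) \<le> gv (num x)\<close> less.prems(2)[OF that] by (meson order_trans)
      show "\<not> gv g \<le> gv (num x)" if "g |\<in>| right_opts G" for g
        using gv_not_right_opt_le[OF that] z(2) unfolding x by (meson order_trans)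
    qed
  next
    case 3
    then obtain z where z: "z |\<in>| left_opts (num y)" "gv G \<le> gv z"
      using less.prems(3) gv_le_rec[of "num y" G] by blast
    obtain x where x: "dyadic x" "z = num x" "x < y"
      using less.prems(1) z(1) by (rule left_opt_num)
    have "gv (num x) \<le> gv (num y)"
      using x less.prems(1) by (simp add: gv_num_le_iff)
    show ?thesis
    proof (rule less.IH[of x])
      show "size (num x) < size (num y)"
        using size_left_opts[OF z(1)] by (simp add: x)
      show "dyadic x" by fact
      show "\<not> gv g \<le> gv (num x)" if "g |\<in>| right_opts G" for g
        using \<open>gv (num x) \<le> gv (num y)\<close> less.prems(3)[OF that] by (meson order_trans)
      show "\<not> gv (num x) \<le> gv g" if "g |\<in>| left_opts G" for g
        using gv_not_left_opt_ge[OF that] z(2) unfolding x by (meson order_trans)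
    qed
  qed
qed

lemma is_numberE:
  assumes "is_number G"
  obtains x where "dyadic x" "gv G = gv (num x)"
  using assms by (auto simp: is_number_def gv_eq_iff)

lemma number_value_eq:
  assumes "dyadic x" "gv G = gv (num x)"
  shows "number_value G = x"
  unfolding number_value_def
proof (rule the_equality)
  show "dyadic x \<and> G \<approx> num x"
    using assms by (simp add: gv_eq_iff)
  show "y = x" if "dyadic y \<and> G \<approx> num y" for y
    using that assms gv_num_eq_iff[of x y] by (metis gv_eq_iff)
qed

lemma is_number_num: "dyadic x \<Longrightarrow> is_number (num x)"
  unfolding is_number_def by (metis gv_eq_iff)

section \<open>Canonical forms\<close>

lemma subposition_trans_opt:
  "subposition H g \<Longrightarrow> g |\<in>| left_opts G |\<union>| right_opts G \<Longrightarrow> subposition H G"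
  by (induction rule: subposition.induct) (blast intro: subposition.intros)+

lemma canonical_opt:
  "canonical G \<Longrightarrow> g |\<in>| left_opts G |\<union>| right_opts G \<Longrightarrow> canonical g"
  unfolding canonical_def using subposition_trans_opt by blast

lemma canonical_unique:
  "canonical K \<Longrightarrow> canonical K' \<Longrightarrow> gv K = gv K' \<Longrightarrow> K = K'"
proof (induction K arbitrary: K' rule: game_induct)
  case (game K)
  have can: "\<And>g. g |\<in>| left_opts H \<Longrightarrow> \<not> left_dominated H g \<and> \<not> left_reversible H g"
    "\<And>g. g |\<in>| right_opts H \<Longrightarrow> \<not> right_dominated H g \<and> \<not> right_reversible H g" if "canonical H" for H
    using that subposition.intros(1)[of H] unfolding canonical_def by blast+
  have left: "\<exists>h. h |\<in>| left_opts H' \<and> gv g \<le> gv h"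
    if "canonical H" "gv H = gv H'" "g |\<in>| left_opts H" for H H' g
  proof -
    have "\<not> gv H' \<le> gv g"
      using gv_not_left_opt_ge that by metis
    moreover have "\<not> gv r \<le> gv H'" if "r |\<in>| right_opts g" for r
      using can(1)[OF \<open>canonical H\<close> \<open>g |\<in>| left_opts H\<close>] that \<open>gv H = gv H'\<close>
      unfolding left_reversible_def gv_le_iff[symmetric] by metis
    ultimately show ?thesis
      using gv_le_rec[of H' g] by blast
  qed
  have right: "\<exists>h. h |\<in>| right_opts H' \<and> gv h \<le> gv g"
    if "canonical H" "gv H = gv H'" "g |\<in>| right_opts H" for H H' g
  proof -
    have "\<not> gv g \<le> gv H'"
      using gv_not_right_opt_le that by metis
    moreover have "\<not> gv H' \<le> gv r" if "r |\<in>| left_opts g" for r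
      using can(2)[OF \<open>canonical H\<close> \<open>g |\<in>| right_opts H\<close>] that \<open>gv H = gv H'\<close>
      unfolding right_reversible_def gv_le_iff[symmetric] by metis
    ultimately show ?thesis
      using gv_le_rec[of g H'] by blast
  qed
  have eq_left: "g = h" if "canonical H" "g |\<in>| left_opts H" "h |\<in>| left_opts H" "gv g \<le> gv h" for H g h
    using can(1)[OF that(1,2)] that(3,4) unfolding left_dominated_def gv_le_iff[symmetric] by metis
  have eq_right: "g = h" if "canonical H" "g |\<in>| right_opts H" "h |\<in>| right_opts H" "gv h \<le> gv g" for H g h
    using can(2)[OF that(1,2)] that(3,4) unfolding right_dominated_def gv_le_iff[symmetric] by metis
  note K = game.prems
  note K_sym = K(3)[symmetric]
  have opts: "canonical g" "canonical h" if "g |\<in>| left_opts K |\<union>| right_opts K" "h |\<in>| left_opts K' |\<union>| right_opts K'" for g h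
    using canonical_opt K(1,2) that by blast+
  show ?case
  proof (rule game_eqI)
    show "left_opts K = left_opts K'"
    proof (intro fset_eqI iffI)
      fix g assume g: "g |\<in>| left_opts K"
      obtain h where h: "h |\<in>| left_opts K'" "gv g \<le> gv h"
        using left[OF K(1,3) g] by blast
      obtain g' where g': "g' |\<in>| left_opts K" "gv h \<le> gv g'"
        using left[OF K(2) K_sym h(1)] by blast
      have "g = g'"
        using eq_left[OF K(1) g g'(1)] h(2) g'(2) by (meson order_trans)
      then have "g = h"
        using game.IH(1)[OF g, of h] opts[of g h] g h g' by simp
      then show "g |\<in>| left_opts K'"
        using h by simp
    next
      fix h assume h: "h |\<in>| left_opts K'"
      obtain g where g: "g |\<in>| left_opts K" "gv h \<le> gv g"
        using left[OF K(2) K_sym h] by blast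
      obtain h' where h': "h' |\<in>| left_opts K'" "gv g \<le> gv h'"
        using left[OF K(1,3) g(1)] by blast
      have "h = h'"
        using eq_left[OF K(2) h h'(1)] h'(2) g(2) by (meson order_trans)
      then have "g = h"
        using game.IH(1)[OF g(1), of h] opts[of g h] g h h' by simp
      then show "h |\<in>| left_opts K"
        using g by simp
    qed
    show "right_opts K = right_opts K'"
    proof (intro fset_eqI iffI)
      fix g assume g: "g |\<in>| right_opts K"
      obtain h where h: "h |\<in>| right_opts K'" "gv h \<le> gv g"
        using right[OF K(1,3) g] by blast
      obtain g' where g': "g' |\<in>| right_opts K" "gv g' \<le> gv h"
        using right[OF K(2) K_sym h(1)] by blast
      have "g = g'"
        using eq_right[OF K(1) g g'(1)] h(2) g'(2) by (meson order_trans)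
      then have "g = h"
        using game.IH(2)[OF g, of h] opts[of g h] g h g' by simp
      then show "g |\<in>| right_opts K'"
        using h by simp
    next
      fix h assume h: "h |\<in>| right_opts K'"
      obtain g where g: "g |\<in>| right_opts K" "gv g \<le> gv h"
        using right[OF K(2) K_sym h] by blast
      obtain h' where h': "h' |\<in>| right_opts K'" "gv h' \<le> gv g"
        using right[OF K(1,3) g(1)] by blast
      have "h = h'"
        using eq_right[OF K(2) h h'(1)] h'(2) g(2) by (meson order_trans)
      then have "g = h"
        using game.IH(2)[OF g(1), of h] opts[of g h] g h h' by simp
      then show "h |\<in>| right_opts K"
        using g by simp
    qed
  qed
qed

lemma subposition_num:
  assumes "subposition H (num x)" "dyadic x"
  obtains y where "dyadic y" "H = num y"
proof -
  have "subposition H G \<Longrightarrow> G = num x \<Longrightarrow> \<exists>y. dyadic y \<and> H = num y" for G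
  proof (induction rule: subposition.induct)
    case (2 H G K)
    then show ?case
      by (auto elim: left_opt_num right_opt_num)
  qed (use assms in auto)
  then show thesis
    using that assms(1) by blast
qed

lemma dyadic_game_not_reversible:
  "g |\<in>| left_opts (dyadic_game k m) \<Longrightarrow> r |\<in>| right_opts g \<Longrightarrow> dv k m < gv r"
  "g |\<in>| right_opts (dyadic_game k m) \<Longrightarrow> r |\<in>| left_opts g \<Longrightarrow> gv r < dv k m"
proof (induction k arbitrary: m)
  case 0
  have no_opts: "left_opts (int_game i) \<noteq> {||} \<Longrightarrow> i \<ge> 1" "right_opts (int_game i) \<noteq> {||} \<Longrightarrow> i \<le> -1" for i
  proof -
    have "right_opts (nat_game n) = {||}" "left_opts (nat_game 0) = {||}" for n
      by (cases n; simp)+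
    then show "left_opts (int_game i) \<noteq> {||} \<Longrightarrow> i \<ge> 1" "right_opts (int_game i) \<noteq> {||} \<Longrightarrow> i \<le> -1"
      by (cases "i = 0"; force simp: int_game_def split: if_splits)+
  qed
  {
    case 1
    then show ?case
      using no_opts(1)[of m] no_opts(2)[of "m - 1"] by (force dest: opts_int_game)
  next
    case 2
    then show ?case
      using no_opts(2)[of m] no_opts(1)[of "m + 1"] by (force dest: opts_int_game)
  }
next
  case (Suc k)
  have split: "\<exists>a. m = 2 * a \<or> m = 2 * a + 1" for m :: int
    by presburger
  have even: "dyadic_game (Suc k) (2 * a) = dyadic_game k a" for a
    by simp
  have odd: "left_opts (dyadic_game (Suc k) (2 * a + 1)) = {|dyadic_game k a|}"
    "right_opts (dyadic_game (Suc k) (2 * a + 1)) = {|dyadic_game k (a + 1)|}" for a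
    by (simp_all add: add.commute)
  have between: "dv k a < dv (Suc k) (2 * a + 1)" "dv (Suc k) (2 * a + 1) < dv k (a + 1)" for a
    using dv_less[of "2 * a" "2 * a + 1" "Suc k"] dv_less[of "2 * a + 1" "2 * (a + 1)" "Suc k"]
    unfolding even by auto
  {
    case 1
    obtain a where "m = 2 * a \<or> m = 2 * a + 1" using split by meson
    then show ?case
    proof
      assume m: "m = 2 * a"
      show ?thesis
        using 1 unfolding m even by (rule Suc)
    next
      assume m: "m = 2 * a + 1"
      have "dv k (a + 1) \<le> gv r"
        using 1 dv_right_opt[of r k a] unfolding m odd by simp
      then show ?thesis
        unfolding m using between(2) by (rule less_le_trans[rotated])
    qed
  next
    case 2
    obtain a where "m = 2 * a \<or> m = 2 * a + 1" using split by meson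
    then show ?case
    proof
      assume m: "m = 2 * a"
      show ?thesis
        using 2 unfolding m even by (rule Suc)
    next
      assume m: "m = 2 * a + 1"
      have "gv r \<le> dv k a"
        using 2 dv_left_opt[of r k "a + 1"] unfolding m odd by simp
      then show ?thesis
        unfolding m using between(1) by (rule le_less_trans)
    qed
  }
qed

lemma dyadic_game_opts_unique:
  "g |\<in>| left_opts (dyadic_game k m) \<Longrightarrow> g' |\<in>| left_opts (dyadic_game k m) \<Longrightarrow> g = g'"
  "g |\<in>| right_opts (dyadic_game k m) \<Longrightarrow> g' |\<in>| right_opts (dyadic_game k m) \<Longrightarrow> g = g'"
  by (induction k arbitrary: m) (auto dest: opts_int_game split: if_splits)

lemma canonical_num:
  assumes "dyadic x"
  shows "canonical (num x)"
  unfolding canonical_def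
proof (intro allI impI)
  fix H assume "subposition H (num x)"
  then obtain y where "dyadic y" "H = num y"
    using assms by (rule subposition_num)
  then obtain k m where H: "H = dyadic_game k m"
    by (auto simp: dyadic_def dyadic_game_eq_num)
  have "\<not> left_dominated H g \<and> \<not> left_reversible H g" if g: "g |\<in>| left_opts H" for g
  proof
    show "\<not> left_dominated H g"
      using g dyadic_game_opts_unique(1)[of _ k m] unfolding left_dominated_def H by blast
    show "\<not> left_reversible H g"
      using g dyadic_game_not_reversible(1)[of g k m]
      unfolding left_reversible_def H gv_le_iff[symmetric] by (meson leD)
  qed
  moreover have "\<not> right_dominated H g \<and> \<not> right_reversible H g" if g: "g |\<in>| right_opts H" for g
  proof
    show "\<not> right_dominated H g"
      using g dyadic_game_opts_unique(2)[of _ k m] unfolding right_dominated_def H by blast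
    show "\<not> right_reversible H g"
      using g dyadic_game_not_reversible(2)[of g k m]
      unfolding right_reversible_def H gv_le_iff[symmetric] by (meson leD)
  qed
  ultimately show "(\<forall>g. g |\<in>| left_opts H \<longrightarrow> \<not> left_dominated H g \<and> \<not> left_reversible H g) \<and>
    (\<forall>g. g |\<in>| right_opts H \<longrightarrow> \<not> right_dominated H g \<and> \<not> right_reversible H g)"
    by simp
qed

lemma canonical_form_eq_num:
  assumes "dyadic x" "gv G = gv (num x)"
  shows "canonical_form G = num x"
  unfolding canonical_form_def
proof (rule the_equality)
  show "canonical (num x) \<and> G \<approx> num x"
    using assms canonical_num by (simp add: gv_eq_iff)
  fix K assume "canonical K \<and> G \<approx> K"
  then have "canonical K" "gv K = gv (num x)"
    unfolding assms(2)[symmetric] by (auto simp: game_eq_def simp flip: gv_le_iff intro: antisym)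
  then show "K = num x"
    using canonical_num[OF assms(1)] canonical_unique by blast
qed

section \<open>Infinitesimal comparison and stops\<close>

definition inf_le :: "gval \<Rightarrow> gval \<Rightarrow> bool" (infix "\<lesssim>" 50) where
  "x \<lesssim> y \<longleftrightarrow> (\<forall>e. dyadic e \<and> e > 0 \<longrightarrow> x \<le> y + gv (num e))"

text \<open>
  If \<open>y\<close> is a number, then \<open>x \<lesssim> y\<close> bounds the Left stop of \<open>x\<close>, and \<open>x \<unlhd> y\<close> its Right stop.
\<close>

definition inf_fuzzy_le :: "gval \<Rightarrow> gval \<Rightarrow> bool" (infix "\<unlhd>" 50) where
  "x \<unlhd> y \<longleftrightarrow> (\<forall>e. dyadic e \<and> e > 0 \<longrightarrow> \<not> y + gv (num e) \<le> x)"

lemma gv_num_pos: "dyadic e \<Longrightarrow> e > 0 \<Longrightarrow> 0 < gv (num e)"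
  using gv_num_less_iff[of 0 e] by simp

lemma gv_num_half: "dyadic e \<Longrightarrow> gv (num (e / 2)) + gv (num (e / 2)) = gv (num e)"
  using gv_num_add[of "e / 2" "e / 2"] by (simp add: dyadic_half)

lemma le_imp_inf_le: "x \<le> y \<Longrightarrow> x \<lesssim> y"
  unfolding inf_le_def using gv_num_pos by (metis add_increasing2 less_imp_le)

lemma inf_le_refl [simp]: "x \<lesssim> x"
  by (simp add: le_imp_inf_le)

lemma inf_le_trans:
  assumes "x \<lesssim> y" "y \<lesssim> z"
  shows "x \<lesssim> z"
  unfolding inf_le_def
proof (intro allI impI)
  fix e :: rat assume e: "dyadic e \<and> e > 0"
  let ?h = "gv (num (e / 2))"
  have "x \<le> y + ?h" "y \<le> z + ?h"
    using assms e unfolding inf_le_def by (simp_all add: dyadic_half)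
  then have "x \<le> z + ?h + ?h"
    by (meson add_right_mono order_trans)
  then show "x \<le> z + gv (num e)"
    using e by (simp add: add.assoc gv_num_half)
qed

lemma inf_fuzzy_le_trans:
  assumes "x \<unlhd> y" "y \<lesssim> z"
  shows "x \<unlhd> z"
  unfolding inf_fuzzy_le_def
proof (intro allI impI notI)
  fix e :: rat assume e: "dyadic e \<and> e > 0"
  let ?h = "gv (num (e / 2))"
  assume "z + gv (num e) \<le> x"
  moreover have "y \<le> z + ?h"
    using assms(2) e unfolding inf_le_def by (simp add: dyadic_half)
  then have "y + ?h \<le> z + ?h + ?h"
    by (rule add_right_mono)
  ultimately have "y + ?h \<le> x"
    using e by (simp add: add.assoc gv_num_half)
  then show False
    using assms(1) e unfolding inf_fuzzy_le_def by (simp add: dyadic_half)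
qed

lemma inf_fuzzy_le_trans':
  assumes "x \<lesssim> y" "y \<unlhd> z"
  shows "x \<unlhd> z"
  unfolding inf_fuzzy_le_def
proof (intro allI impI notI)
  fix e :: rat assume e: "dyadic e \<and> e > 0"
  let ?h = "gv (num (e / 2))"
  assume "z + gv (num e) \<le> x"
  moreover have "x \<le> y + ?h"
    using assms(1) e unfolding inf_le_def by (simp add: dyadic_half)
  ultimately have "z + ?h + ?h \<le> y + ?h"
    using e by (simp add: add.assoc gv_num_half)
  then have "z + ?h \<le> y"
    by simp
  then show False
    using assms(2) e unfolding inf_fuzzy_le_def by (simp add: dyadic_half)
qed

lemma inf_le_imp_fuzzy: "x \<lesssim> y \<Longrightarrow> x \<unlhd> y"
proof -
  have "x \<unlhd> x"
    unfolding inf_fuzzy_le_def using gv_num_pos by (simp add: less_le_not_le)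
  then show "x \<lesssim> y \<Longrightarrow> x \<unlhd> y"
    by (rule inf_fuzzy_le_trans)
qed

lemma inf_le_uminus [simp]: "- x \<lesssim> - y \<longleftrightarrow> y \<lesssim> x"
proof -
  have "- x \<le> - y + z \<longleftrightarrow> y \<le> x + z" for z :: gval
    by (metis add.commute diff_le_eq le_minus_iff minus_diff_eq uminus_add_conv_diff neg_le_iff_le)
  then show ?thesis
    by (simp add: inf_le_def)
qed

lemma inf_le_num_iff:
  assumes "dyadic a" "dyadic b"
  shows "gv (num a) \<lesssim> gv (num b) \<longleftrightarrow> a \<le> b" "gv (num a) \<unlhd> gv (num b) \<longleftrightarrow> a \<le> b"
proof -
  have *: "a \<le> b" if "gv (num a) \<unlhd> gv (num b)"
  proof (rule ccontr)
    assume "\<not> a \<le> b"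
    then have "\<not> gv (num b) + gv (num (a - b)) \<le> gv (num a)"
      using that assms unfolding inf_fuzzy_le_def by (simp add: dyadic_diff)
    then show False
      using assms by (simp flip: gv_num_add add: dyadic_diff)
  qed
  have **: "gv (num a) \<lesssim> gv (num b)" if "a \<le> b"
    using that assms by (simp add: le_imp_inf_le gv_num_le_iff)
  show "gv (num a) \<lesssim> gv (num b) \<longleftrightarrow> a \<le> b" "gv (num a) \<unlhd> gv (num b) \<longleftrightarrow> a \<le> b"
    using * ** inf_le_imp_fuzzy by blast+
qed

lemma inf_le_numI:
  assumes "dyadic d" "\<And>c. dyadic c \<Longrightarrow> c > d \<Longrightarrow> x \<le> gv (num c)"
  shows "x \<lesssim> gv (num d)"
  unfolding inf_le_def using assms by (auto simp: dyadic_add simp flip: gv_num_add)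

lemma num_inf_leI:
  assumes "dyadic d" "\<And>c. dyadic c \<Longrightarrow> c < d \<Longrightarrow> gv (num c) \<le> x"
  shows "gv (num d) \<lesssim> x"
  unfolding inf_le_def
proof (intro allI impI)
  fix e :: rat assume e: "dyadic e \<and> e > 0"
  then have "gv (num (d - e)) \<le> x"
    using assms by (simp add: dyadic_diff)
  then show "gv (num d) \<le> x + gv (num e)"
    using assms(1) e by (simp add: gv_num_diff diff_le_eq)
qed

lemma inf_fuzzy_le_numD:
  assumes "x \<unlhd> gv (num d)" "dyadic c" "dyadic d" "d < c"
  shows "\<not> gv (num c) \<le> x"
  using assms gv_num_add[of d "c - d"] unfolding inf_fuzzy_le_def by (auto simp: dyadic_diff)

lemma num_inf_fuzzy_leD:
  assumes "gv (num d) \<unlhd> x" "dyadic c" "dyadic d" "c < d"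
  shows "\<not> x \<le> gv (num c)"
proof
  assume "x \<le> gv (num c)"
  then have "x + gv (num (d - c)) \<le> gv (num c) + gv (num (d - c))"
    by (rule add_right_mono)
  also have "\<dots> = gv (num d)"
    using gv_num_add[of c "d - c"] assms by (simp add: dyadic_diff)
  finally show False
    using assms unfolding inf_fuzzy_le_def by (simp add: dyadic_diff)
qed

lemma inf_fuzzy_le_left_opt:
  assumes "x \<lesssim> gv g" "g |\<in>| left_opts G"
  shows "x \<unlhd> gv G"
  unfolding inf_fuzzy_le_def
proof (intro allI impI notI)
  fix e :: rat assume e: "dyadic e \<and> e > 0" and "gv G + gv (num e) \<le> x"
  moreover have "x \<le> gv g + gv (num e)"
    using assms(1) e by (simp add: inf_le_def)
  ultimately have "gv G \<le> gv g"
    by (meson add_le_cancel_right order_trans)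
  then show False
    using gv_not_left_opt_ge[OF assms(2)] by simp
qed

lemma inf_fuzzy_le_right_opt:
  assumes "gv g \<lesssim> x" "g |\<in>| right_opts G"
  shows "gv G \<unlhd> x"
  unfolding inf_fuzzy_le_def
proof (intro allI impI notI)
  fix e :: rat assume e: "dyadic e \<and> e > 0" and "x + gv (num e) \<le> gv G"
  moreover have "gv g \<le> x + gv (num e)"
    using assms(1) e by (simp add: inf_le_def)
  ultimately have "gv g \<le> gv G"
    by (meson order_trans)
  then show False
    using gv_not_right_opt_le[OF assms(2)] by simp
qed

lemma inf_le_num_if_opts:
  assumes "dyadic d" "\<And>g. g |\<in>| left_opts G \<Longrightarrow> gv g \<unlhd> gv (num d)" "gv G \<unlhd> gv (num d)"
  shows "gv G \<lesssim> gv (num d)"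
proof (rule inf_le_numI)
  fix c assume c: "dyadic c" "d < c"
  show "gv G \<le> gv (num c)"
  proof (subst gv_le_rec, intro conjI allI impI)
    show "\<not> gv (num c) \<le> gv g" if "g |\<in>| left_opts G" for g
      using assms(2)[OF that] c assms(1) by (intro inf_fuzzy_le_numD)
    fix h assume "h |\<in>| right_opts (num c)"
    then obtain y where "dyadic y" "h = num y" "c < y"
      using c(1) right_opt_num by blast
    then show "\<not> gv h \<le> gv G"
      using inf_fuzzy_le_numD[OF assms(3)] assms(1) c by simp
  qed
qed fact

lemma num_inf_le_if_opts:
  assumes "dyadic d" "\<And>g. g |\<in>| right_opts G \<Longrightarrow> gv (num d) \<unlhd> gv g" "gv (num d) \<unlhd> gv G"
  shows "gv (num d) \<lesssim> gv G"
proof (rule num_inf_leI)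
  fix c assume c: "dyadic c" "c < d"
  show "gv (num c) \<le> gv G"
  proof (subst gv_le_rec, intro conjI allI impI)
    show "\<not> gv g \<le> gv (num c)" if "g |\<in>| right_opts G" for g
      using assms(2)[OF that] c assms(1) by (intro num_inf_fuzzy_leD)
    fix h assume "h |\<in>| left_opts (num c)"
    then obtain y where "dyadic y" "h = num y" "y < c"
      using c(1) left_opt_num by blast
    then show "\<not> gv G \<le> gv h"
      using num_inf_fuzzy_leD[OF assms(3)] assms(1) c by simp
  qed
qed fact

text \<open>Number avoidance: for games that are not numbers it suffices to look at the options.\<close>

lemma inf_le_num_if_not_number:
  assumes "\<not> is_number G" "dyadic d" "\<And>g. g |\<in>| left_opts G \<Longrightarrow> gv g \<unlhd> gv (num d)"
  shows "gv G \<lesssim> gv (num d)"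
proof (rule inf_le_num_if_opts[OF assms(2,3)])
  show "gv G \<unlhd> gv (num d)"
    unfolding inf_fuzzy_le_def
  proof (intro allI impI notI)
    fix e :: rat assume e: "dyadic e \<and> e > 0" and "gv (num d) + gv (num e) \<le> gv G"
    then have le: "gv (num (d + e)) \<le> gv G"
      using assms(2) by (simp add: gv_num_add)
    have "is_number G"
    proof (rule is_numberI_between)
      show "dyadic (d + e)"
        using e assms(2) by (simp add: dyadic_add)
      then show "\<not> gv (num (d + e)) \<le> gv g" if "g |\<in>| left_opts G" for g
        using inf_fuzzy_le_numD[OF assms(3)[OF that]] e assms(2) by simp
      show "\<not> gv g \<le> gv (num (d + e))" if "g |\<in>| right_opts G" for g
        using le gv_not_right_opt_le[OF that] by (meson order_trans)
    qed
    with assms(1) show False ..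
  qed
qed

lemma num_inf_le_if_not_number:
  assumes "\<not> is_number G" "dyadic d" "\<And>g. g |\<in>| right_opts G \<Longrightarrow> gv (num d) \<unlhd> gv g"
  shows "gv (num d) \<lesssim> gv G"
proof (rule num_inf_le_if_opts[OF assms(2,3)])
  show "gv (num d) \<unlhd> gv G"
    unfolding inf_fuzzy_le_def
  proof (intro allI impI notI)
    fix e :: rat assume e: "dyadic e \<and> e > 0" and "gv G + gv (num e) \<le> gv (num d)"
    then have le: "gv G \<le> gv (num (d - e))"
      using assms(2) by (simp add: gv_num_diff le_diff_eq)
    have "is_number G"
    proof (rule is_numberI_between)
      show "dyadic (d - e)"
        using e assms(2) by (simp add: dyadic_diff)
      then show "\<not> gv g \<le> gv (num (d - e))" if "g |\<in>| right_opts G" for g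
        using num_inf_fuzzy_leD[OF assms(3)[OF that]] e assms(2) by simp
      show "\<not> gv (num (d - e)) \<le> gv g" if "g |\<in>| left_opts G" for g
        using le gv_not_left_opt_ge[OF that] by (meson order_trans)
    qed
    with assms(1) show False ..
  qed
qed

lemma number_gt_0_iff:
  "is_number x \<and> 0 < x \<longleftrightarrow> (\<exists>e. dyadic e \<and> e > 0 \<and> gv x = gv (num e))"
proof -
  have "0 < x \<longleftrightarrow> e > 0" if "dyadic e" "gv x = gv (num e)" for e
    using that gv_num_less_iff[of 0 e] by (metis dyadic_0_1(1) gv_less_iff gv_simps(1) num_0)
  then show ?thesis
    by (auto simp: is_number_def gv_eq_iff)
qed

lemma inf_ge_iff: "G \<ge>\<^sub>I H \<longleftrightarrow> gv H \<lesssim> gv G"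
proof -
  have "G \<ge>\<^sub>I H \<longleftrightarrow> (\<forall>x. is_number x \<and> 0 < x \<longrightarrow> gv H \<le> gv G + gv x)"
    unfolding inf_ge_def gv_le_iff[symmetric] gv_simps by (simp add: algebra_simps)
  also have "\<dots> \<longleftrightarrow> gv H \<lesssim> gv G"
    unfolding number_gt_0_iff inf_le_def by metis
  finally show ?thesis .
qed

lemma inf_eq_iff: "G =\<^sub>I H \<longleftrightarrow> gv G \<lesssim> gv H \<and> gv H \<lesssim> gv G"
proof -
  have "G =\<^sub>I H \<longleftrightarrow> (\<forall>x. is_number x \<and> 0 < x \<longrightarrow> gv H < gv G + gv x \<and> gv G < gv H + gv x)"
    unfolding inf_eq_def gv_less_iff[symmetric] gv_simps by (simp add: algebra_simps)
  also have "\<dots> \<longleftrightarrow> (\<forall>e. dyadic e \<and> e > 0 \<longrightarrow> gv H < gv G + gv (num e) \<and> gv G < gv H + gv (num e))"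
    unfolding number_gt_0_iff by metis
  also have "\<dots> \<longleftrightarrow> gv G \<lesssim> gv H \<and> gv H \<lesssim> gv G"
  proof -
    have "x < y + gv (num e)" if "x \<lesssim> y" "dyadic e" "e > 0" for x y e
    proof -
      have "x \<le> y + gv (num (e / 2))"
        using that by (simp add: inf_le_def dyadic_half)
      also have "\<dots> < y + gv (num e)"
        using that by (simp add: gv_num_less_iff dyadic_half)
      finally show ?thesis .
    qed
    then show ?thesis
      unfolding inf_le_def[of "gv G"] inf_le_def[of "gv H"] by (metis inf_le_def less_imp_le)
  qed
  finally show ?thesis .
qed

lemma inf_eq_trans: "G =\<^sub>I H \<Longrightarrow> H =\<^sub>I K \<Longrightarrow> G =\<^sub>I K"
  unfolding inf_eq_iff by (meson inf_le_trans)

lemma inf_eq_sym: "G =\<^sub>I H \<Longrightarrow> H =\<^sub>I G"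
  unfolding inf_eq_iff by simp

lemma num_neg_size_le: "gv (num (of_int (- int (size G)))) \<le> gv G"
proof (induction G rule: game_induct)
  case (game G)
  show ?case
  proof (subst gv_le_rec, intro conjI allI impI)
    fix g assume "g |\<in>| left_opts (num (of_int (- int (size G))))"
    then have "g |\<in>| left_opts (int_game (- int (size G)))"
      using dyadic_game_eq_num[of 0 "- int (size G)"] by simp
    moreover have "right_opts (nat_game n) = {||}" for n
      by (cases n) simp_all
    ultimately show "\<not> gv G \<le> gv g"
      by (auto simp: int_game_def split: if_splits)
  next
    fix g assume g: "g |\<in>| right_opts G"
    have "gv (num (of_int (- int (size G)))) < gv (num (of_int (- int (size g))))"
      using size_right_opts[OF g] by (simp add: gv_num_less_iff dyadic_uminus del: of_int_minus)
    also have "\<dots> \<le> gv g"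
      using game(2)[OF g] .
    finally show "\<not> gv g \<le> gv (num (of_int (- int (size G))))"
      by (simp add: less_le_not_le)
  qed
qed

lemma is_number_uminus: "is_number (- G) \<longleftrightarrow> is_number G"
proof -
  have "is_number (- G)" if number: "is_number G" for G
  proof -
    obtain x where "dyadic x" "gv G = gv (num x)"
      using number by (rule is_numberE)
    then have "dyadic (- x)" "gv (- G) = gv (num (- x))"
      by (simp_all add: dyadic_uminus gv_num_uminus)
    then show ?thesis
      unfolding is_number_def gv_eq_iff by blast
  qed
  from this[of G] this[of "- G"] show ?thesis
    by auto
qed

lemma is_number_if_no_left_opts:
  assumes "left_opts G = {||}"
  shows "is_number G"
proof (rule is_numberI_between)
  let ?y = "of_int (- int (size G)) :: rat"
  show "dyadic ?y"
    by (rule dyadic_of_int)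
  show "\<not> gv g \<le> gv (num ?y)" if "g |\<in>| right_opts G" for g
    using num_neg_size_le[of G] gv_not_right_opt_le[OF that] by (meson order_trans)
qed (use assms in simp)

lemma is_number_if_no_right_opts: "right_opts G = {||} \<Longrightarrow> is_number G"
  using is_number_if_no_left_opts[of "- G"] by (simp add: is_number_uminus)

lemma stops_number:
  assumes "dyadic x" "gv G = gv (num x)"
  shows "left_stop G = x" "right_stop G = x"
proof -
  have "is_number G"
    using assms by (auto simp: is_number_def gv_eq_iff)
  with number_value_eq[OF assms] show "left_stop G = x" "right_stop G = x"
    by (simp_all add: left_stop.simps[of G] right_stop.simps[of G])
qed

lemma stops_not_number:
  assumes "\<not> is_number G"
  shows "\<exists>g. g |\<in>| left_opts G \<and> left_stop G = right_stop g"
    and "\<And>g. g |\<in>| left_opts G \<Longrightarrow> right_stop g \<le> left_stop G"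
    and "\<exists>g. g |\<in>| right_opts G \<and> right_stop G = left_stop g"
    and "\<And>g. g |\<in>| right_opts G \<Longrightarrow> right_stop G \<le> left_stop g"
proof -
  have ne: "fset (left_opts G) \<noteq> {}" "fset (right_opts G) \<noteq> {}"
    using assms is_number_if_no_left_opts is_number_if_no_right_opts
    by (metis bot_fset.rep_eq fset_inject)+
  have L: "left_stop G = Max (right_stop ` fset (left_opts G))"
    and R: "right_stop G = Min (left_stop ` fset (right_opts G))"
    using assms by (simp_all add: left_stop.simps[of G] right_stop.simps[of G])
  have "left_stop G \<in> right_stop ` fset (left_opts G)"
    unfolding L using ne by (intro Max_in) auto
  then show "\<exists>g. g |\<in>| left_opts G \<and> left_stop G = right_stop g"
    by auto
  have "right_stop G \<in> left_stop ` fset (right_opts G)"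
    unfolding R using ne by (intro Min_in) auto
  then show "\<exists>g. g |\<in>| right_opts G \<and> right_stop G = left_stop g"
    by auto
  show "right_stop g \<le> left_stop G" if "g |\<in>| left_opts G" for g
    unfolding L using that by (intro Max_ge) auto
  show "right_stop G \<le> left_stop g" if "g |\<in>| right_opts G" for g
    unfolding R using that by (intro Min_le) auto
qed

lemma stops_bounds:
  shows dyadic_left_stop: "dyadic (left_stop G)"
    and dyadic_right_stop: "dyadic (right_stop G)"
    and inf_le_left_stop: "gv G \<lesssim> gv (num (left_stop G))"
    and left_stop_fuzzy_le: "gv (num (left_stop G)) \<unlhd> gv G"
    and right_stop_inf_le: "gv (num (right_stop G)) \<lesssim> gv G"
    and fuzzy_le_right_stop: "gv G \<unlhd> gv (num (right_stop G))"
proof (induction G rule: game_induct)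
  case (game G)
  have "dyadic (left_stop G) \<and> dyadic (right_stop G) \<and>
    gv G \<lesssim> gv (num (left_stop G)) \<and> gv (num (left_stop G)) \<unlhd> gv G \<and>
    gv (num (right_stop G)) \<lesssim> gv G \<and> gv G \<unlhd> gv (num (right_stop G))"
  proof (cases "is_number G")
    case True
    then obtain x where "dyadic x" "gv G = gv (num x)"
      by (rule is_numberE)
    then show ?thesis
      using stops_number[of x G] by (simp add: inf_le_imp_fuzzy)
  next
    case False
    obtain l where l: "l |\<in>| left_opts G" "left_stop G = right_stop l"
      using stops_not_number(1)[OF False] by blast
    obtain r where r: "r |\<in>| right_opts G" "right_stop G = left_stop r"
      using stops_not_number(3)[OF False] by blast
    have dyadic: "dyadic (left_stop G)" "dyadic (right_stop G)"
      using game(2)[OF l(1)] game(7)[OF r(1)] l(2) r(2) by simp_all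
    moreover have "gv G \<lesssim> gv (num (left_stop G))"
    proof (rule inf_le_num_if_not_number[OF False dyadic(1)])
      fix g assume g: "g |\<in>| left_opts G"
      have "gv (num (right_stop g)) \<lesssim> gv (num (left_stop G))"
        using stops_not_number(2)[OF False g] game(2)[OF g] dyadic by (simp add: inf_le_num_iff)
      then show "gv g \<unlhd> gv (num (left_stop G))"
        using game(6)[OF g] by (rule inf_fuzzy_le_trans[rotated])
    qed
    moreover have "gv (num (right_stop G)) \<lesssim> gv G"
    proof (rule num_inf_le_if_not_number[OF False dyadic(2)])
      fix g assume g: "g |\<in>| right_opts G"
      have "gv (num (right_stop G)) \<lesssim> gv (num (left_stop g))"
        using stops_not_number(4)[OF False g] game(7)[OF g] dyadic by (simp add: inf_le_num_iff)
      then show "gv (num (right_stop G)) \<unlhd> gv g"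
        using game(10)[OF g] by (rule inf_fuzzy_le_trans')
    qed
    moreover have "gv (num (left_stop G)) \<unlhd> gv G"
      using game(5)[OF l(1)] l by (auto intro: inf_fuzzy_le_left_opt)
    moreover have "gv G \<unlhd> gv (num (right_stop G))"
      using game(9)[OF r(1)] r by (auto intro: inf_fuzzy_le_right_opt)
    ultimately show ?thesis
      by blast
  qed
  then show "dyadic (left_stop G)" "dyadic (right_stop G)"
    "gv G \<lesssim> gv (num (left_stop G))" "gv (num (left_stop G)) \<unlhd> gv G"
    "gv (num (right_stop G)) \<lesssim> gv G" "gv G \<unlhd> gv (num (right_stop G))"
    by blast+
qed

lemma hot_not_number: "hot G \<Longrightarrow> \<not> is_number G"
  unfolding hot_def by (auto elim!: is_numberE simp: stops_number)

section \<open>Uniqueness of reduced canonical forms\<close>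

lemma reduced_canonical_opt:
  "reduced_canonical G \<Longrightarrow> g |\<in>| left_opts G |\<union>| right_opts G \<Longrightarrow> reduced_canonical g"
  unfolding reduced_canonical_def using subposition_trans_opt by blast

lemma reduced_canonical_cases:
  assumes "reduced_canonical K"
  obtains "is_number K" "canonical K"
  | "hot K"
    "\<And>g. g |\<in>| left_opts K \<Longrightarrow> \<not> inf_left_dominated K g \<and> \<not> inf_left_reversible K g"
    "\<And>g. g |\<in>| right_opts K \<Longrightarrow> \<not> inf_right_dominated K g \<and> \<not> inf_right_reversible K g"
  using assms subposition.intros(1)[of K] unfolding reduced_canonical_def by blast

lemma reduced_canonical_num: "dyadic x \<Longrightarrow> reduced_canonical (num x)"
  unfolding reduced_canonical_def
  by (auto elim!: subposition_num simp: is_number_num canonical_num)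

lemma reduced_canonical_eq_num:
  assumes K: "reduced_canonical K" "K =\<^sub>I num x" and x: "dyadic x"
  shows "K = num x"
  using K(1)
proof (cases rule: reduced_canonical_cases)
  case 1
  then obtain y where y: "dyadic y" "gv K = gv (num y)"
    by (auto elim: is_numberE)
  then have "y = x"
    using K(2) x by (simp add: inf_eq_iff inf_le_num_iff)
  then show ?thesis
    using canonical_unique[OF 1(2) canonical_num[OF x]] y by simp
next
  case 2
  have "gv (num (left_stop K)) \<unlhd> gv (num x)"
    using left_stop_fuzzy_le inf_fuzzy_le_trans K(2) unfolding inf_eq_iff by blast
  moreover have "gv (num x) \<unlhd> gv (num (right_stop K))"
    using fuzzy_le_right_stop inf_fuzzy_le_trans' K(2) unfolding inf_eq_iff by blast
  ultimately have "left_stop K \<le> right_stop K"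
    using x by (simp add: inf_le_num_iff dyadic_left_stop dyadic_right_stop)
  with 2(1) show ?thesis
    by (simp add: hot_def)
qed

lemma rcf_eq_num:
  assumes "dyadic x" "G =\<^sub>I num x"
  shows "rcf G = num x"
  unfolding rcf_def
proof (rule the_equality)
  show "reduced_canonical (num x) \<and> G =\<^sub>I num x"
    using assms reduced_canonical_num by simp
  show "K = num x" if "reduced_canonical K \<and> G =\<^sub>I K" for K
    using that assms reduced_canonical_eq_num inf_eq_trans inf_eq_sym by metis
qed

abbreviation (input) switch :: "rat \<Rightarrow> rat \<Rightarrow> game" where
  "switch a b \<equiv> Game {|num a|} {|num b|}"

lemma switch_bounds:
  assumes "dyadic a" "dyadic b" "b < a"
  shows "\<not> is_number (switch a b)"
    and "gv (num a) \<unlhd> gv (switch a b)" "gv (switch a b) \<unlhd> gv (num b)"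
    and "gv (num b) \<lesssim> gv (switch a b)" "gv (switch a b) \<lesssim> gv (num a)"
    and "left_stop (switch a b) = a" "right_stop (switch a b) = b"
proof -
  show *: "gv (num a) \<unlhd> gv (switch a b)"
    by (rule inf_fuzzy_le_left_opt[of _ "num a"]) simp_all
  show **: "gv (switch a b) \<unlhd> gv (num b)"
    by (rule inf_fuzzy_le_right_opt[of "num b"]) simp_all
  show not: "\<not> is_number (switch a b)"
  proof
    assume "is_number (switch a b)"
    then obtain x where "dyadic x" "gv (switch a b) = gv (num x)"
      by (rule is_numberE)
    then show False
      using * ** assms by (simp add: inf_le_num_iff)
  qed
  show "gv (num b) \<lesssim> gv (switch a b)"
    by (rule num_inf_le_if_not_number[OF not assms(2)]) (simp add: inf_le_imp_fuzzy)
  show "gv (switch a b) \<lesssim> gv (num a)"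
    by (rule inf_le_num_if_not_number[OF not assms(1)]) (simp add: inf_le_imp_fuzzy)
  show "left_stop (switch a b) = a" "right_stop (switch a b) = b"
    using stops_not_number[OF not] stops_number[of a "num a"] stops_number[of b "num b"] assms
    by auto
qed

lemma reduced_canonical_switch:
  assumes "dyadic a" "dyadic b" "b < a"
  shows "reduced_canonical (switch a b)"
  unfolding reduced_canonical_def
proof (intro allI impI)
  note sb = switch_bounds[OF assms]
  have not_left: "\<not> inf_left_reversible (switch a b) (num a)"
  proof
    assume "inf_left_reversible (switch a b) (num a)"
    then obtain r where r: "r |\<in>| right_opts (num a)" "gv r \<lesssim> gv (switch a b)"
      unfolding inf_left_reversible_def inf_ge_iff by blast
    obtain y where y: "dyadic y" "r = num y" "a < y"
      using assms(1) r(1) by (rule right_opt_num)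
    have "gv (num y) \<unlhd> gv (num b)"
      using r(2) sb(3) unfolding y(2) by (rule inf_fuzzy_le_trans')
    then show False
      using y assms by (simp add: inf_le_num_iff)
  qed
  have not_right: "\<not> inf_right_reversible (switch a b) (num b)"
  proof
    assume "inf_right_reversible (switch a b) (num b)"
    then obtain r where r: "r |\<in>| left_opts (num b)" "gv (switch a b) \<lesssim> gv r"
      unfolding inf_right_reversible_def inf_ge_iff by blast
    obtain y where y: "dyadic y" "r = num y" "y < b"
      using assms(2) r(1) by (rule left_opt_num)
    have "gv (num a) \<unlhd> gv (num y)"
      using sb(2) r(2) unfolding y(2) by (rule inf_fuzzy_le_trans)
    then show False
      using y assms by (simp add: inf_le_num_iff)
  qed
  fix H assume "subposition H (switch a b)"
  then have "H = switch a b \<or> subposition H (num a) \<or> subposition H (num b)"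
  proof (induction H "switch a b" rule: subposition.induct)
    case (2 H K)
    then show ?case
      by (auto intro: subposition.intros)
  qed simp
  then consider "H = switch a b" | "is_number H" "canonical H"
    using assms by (auto elim!: subposition_num simp: is_number_num canonical_num)
  then show "is_number H \<and> canonical H \<or> hot H \<and>
      (\<forall>g. g |\<in>| left_opts H \<longrightarrow> \<not> inf_left_dominated H g \<and> \<not> inf_left_reversible H g) \<and>
      (\<forall>g. g |\<in>| right_opts H \<longrightarrow> \<not> inf_right_dominated H g \<and> \<not> inf_right_reversible H g)"
  proof cases
    case 1
    then show ?thesis
      using not_left not_right assms(3) sb(6,7)
      by (auto simp: hot_def inf_left_dominated_def inf_right_dominated_def)
  qed simp
qed

lemma num_power_half: "num (1 / 2 ^ Suc n) = Game {|0|} {|num (1 / 2 ^ n)|}"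
  using num_midpoint[of 0 n] by simp

lemma power_half_less:
  assumes "(e :: rat) > 0"
  obtains n where "1 / 2 ^ Suc n < e"
proof -
  obtain n where "inverse e < of_nat n"
    using reals_Archimedean2 by blast
  also have "\<dots> < (2 :: rat) ^ Suc n"
  proof -
    have "n < 2 ^ Suc n"
      using less_exp[of n] unfolding power_Suc by linarith
    then have "(of_nat n :: rat) < of_nat (2 ^ Suc n)"
      by (simp only: of_nat_less_iff)
    then show ?thesis
      by simp
  qed
  finally have "1 / 2 ^ Suc n < e"
    using assms by (simp add: field_simps)
  then show thesis
    by (rule that)
qed

text \<open>
  The witnesses of \<open>\<not> x \<lesssim> z\<close> for finitely many \<open>x\<close> can be taken uniformly, and of the form
  \<open>2 ^ - (n + 1)\<close>, whose only Left option is \<open>0\<close>.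
\<close>

lemma not_inf_le_uniform:
  assumes "finite X" "\<And>x. x \<in> X \<Longrightarrow> \<not> x \<lesssim> z" "(e :: rat) > 0"
  shows "\<exists>n. 1 / 2 ^ Suc n < e \<and> (\<forall>x\<in>X. \<not> x \<le> z + gv (num (1 / 2 ^ Suc n)))"
proof -
  have "\<exists>d>0. dyadic d \<and> (\<forall>x\<in>X. \<not> x \<le> z + gv (num d))"
    using assms(1,2)
  proof (induction X rule: finite_induct)
    case empty
    show ?case
      by (rule exI[of _ 1]) simp
  next
    case (insert x X)
    then obtain d where d: "d > 0" "dyadic d" "\<forall>x\<in>X. \<not> x \<le> z + gv (num d)"
      by auto
    obtain c where c: "c > 0" "dyadic c" "\<not> x \<le> z + gv (num c)"
      using insert.prems[of x] by (auto simp: inf_le_def)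
    have mono: "\<not> y \<le> z + gv (num (min c d))" if "\<not> y \<le> z + gv (num b)" "b \<in> {c, d}" for y b
    proof -
      have "z + gv (num (min c d)) \<le> z + gv (num b)"
        using that(2) c(2) d(2) by (auto simp: min_def gv_num_le_iff)
      then show ?thesis
        using that(1) by (meson order_trans)
    qed
    then have "\<forall>y\<in>insert x X. \<not> y \<le> z + gv (num (min c d))"
      using c(3) d(3) by blast
    moreover have "min c d > 0" "dyadic (min c d)"
      using c d by (simp_all add: min_def)
    ultimately show ?case
      by blast
  qed
  then obtain d where d: "d > 0" "dyadic d" "\<And>x. x \<in> X \<Longrightarrow> \<not> x \<le> z + gv (num d)"
    by blast
  obtain n where n: "1 / 2 ^ Suc n < min d e"
    using power_half_less[of "min d e"] d(1) assms(3) by auto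
  have "\<not> x \<le> z + gv (num (1 / 2 ^ Suc n))" if "x \<in> X" for x
  proof -
    have "z + gv (num (1 / 2 ^ Suc n)) \<le> z + gv (num d)"
      using n d(2) dyadic_power[of "Suc n"] by (simp add: gv_num_le_iff)
    then show ?thesis
      using d(3)[OF that] by (meson order_trans)
  qed
  moreover have "1 / 2 ^ Suc n < e"
    using n by simp
  ultimately show ?thesis
    by blast
qed

lemma left_opts_inf_eq_switch:
  assumes ab: "dyadic a" "dyadic b" "b < a"
    and K: "gv K \<lesssim> gv (switch a b)" "gv (switch a b) \<lesssim> gv K"
    and not_reversible: "\<And>g r. g |\<in>| left_opts K \<Longrightarrow> r |\<in>| right_opts g \<Longrightarrow> \<not> gv r \<lesssim> gv K"
    and not_dominated: "\<And>g h. g |\<in>| left_opts K \<Longrightarrow> h |\<in>| left_opts K \<Longrightarrow> gv g \<lesssim> gv h \<Longrightarrow> g = h"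
    and stops: "\<And>g. g |\<in>| left_opts K \<Longrightarrow> is_number g \<or>
      (\<exists>c r. dyadic c \<and> gv (num c) \<lesssim> gv g \<and> r |\<in>| right_opts g \<and> gv r \<lesssim> gv (num c))"
  obtains g where "left_opts K = {|g|}" "g =\<^sub>I num a"
proof -
  note sb = switch_bounds[OF ab]
  define S where "S = switch a b"
  note K = K[folded S_def] and sb = sb[folded S_def]
  have S_opts: "left_opts S = {|num a|}" "right_opts S = {|num b|}"
    by (simp_all add: S_def)
  have upper: "gv g \<lesssim> gv (num a)" if g: "g |\<in>| left_opts K" for g
  proof (rule ccontr)
    assume not: "\<not> gv g \<lesssim> gv (num a)"
    have not_le_S: "\<not> x \<lesssim> gv S" if x: "x \<in> gv ` fset (right_opts g)" for x
    proof
      assume "x \<lesssim> gv S"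
      then have "x \<lesssim> gv K"
        using K(2) by (rule inf_le_trans)
      with x not_reversible[OF g] show False
        by blast
    qed
    obtain n where "1 / 2 ^ Suc n < (1 :: rat)"
      and n: "\<forall>x\<in>gv ` fset (right_opts g). \<not> x \<le> gv S + gv (num (1 / 2 ^ Suc n))"
      using not_inf_le_uniform[OF finite_imageI[OF finite_fset] not_le_S zero_less_one] by blast
    obtain d where d: "d > 0" "dyadic d" "\<not> gv g \<le> gv (num a) + gv (num d)"
      using not by (auto simp: inf_le_def)
    obtain m where m: "1 / 2 ^ Suc m < min d (1 / 2 ^ Suc n)"
      using power_half_less[of "min d (1 / 2 ^ Suc n)"] d(1) by auto
    let ?e = "num (1 / 2 ^ Suc m)"
    have e_less: "gv ?e \<le> gv (num d)" "gv ?e \<le> gv (num (1 / 2 ^ Suc n))"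
      using m d(2) dyadic_power[of "Suc m"] dyadic_power[of "Suc n"] by (simp_all add: gv_num_le_iff)
    have "\<not> gv (S + ?e) \<le> gv g"
    proof
      assume "gv (S + ?e) \<le> gv g"
      moreover have "gv K \<le> gv (S + ?e)"
        using K(1) dyadic_power[of "Suc m"] by (simp add: inf_le_def del: power_Suc)
      ultimately show False
        using gv_not_left_opt_ge[OF g] by (meson order_trans)
    qed
    then have "(\<exists>l. l |\<in>| left_opts (S + ?e) \<and> gv g \<le> gv l) \<or>
        (\<exists>r. r |\<in>| right_opts g \<and> gv r \<le> gv (S + ?e))"
      using gv_le_rec[of "S + ?e" g] by blast
    moreover have "left_opts (S + ?e) = {|S, num a + ?e|}"
      by (simp add: S_opts num_power_half del: power_Suc)
    ultimately have "gv g \<le> gv (num a) + gv ?e \<or> gv g \<le> gv S \<or>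
        (\<exists>r. r |\<in>| right_opts g \<and> gv r \<le> gv S + gv ?e)"
      by (auto simp del: power_Suc left_opts_add)
    then consider "gv g \<le> gv (num a) + gv ?e" | "gv g \<le> gv S"
      | r where "r |\<in>| right_opts g" "gv r \<le> gv S + gv ?e"
      by blast
    then show False
    proof cases
      case 1
      then show ?thesis
        using d(3) order_trans[OF _ add_left_mono[OF e_less(1)]] by blast
    next
      case 3
      then show ?thesis
        using n order_trans[OF _ add_left_mono[OF e_less(2)]] by blast
    next
      case 2
      from stops[OF g] show ?thesis
      proof
        assume "is_number g"
        then obtain y where y: "dyadic y" "gv g = gv (num y)"
          by (rule is_numberE)
        have "gv (num y) \<unlhd> gv (num b)"
          using 2 sb(3) inf_fuzzy_le_trans'[OF le_imp_inf_le] unfolding y(2) by blast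
        then have "gv g \<lesssim> gv (num a)"
          using ab y by (simp add: inf_le_num_iff)
        with not show False ..
      next
        assume "\<exists>c r. dyadic c \<and> gv (num c) \<lesssim> gv g \<and> r |\<in>| right_opts g \<and> gv r \<lesssim> gv (num c)"
        then obtain c r where c: "dyadic c" "gv (num c) \<lesssim> gv g" "r |\<in>| right_opts g" "gv r \<lesssim> gv (num c)"
          by blast
        have "gv (num c) \<unlhd> gv (num b)"
          using c(2) le_imp_inf_le[OF 2] sb(3) by (meson inf_fuzzy_le_trans' inf_le_trans)
        then have "gv (num c) \<lesssim> gv (num b)"
          using ab c(1) by (simp add: inf_le_num_iff)
        then have "gv r \<lesssim> gv K"
          using c(4) sb(4) K(2) by (meson inf_le_trans)
        then show False
          using not_reversible[OF g c(3)] by blast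
      qed
    qed
  qed
  have "\<exists>g. g |\<in>| left_opts K \<and> gv (num a) \<lesssim> gv g"
  proof (rule ccontr)
    assume "\<nexists>g. g |\<in>| left_opts K \<and> gv (num a) \<lesssim> gv g"
    then have not_le: "\<not> x \<lesssim> - gv (num a)" if "x \<in> (\<lambda>g. - gv g) ` fset (left_opts K)" for x
      using that by auto
    have ab_pos: "0 < a - b"
      using ab(3) by simp
    obtain n where n: "1 / 2 ^ Suc n < a - b"
      "\<forall>x\<in>(\<lambda>g. - gv g) ` fset (left_opts K). \<not> x \<le> - gv (num a) + gv (num (1 / 2 ^ Suc n))"
      using not_inf_le_uniform[OF finite_imageI[OF finite_fset] not_le ab_pos] by blast
    let ?d = "1 / 2 ^ Suc n :: rat"
    have Kb: "gv K \<unlhd> gv (num b)"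
      using K(1) sb(3) by (rule inf_fuzzy_le_trans')
    have a_not_le: "\<not> gv (num a) \<le> gv K + gv (num ?d)"
    proof
      assume "gv (num a) \<le> gv K + gv (num ?d)"
      then have "gv (num (a - ?d)) \<le> gv K"
        using ab(1) dyadic_power[of "Suc n"] by (simp add: gv_num_diff diff_le_eq del: power_Suc)
      moreover have "dyadic (a - ?d)" "b < a - ?d"
        using ab(1) n(1) dyadic_power[of "Suc n"] by (auto intro: dyadic_diff simp del: power_Suc)
      ultimately show False
        using inf_fuzzy_le_numD[OF Kb] ab(2) by blast
    qed
    have pos: "0 \<le> gv (num ?d)"
      using gv_num_pos[of ?d] dyadic_power[of "Suc n"] by (simp add: less_imp_le del: power_Suc)
    have "\<not> gv (K + num ?d) \<le> gv (num a)"
    proof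
      assume "gv (K + num ?d) \<le> gv (num a)"
      moreover have "gv S \<le> gv (K + num ?d)"
        using K(2) dyadic_power[of "Suc n"] by (simp add: inf_le_def del: power_Suc)
      ultimately show False
        using gv_not_left_opt_ge[of "num a" S] by (simp add: S_opts)
    qed
    then consider l where "l |\<in>| left_opts (K + num ?d)" "gv (num a) \<le> gv l"
      | r where "r |\<in>| right_opts (num a)" "gv r \<le> gv (K + num ?d)"
      using gv_le_rec[of "K + num ?d" "num a"] by blast
    then show False
    proof cases
      case 1
      have "(\<exists>g. g |\<in>| left_opts K \<and> l = g + num ?d) \<or> l = K"
        using 1(1) by (auto simp: num_power_half simp del: power_Suc)
      then consider g where "g |\<in>| left_opts K" "gv (num a) \<le> gv g + gv (num ?d)"
        | "gv (num a) \<le> gv K"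
        using 1(2) gv_simps(2) by metis
      then show ?thesis
      proof cases
        case 1
        then have "- gv g \<le> - gv (num a) + gv (num ?d)"
          by (simp add: algebra_simps del: power_Suc)
        then show ?thesis
          using n(2) 1(1) by blast
      next
        case 2
        then show ?thesis
          using a_not_le pos by (metis add_increasing2)
      qed
    next
      case 2
      obtain y where y: "dyadic y" "r = num y" "a < y"
        using ab(1) 2(1) by (rule right_opt_num)
      have "gv (num a) \<le> gv (num y)"
        using y ab(1) by (simp add: gv_num_le_iff)
      also have "\<dots> \<le> gv K + gv (num ?d)"
        using 2(2) unfolding y(2) gv_simps .
      finally show ?thesis
        using a_not_le by blast
    qed
  qed
  then obtain g where g: "g |\<in>| left_opts K" "gv (num a) \<lesssim> gv g"
    by blast
  have unique: "h = g" if h: "h |\<in>| left_opts K" for h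
    by (rule not_dominated[OF h g(1)]) (rule inf_le_trans[OF upper[OF h] g(2)])
  show thesis
  proof (rule that)
    show "left_opts K = {|g|}"
    proof (intro fset_eqI iffI)
      show "h |\<in>| {|g|}" if "h |\<in>| left_opts K" for h
        using unique[OF that] by simp
      show "h |\<in>| left_opts K" if "h |\<in>| {|g|}" for h
        using that g(1) by simp
    qed
    show "g =\<^sub>I num a"
      using upper[OF g(1)] g(2) by (simp add: inf_eq_iff)
  qed
qed

lemma reduced_canonical_eq_switch:
  assumes K: "reduced_canonical K" "K =\<^sub>I switch a b" and ab: "dyadic a" "dyadic b" "b < a"
  shows "K = switch a b"
  using K(1)
proof (cases rule: reduced_canonical_cases)
  case 1
  then obtain x where x: "dyadic x" "gv K = gv (num x)"
    by (auto elim: is_numberE)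
  have "gv (num a) \<unlhd> gv (num x)" "gv (num x) \<unlhd> gv (num b)"
    using switch_bounds(2,3)[OF ab] K(2) inf_fuzzy_le_trans inf_fuzzy_le_trans'
    unfolding inf_eq_iff x(2) by blast+
  then show ?thesis
    using x ab by (simp add: inf_le_num_iff)
next
  case 2
  have number_or_hot: "is_number g \<or> hot g" if "g |\<in>| left_opts K |\<union>| right_opts K" for g
    using reduced_canonical_opt[OF K(1) that] by (auto elim: reduced_canonical_cases)
  have "is_number g \<or> (\<exists>c r. dyadic c \<and> gv (num c) \<lesssim> gv g \<and> r |\<in>| right_opts g \<and> gv r \<lesssim> gv (num c))"
    if "g |\<in>| left_opts K" for g
  proof -
    have "is_number g \<or> (\<exists>r. r |\<in>| right_opts g \<and> right_stop g = left_stop r)"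
      using number_or_hot[of g] that stops_not_number(3)[of g] by auto
    then show ?thesis
      by (metis dyadic_right_stop inf_le_left_stop right_stop_inf_le)
  qed
  note left_stops = this
  obtain g where g: "left_opts K = {|g|}" "g =\<^sub>I num a"
  proof (rule left_opts_inf_eq_switch[OF ab, of K])
    show "gv K \<lesssim> gv (switch a b)" "gv (switch a b) \<lesssim> gv K"
      using K(2) by (simp_all add: inf_eq_iff)
    show "\<not> gv r \<lesssim> gv K" if "g |\<in>| left_opts K" "r |\<in>| right_opts g" for g r
      using 2(2)[OF that(1)] that(2) unfolding inf_left_reversible_def inf_ge_iff by blast
    show "g = h" if "g |\<in>| left_opts K" "h |\<in>| left_opts K" "gv g \<lesssim> gv h" for g h
      using 2(2)[OF that(1)] that(2,3) unfolding inf_left_dominated_def inf_ge_iff by blast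
  qed (use left_stops in blast)+
  have neg_ab: "dyadic (- b)" "dyadic (- a)" "- a < - b"
    using ab by (simp_all add: dyadic_uminus)
  have neg_switch: "gv (switch (- b) (- a)) = - gv (switch a b)"
  proof (rule antisym)
    have neg: "gv (num (- b)) = - gv (num b)" "gv (num (- a)) = - gv (num a)"
      using ab by (simp_all add: gv_num_uminus)
    have "\<not> gv (switch (- b) (- a)) \<le> gv (num (- b))" "\<not> gv (num (- a)) \<le> gv (switch (- b) (- a))"
      "\<not> gv (- switch a b) \<le> gv (- num b)" "\<not> gv (- num a) \<le> gv (- switch a b)"
      by (rule gv_not_left_opt_ge gv_not_right_opt_le; simp)+
    note not_le = this[unfolded neg gv_simps]
    have "gv (switch (- b) (- a)) \<le> gv (- switch a b)"
      by (subst gv_le_rec) (use not_le neg in simp)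
    moreover have "gv (- switch a b) \<le> gv (switch (- b) (- a))"
      by (subst gv_le_rec) (use not_le neg in simp)
    ultimately show "gv (switch (- b) (- a)) \<le> - gv (switch a b)" "- gv (switch a b) \<le> gv (switch (- b) (- a))"
      by simp_all
  qed
  have "is_number (- g) \<or> (\<exists>c r. dyadic c \<and> gv (num c) \<lesssim> gv (- g) \<and> r |\<in>| right_opts (- g) \<and> gv r \<lesssim> gv (num c))"
    if "g |\<in>| right_opts K" for g
  proof -
    have "is_number g \<or> (\<exists>r. r |\<in>| left_opts g \<and> left_stop g = right_stop r)"
      using number_or_hot[of g] that hot_not_number stops_not_number(1)[of g] by auto
    then show ?thesis
    proof
      assume "\<exists>r. r |\<in>| left_opts g \<and> left_stop g = right_stop r"
      then obtain r where r: "r |\<in>| left_opts g" "left_stop g = right_stop r"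
        by blast
      have "dyadic (- left_stop g) \<and> gv (num (- left_stop g)) \<lesssim> gv (- g) \<and>
          - r |\<in>| right_opts (- g) \<and> gv (- r) \<lesssim> gv (num (- left_stop g))"
        using inf_le_left_stop[of g] right_stop_inf_le[of r] dyadic_left_stop[of g] r
        by (simp add: gv_num_uminus dyadic_uminus)
      then show ?thesis
        by blast
    qed (simp add: is_number_uminus)
  qed
  note right_stops = this
  obtain h where h: "left_opts (- K) = {|h|}" "h =\<^sub>I num (- b)"
  proof (rule left_opts_inf_eq_switch[OF neg_ab, of "- K"])
    show "gv (- K) \<lesssim> gv (switch (- b) (- a))" "gv (switch (- b) (- a)) \<lesssim> gv (- K)"
      using K(2) unfolding neg_switch inf_eq_iff by simp_all
    show "\<not> gv r \<lesssim> gv (- K)" if g: "g |\<in>| left_opts (- K)" and r: "r |\<in>| right_opts g" for g r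
    proof -
      obtain g' where g': "g' |\<in>| right_opts K" "g = - g'"
        using g by auto
      then obtain r' where "r' |\<in>| left_opts g'" "r = - r'"
        using r by auto
      then show ?thesis
        using 2(3)[OF g'(1)] unfolding inf_right_reversible_def inf_ge_iff by auto
    qed
    show "g = h" if gh: "g |\<in>| left_opts (- K)" "h |\<in>| left_opts (- K)" "gv g \<lesssim> gv h" for g h
    proof -
      obtain g' h' where gh': "g' |\<in>| right_opts K" "g = - g'" "h' |\<in>| right_opts K" "h = - h'"
        using gh(1,2) by auto
      then have "gv h' \<lesssim> gv g'"
        using gh(3) by simp
      then show ?thesis
        using 2(3)[OF gh'(1)] gh' unfolding inf_right_dominated_def inf_ge_iff by blast
    qed
    show "is_number g \<or> (\<exists>c r. dyadic c \<and> gv (num c) \<lesssim> gv g \<and> r |\<in>| right_opts g \<and> gv r \<lesssim> gv (num c))"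
      if g: "g |\<in>| left_opts (- K)" for g
    proof -
      obtain g' where "g' |\<in>| right_opts K" "g = - g'"
        using g by auto
      then show ?thesis
        using right_stops by blast
    qed
  qed blast
  define h' where "h' = - h"
  have "right_opts K = {|h'|}"
    using arg_cong[OF h(1), of "\<lambda>X. uminus |`| X"]
    by (simp add: h'_def fimage_fimage comp_def fset.map_ident)
  moreover have "h' =\<^sub>I num b"
    using h(2) ab inf_le_uminus[of "gv h" "- gv (num b)"] inf_le_uminus[of "- gv (num b)" "gv h"]
    unfolding inf_eq_iff h'_def by (simp add: gv_num_uminus)
  moreover have "reduced_canonical g" "reduced_canonical h'"
    using reduced_canonical_opt[OF K(1)] g(1) \<open>right_opts K = {|h'|}\<close> by auto
  ultimately show ?thesis
    using g reduced_canonical_eq_num ab by (intro game_eqI) auto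
qed

lemma rcf_eq_switch:
  assumes "dyadic a" "dyadic b" "b < a" "G =\<^sub>I switch a b"
  shows "rcf G = switch a b"
  unfolding rcf_def
proof (rule the_equality)
  show "reduced_canonical (switch a b) \<and> G =\<^sub>I switch a b"
    using assms reduced_canonical_switch by simp
  fix K assume K: "reduced_canonical K \<and> G =\<^sub>I K"
  then have "K =\<^sub>I switch a b"
    using assms(4) by (meson inf_eq_trans inf_eq_sym)
  with K show "K = switch a b"
    using assms(1-3) reduced_canonical_eq_switch by blast
qed

lemma inf_eq_switchI:
  assumes ab: "dyadic a" "dyadic b" "b < a"
    and G: "gv (num b) \<lesssim> gv G" "gv G \<lesssim> gv (num a)"
    and left: "l |\<in>| left_opts G" "gv (num a) \<lesssim> gv l"
      "\<And>g. g |\<in>| left_opts G \<Longrightarrow> gv g \<lesssim> gv (num a)"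
    and right: "r |\<in>| right_opts G" "gv r \<lesssim> gv (num b)"
      "\<And>g. g |\<in>| right_opts G \<Longrightarrow> gv (num b) \<lesssim> gv g \<or> (\<exists>k. k |\<in>| left_opts g \<and> gv (num a) \<lesssim> gv k)"
  shows "G =\<^sub>I switch a b"
  unfolding inf_eq_iff
proof
  note sb = switch_bounds[OF ab]
  define S where "S = switch a b"
  note sb = sb[folded S_def]
  have S_opts: "left_opts S = {|num a|}" "right_opts S = {|num b|}"
    by (simp_all add: S_def)
  have "gv G \<le> gv (S + num e)" if e: "dyadic e" "e > 0" for e
  proof (subst gv_le_rec, intro conjI allI impI)
    fix g assume g: "g |\<in>| left_opts G"
    have "gv g \<le> gv (num a + num e)"
      using left(3)[OF g] e by (simp add: inf_le_def)
    moreover have "\<not> gv (S + num e) \<le> gv (num a + num e)"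
      by (rule gv_not_left_opt_ge) (simp add: S_opts)
    ultimately show "\<not> gv (S + num e) \<le> gv g"
      by (meson order_trans)
  next
    fix h assume "h |\<in>| right_opts (S + num e)"
    then consider "h = num b + num e" | y where "dyadic y" "y > e" "h = S + num y"
      using e by (auto simp: S_opts elim: right_opt_num)
    then show "\<not> gv h \<le> gv G"
    proof cases
      case 1
      have "gv r \<le> gv h"
        using right(2) e unfolding 1 by (simp add: inf_le_def)
      then show ?thesis
        using gv_not_right_opt_le[OF right(1)] by (meson order_trans)
    next
      case 2
      have "gv G \<le> gv (num a + num y)"
        using G(2) 2(1,2) e by (simp add: inf_le_def)
      moreover have "\<not> gv h \<le> gv (num a + num y)"
        unfolding 2 by (rule gv_not_left_opt_ge) (simp add: S_opts)
      ultimately show ?thesis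
        by (meson order_trans)
    qed
  qed
  then show "gv G \<lesssim> gv (switch a b)"
    by (simp add: inf_le_def S_def)
  have "gv S \<le> gv (G + num e)" if e: "dyadic e" "e > 0" for e
  proof (subst gv_le_rec, intro conjI allI impI)
    fix g assume "g |\<in>| left_opts S"
    then have "gv g \<le> gv (l + num e)"
      using left(2) e by (simp add: S_opts inf_le_def)
    moreover have "\<not> gv (G + num e) \<le> gv (l + num e)"
      by (rule gv_not_left_opt_ge) (use left(1) in simp)
    ultimately show "\<not> gv (G + num e) \<le> gv g"
      by (meson order_trans)
  next
    have b: "\<not> gv (num b) \<le> gv S"
      by (rule gv_not_right_opt_le) (simp add: S_opts)
    fix h assume "h |\<in>| right_opts (G + num e)"
    then consider g where "g |\<in>| right_opts G" "h = g + num e" | y where "dyadic y" "y > e" "h = G + num y"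
      using e by (auto elim: right_opt_num)
    then show "\<not> gv h \<le> gv S"
    proof cases
      case 1
      from right(3)[OF 1(1)] show ?thesis
      proof
        assume "gv (num b) \<lesssim> gv g"
        then have "gv (num b) \<le> gv h"
          using e unfolding 1 by (simp add: inf_le_def)
        with b show ?thesis
          by (meson order_trans)
      next
        assume "\<exists>k. k |\<in>| left_opts g \<and> gv (num a) \<lesssim> gv k"
        then obtain k where k: "k |\<in>| left_opts g" "gv S \<lesssim> gv k"
          using sb(5) inf_le_trans by blast
        have "gv S \<le> gv (k + num e)"
          using k(2) e by (simp add: inf_le_def)
        moreover have "\<not> gv h \<le> gv (k + num e)"
          unfolding 1 by (rule gv_not_left_opt_ge) (use k in simp)
        ultimately show ?thesis
          by (meson order_trans)
      qed
    next
      case 2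
      have "gv (num b) \<le> gv h"
        using G(1) 2(1,2) e unfolding 2(3) by (simp add: inf_le_def)
      with b show ?thesis
        by (meson order_trans)
    qed
  qed
  then show "gv (switch a b) \<lesssim> gv G"
    by (simp add: inf_le_def S_def)
qed

section \<open>Wythoff sequences as rotations\<close>

lemma golden_square: "golden * golden = golden + 1"
  by (simp add: golden_def field_simps)

lemma golden_bounds: "1618 / 1000 < golden" "golden < 1619 / 1000"
proof -
  have "2.236 < sqrt 5" "sqrt 5 < 2.238"
    by (rule real_less_rsqrt, simp add: power2_eq_square) (rule real_less_lsqrt, simp_all add: power2_eq_square)
  then show "1618 / 1000 < golden" "golden < 1619 / 1000"
    by (simp_all add: golden_def)
qed

lemma golden_powers:
  "(golden - 1) ^ 2 = 2 - golden" "(golden - 1) ^ 3 = 2 * golden - 3"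
  by (simp_all add: power2_eq_square power3_eq_cube algebra_simps golden_square)

lemma fib_golden: "real (fib k) * golden - real (fib (Suc k)) = - ((1 - golden) ^ k)"
proof (induction k rule: fib.induct)
  case (3 n)
  have "(1 - golden) * (1 - golden) = (1 - golden) + 1"
    by (simp add: algebra_simps golden_square)
  then have "(1 - golden) ^ Suc (Suc n) = ((1 - golden) + 1) * (1 - golden) ^ n"
    by (simp only: power_Suc mult.assoc[symmetric])
  then have "(1 - golden) ^ Suc (Suc n) = (1 - golden) ^ Suc n + (1 - golden) ^ n"
    by (simp add: algebra_simps)
  then show ?case
    using 3 by (simp add: algebra_simps)
qed (simp_all add: numeral_2_eq_2)

lemma fib_basis:
  "\<exists>u v. m = u * int (fib k) + v * int (fib (Suc k)) \<and> p = u * int (fib (Suc k)) + v * int (fib (Suc (Suc k)))"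
proof (induction k)
  case 0
  show ?case
    by (rule exI[of _ "p - m"], rule exI[of _ m]) simp
next
  case (Suc k)
  then obtain u v where "m = u * int (fib k) + v * int (fib (Suc k))"
    "p = u * int (fib (Suc k)) + v * int (fib (Suc (Suc k)))"
    by blast
  then show ?case
    by (intro exI[of _ "v - u"] exI[of _ u]) (simp add: algebra_simps)
qed

text \<open>
  Best approximation: writing \<open>(m, p)\<close> in the basis of two consecutive convergents, the two
  coefficients are neither both positive nor both nonpositive, so the contributions to
  \<open>m * golden - p\<close> have equal signs.
\<close>

lemma golden_best_approximation:
  fixes m p :: int
  assumes "0 < m" "m < int (fib (k + 2))"
  defines "d \<equiv> (of_int m * golden - of_int p) * (- 1) ^ Suc k"
  shows "d \<le> - ((golden - 1) ^ Suc k) \<or> (golden - 1) ^ k \<le> d"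
proof -
  obtain u v where m: "m = u * int (fib k) + v * int (fib (Suc k))"
    and p: "p = u * int (fib (Suc k)) + v * int (fib (Suc (Suc k)))"
    using fib_basis by blast
  have "of_int m * golden - of_int p =
      of_int u * (real (fib k) * golden - real (fib (Suc k))) +
      of_int v * (real (fib (Suc k)) * golden - real (fib (Suc (Suc k))))"
    unfolding m p by (simp add: algebra_simps)
  also have "\<dots> = of_int u * (- ((1 - golden) ^ k)) + of_int v * (- ((1 - golden) ^ Suc k))"
    unfolding fib_golden ..
  finally have eq: "of_int m * golden - of_int p = \<dots>" .
  have "d = of_int u * ((1 - golden) ^ k * (- 1) ^ k) - of_int v * ((1 - golden) ^ Suc k * (- 1) ^ Suc k)"
    unfolding d_def eq by (simp add: algebra_simps)
  then have d: "d = of_int u * (golden - 1) ^ k - of_int v * (golden - 1) ^ Suc k"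
    unfolding power_mult_distrib[symmetric] by simp
  have pos: "0 < (golden - 1) ^ j" for j
    using golden_bounds by simp
  consider "u \<ge> 1" "v \<ge> 1" | "u \<ge> 1" "v \<le> 0" | "u \<le> 0" "v \<ge> 1" | "u \<le> 0" "v \<le> 0"
    by linarith
  then show ?thesis
  proof cases
    case 1
    then have "1 * int (fib k) + 1 * int (fib (Suc k)) \<le> m"
      unfolding m by (intro add_mono mult_right_mono) auto
    with assms(2) show ?thesis
      by simp
  next
    case 2
    then have "1 * (golden - 1) ^ k \<le> of_int u * (golden - 1) ^ k" "of_int v * (golden - 1) ^ Suc k \<le> 0"
      using pos[of k] pos[of "Suc k"] by (intro mult_right_mono mult_nonpos_nonneg; simp)+
    then show ?thesis
      unfolding d by linarith
  next
    case 3
    then have "1 * (golden - 1) ^ Suc k \<le> of_int v * (golden - 1) ^ Suc k" "of_int u * (golden - 1) ^ k \<le> 0"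
      using pos[of k] pos[of "Suc k"] by (intro mult_right_mono mult_nonpos_nonneg; simp)+
    then show ?thesis
      unfolding d by linarith
  next
    case 4
    then have "m \<le> 0"
      unfolding m by (intro add_nonpos_nonpos mult_nonpos_nonneg) auto
    with assms(1) show ?thesis
      by simp
  qed
qed

lemma golden_best_approximation_odd:
  assumes "0 < m" "m < fib (2 * n + 3)"
  shows "real m * golden - of_int p \<le> - ((golden - 1) ^ (2 * n + 2)) \<or>
    (golden - 1) ^ (2 * n + 1) \<le> real m * golden - of_int p"
proof -
  have "2 * n + 1 + 2 = 2 * n + 3" "Suc (2 * n + 1) = 2 * n + 2" "(- 1 :: real) ^ (2 * n + 2) = 1"
    by simp_all
  moreover have "0 < int m" "int m < int (fib (2 * n + 3))"
    using assms by simp_all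
  ultimately show ?thesis
    using golden_best_approximation[of "int m" "2 * n + 1" p] by (simp only: of_int_of_nat_eq mult_1_right)
qed

lemma golden_best_approximation_even:
  assumes "0 < m" "m < fib (2 * n + 2)"
  shows "real m * golden - of_int p \<le> - ((golden - 1) ^ (2 * n)) \<or>
    (golden - 1) ^ (2 * n + 1) \<le> real m * golden - of_int p"
proof -
  have "Suc (2 * n) = 2 * n + 1" "(- 1 :: real) ^ (2 * n + 1) = - 1"
    by simp_all
  moreover have "0 < int m" "int m < int (fib (2 * n + 2))"
    using assms by simp_all
  note golden_best_approximation[OF this, of p]
  moreover have "x * - 1 \<le> - a \<or> b \<le> x * - 1 \<Longrightarrow> x \<le> - b \<or> a \<le> x" for x a b :: real
    by linarith
  ultimately show ?thesis
    unfolding of_int_of_nat_eq by metis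
qed

lemma fib_gt: "n < fib (2 * n + 3)"
proof (induction n)
  case (Suc n)
  have "0 < fib (2 * n + 4)"
    by (simp add: fib_neq_0_nat)
  moreover have "fib (2 * Suc n + 3) = fib (2 * n + 4) + fib (2 * n + 3)"
    by (simp add: eval_nat_numeral)
  ultimately show ?case
    using Suc by simp
qed (simp add: eval_nat_numeral)

lemma golden_irrational:
  assumes "m > 0"
  shows "real m * golden \<noteq> of_int p"
proof
  assume "real m * golden = of_int p"
  moreover have "0 < (golden - 1) ^ j" for j
    using golden_bounds by simp
  ultimately show False
    using golden_best_approximation_odd[OF assms fib_gt[of m], of p]
    by (metis diff_self neg_0_le_iff_le not_le)
qed

lemma frac_mult_golden_pos: "m > 0 \<Longrightarrow> 0 < frac (real m * golden)"
  using golden_irrational by (auto simp: frac_gt_0_iff elim!: Ints_cases)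

lemma frac_eqI:
  assumes "x = of_int p + a" "0 \<le> a" "a < 1"
  shows "frac x = a"
  using assms by (simp add: frac_unique_iff)

lemma golden_floor_split: "real n * golden = real (A n) + frac (real n * golden)"
proof -
  have "0 \<le> real n * golden"
    using golden_bounds by simp
  then show ?thesis
    by (simp add: A_def frac_def)
qed

lemma B_eq: "B n = A n + n"
proof -
  have "real n * golden ^ 2 = real n * golden + of_nat n"
    by (simp add: power2_eq_square algebra_simps golden_square)
  moreover have "0 \<le> \<lfloor>real n * golden\<rfloor>"
    using golden_bounds by simp
  ultimately show ?thesis
    by (simp add: A_def B_def nat_add_distrib)
qed

lemma frac_A:
  assumes "n > 0"
  shows "frac (real (A n) * golden) = 1 - frac (real n * golden) * (golden - 1)"
proof (rule frac_eqI)
  let ?d = "frac (real n * golden)"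
  have A: "real (A n) = real n * golden - ?d"
    using golden_floor_split[of n] by simp
  have "real (A n) * golden = real n * (golden * golden) - ?d * golden"
    unfolding A by (simp only: left_diff_distrib mult.assoc)
  also have "\<dots> = (real n * golden - ?d) + real n + ?d - ?d * golden"
    unfolding golden_square by (simp add: algebra_simps)
  also have "\<dots> = of_int (int (A n) + int n - 1) + (1 - ?d * (golden - 1))"
    using golden_floor_split[of n] by (simp add: algebra_simps)
  finally show "real (A n) * golden = \<dots>" .
  have "0 < ?d" "?d < 1"
    using frac_mult_golden_pos[OF assms] frac_lt_1 by auto
  then have "0 < ?d * (golden - 1)" "?d * (golden - 1) \<le> 1 * 1"
    using golden_bounds by (intro mult_pos_pos mult_mono; simp)+
  then show "0 \<le> 1 - ?d * (golden - 1)" "1 - ?d * (golden - 1) < 1"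
    by simp_all
qed

lemma frac_B: "frac (real (B n) * golden) = frac (real n * golden) * (2 - golden)"
proof (rule frac_eqI)
  let ?d = "frac (real n * golden)"
  have B: "real (B n) = real n * golden - ?d + real n"
    using golden_floor_split[of n] by (simp add: B_eq)
  have "real (B n) * golden = real n * (golden * golden) - ?d * golden + real n * golden"
    unfolding B by (simp only: left_diff_distrib distrib_right mult.assoc)
  also have "\<dots> = 2 * (real n * golden - ?d) + real n + ?d * (2 - golden)"
    unfolding golden_square by (simp add: algebra_simps)
  also have "\<dots> = of_int (2 * int (A n) + int n) + ?d * (2 - golden)"
    using golden_floor_split[of n] by (simp add: algebra_simps)
  finally show "real (B n) * golden = \<dots>" .
  show "0 \<le> ?d * (2 - golden)"
    using golden_bounds frac_ge_0 by simp
  have "?d * (2 - golden) \<le> 1 * (2 - golden)"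
    using golden_bounds frac_lt_1 by (intro mult_right_mono less_imp_le) auto
  also have "\<dots> < 1"
    using golden_bounds by simp
  finally show "?d * (2 - golden) < 1" .
qed

lemma A_image_iff:
  assumes "m > 0"
  shows "(\<exists>i\<ge>1. A i = m) \<longleftrightarrow> 2 - golden < frac (real m * golden)"
proof
  assume "\<exists>i\<ge>1. A i = m"
  then obtain i where i: "i \<ge> 1" "A i = m" by blast
  have "frac (real i * golden) * (golden - 1) < 1 * (golden - 1)"
    using golden_bounds frac_lt_1 by (intro mult_strict_right_mono) auto
  then show "2 - golden < frac (real m * golden)"
    using frac_A[of i] i by simp
next
  let ?f = "frac (real m * golden)"
  assume f: "2 - golden < ?f"
  define d where "d = (1 - ?f) * golden"
  have "?f < 1"
    by (rule frac_lt_1)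
  then have "0 < d"
    unfolding d_def using golden_bounds by simp
  have "(1 - ?f) * golden < (golden - 1) * golden"
    using f golden_bounds by (intro mult_strict_right_mono) auto
  then have "d < 1"
    unfolding d_def by (simp add: algebra_simps golden_square)
  have "m \<le> A m"
    using golden_bounds assms by (simp add: A_def le_nat_iff le_floor_iff)
  define i where "i = A m - m + 1"
  have i: "real i = real (A m) - real m + 1"
    using \<open>m \<le> A m\<close> by (simp add: i_def)
  have "real i = real m * golden - ?f - real m + 1"
    using golden_floor_split[of m] by (simp add: i)
  then have "real i * golden = (real m * golden - ?f - real m + 1) * golden"
    by (rule arg_cong)
  also have "\<dots> = real m * (golden * golden) - real m * golden + (1 - ?f) * golden"
    by (simp add: algebra_simps)
  also have "\<dots> = real m + d"
    unfolding golden_square d_def by (simp add: algebra_simps)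
  finally have "\<lfloor>real i * golden\<rfloor> = int m"
    using \<open>0 < d\<close> \<open>d < 1\<close> by (simp add: floor_eq_iff)
  then have "A i = m" "i \<ge> 1"
    by (simp_all add: A_def i_def)
  then show "\<exists>i\<ge>1. A i = m"
    by blast
qed

lemma B_image_iff:
  assumes "m > 0"
  shows "(\<exists>i\<ge>1. B i = m) \<longleftrightarrow> frac (real m * golden) < 2 - golden"
proof
  assume "\<exists>i\<ge>1. B i = m"
  then obtain i where i: "i \<ge> 1" "B i = m" by blast
  have "frac (real i * golden) * (2 - golden) < 1 * (2 - golden)"
    using golden_bounds frac_lt_1 by (intro mult_strict_right_mono) auto
  then show "frac (real m * golden) < 2 - golden"
    using frac_B[of i] i by simp
next
  let ?f = "frac (real m * golden)"
  assume f: "?f < 2 - golden"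
  define d where "d = ?f * (golden + 1)"
  have "0 \<le> d"
    unfolding d_def using golden_bounds frac_ge_0 by simp
  have "?f * (golden + 1) < (2 - golden) * (golden + 1)"
    using f golden_bounds by (intro mult_strict_right_mono) auto
  then have "d < 1"
    unfolding d_def by (simp add: algebra_simps golden_square)
  have "real (A m) \<le> real m * golden"
    using golden_floor_split[of m] frac_ge_0[of "real m * golden"] by linarith
  also have "\<dots> < real m * 2"
    using golden_bounds assms by (intro mult_strict_left_mono) auto
  finally have less: "A m < 2 * m"
    by linarith
  define i where "i = 2 * m - A m"
  have i: "real i = 2 * real m - real (A m)"
    using less by (simp add: i_def)
  have "real i = 2 * real m - real m * golden + ?f"
    using golden_floor_split[of m] by (simp add: i)
  then have "real i * golden ^ 2 = (2 * real m - real m * golden + ?f) * (golden * golden)"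
    unfolding power2_eq_square by (rule arg_cong)
  also have "\<dots> = real m * ((2 - golden) * (golden + 1)) + d"
    unfolding golden_square d_def by (simp add: algebra_simps)
  also have "(2 - golden) * (golden + 1) = 1"
    by (simp add: algebra_simps golden_square)
  finally have "real i * golden ^ 2 = real m + d"
    by simp
  then have "\<lfloor>real i * golden ^ 2\<rfloor> = int m"
    using \<open>0 \<le> d\<close> \<open>d < 1\<close> by (simp add: floor_eq_iff)
  then have "B i = m" "i \<ge> 1"
    using less by (simp_all add: B_def i_def)
  then show "\<exists>i\<ge>1. B i = m"
    by blast
qed

text \<open>
  The position of the heap \<open>h\<close> on the circle. Moves are arcs: Left moves forward by less than
  \<open>golden - 1\<close>, Right moves backward by less than \<open>2 - golden\<close>. The shift by one puts the point
  \<open>0\<close> between the positions of \<open>AB0_hat\<close> and those of \<open>B_set\<close>.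
\<close>

definition pos :: "nat \<Rightarrow> real" where
  "pos h = frac (real (h + 1) * golden)"

lemma pos_bounds: "0 < pos h" "pos h < 1"
  using frac_mult_golden_pos[of "h + 1"] frac_lt_1 by (simp_all add: pos_def)

lemma frac_diff_pos:
  assumes "k < h"
  shows "frac (real (h - k) * golden) = (if pos k \<le> pos h then pos h - pos k else pos h - pos k + 1)"
proof -
  let ?p = "\<lfloor>real (h + 1) * golden\<rfloor> - \<lfloor>real (k + 1) * golden\<rfloor>"
  have "real (h - k) * golden = real (h + 1) * golden - real (k + 1) * golden"
    using assms by (simp add: algebra_simps)
  then have eq: "real (h - k) * golden = of_int ?p + (pos h - pos k)"
    by (simp add: pos_def frac_def)
  then have eq': "real (h - k) * golden = of_int (?p - 1) + (pos h - pos k + 1)"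
    by simp
  show ?thesis
    using pos_bounds[of h] pos_bounds[of k] frac_eqI[OF eq] frac_eqI[OF eq'] by simp
qed

lemma left_heaps_iff:
  "k \<in> left_heaps h \<longleftrightarrow> k < h \<and> (2 - golden < pos h - pos k \<or> pos h < pos k \<and> pos k - pos h < golden - 1)"
proof -
  have "k \<in> left_heaps h \<longleftrightarrow> k < h \<and> (\<exists>i\<ge>1. A i = h - k)"
  proof
    assume "k \<in> left_heaps h"
    then obtain i where "i \<ge> 1" "A i \<le> h" "k = h - A i"
      by (auto simp: left_heaps_def)
    with A_pos[of i] show "k < h \<and> (\<exists>i\<ge>1. A i = h - k)"
      by (intro conjI exI[of _ i]) linarith+
  next
    assume "k < h \<and> (\<exists>i\<ge>1. A i = h - k)"
    then obtain i where "k < h" "i \<ge> 1" "A i = h - k"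
      by blast
    then show "k \<in> left_heaps h"
      unfolding left_heaps_def by (intro CollectI exI[of _ i]) linarith
  qed
  also have "\<dots> \<longleftrightarrow> k < h \<and> 2 - golden < frac (real (h - k) * golden)"
    using A_image_iff[of "h - k"] by (metis zero_less_diff)
  finally show ?thesis
    using golden_bounds pos_bounds[of h] pos_bounds[of k] frac_diff_pos[of k h]
    by (cases "pos k \<le> pos h"; cases "k < h") (simp_all, linarith+)
qed

lemma right_heaps_iff:
  "k \<in> right_heaps h \<longleftrightarrow> k < h \<and> (pos k \<le> pos h \<and> pos h - pos k < 2 - golden \<or> golden - 1 < pos k - pos h)"
proof -
  have "k \<in> right_heaps h \<longleftrightarrow> k < h \<and> (\<exists>i\<ge>1. B i = h - k)"
  proof
    assume "k \<in> right_heaps h"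
    then obtain i where "i \<ge> 1" "B i \<le> h" "k = h - B i"
      by (auto simp: right_heaps_def)
    with B_pos[of i] show "k < h \<and> (\<exists>i\<ge>1. B i = h - k)"
      by (intro conjI exI[of _ i]) linarith+
  next
    assume "k < h \<and> (\<exists>i\<ge>1. B i = h - k)"
    then obtain i where "k < h" "i \<ge> 1" "B i = h - k"
      by blast
    then show "k \<in> right_heaps h"
      unfolding right_heaps_def by (intro CollectI exI[of _ i]) linarith
  qed
  also have "\<dots> \<longleftrightarrow> k < h \<and> frac (real (h - k) * golden) < 2 - golden"
    using B_image_iff[of "h - k"] by (metis zero_less_diff)
  finally show ?thesis
    using golden_bounds pos_bounds[of h] pos_bounds[of k] frac_diff_pos[of k h]
    by (cases "pos k \<le> pos h"; cases "k < h") (simp_all, linarith+)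
qed

lemma pos_inj: "pos h = pos k \<Longrightarrow> h = k"
proof (rule ccontr)
  have less: False if "pos h = pos k" "k < h" for h k
    using frac_diff_pos[OF that(2)] frac_mult_golden_pos[of "h - k"] that by simp
  assume "pos h = pos k" "h \<noteq> k"
  then show False
    using less[of h k] less[of k h] by linarith
qed

lemma fib_odd_ge_2: "2 \<le> fib (2 * n + 3)"
  using fib_mono[of 3 "2 * n + 3"] by (simp add: eval_nat_numeral)

lemma fib_odd_golden: "real (fib (2 * n + 1)) * golden = real (fib (2 * n + 2)) + (golden - 1) ^ (2 * n + 1)"
proof -
  have "(1 - golden) ^ (2 * n + 1) = - ((golden - 1) ^ (2 * n + 1))"
    by (subst power_minus_odd[symmetric]) simp_all
  then show ?thesis
    using fib_golden[of "2 * n + 1"] by (simp del: power_Suc power_add)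
qed

lemma fib_even_golden: "real (fib (2 * n)) * golden = real (fib (2 * n + 1)) - (golden - 1) ^ (2 * n)"
proof -
  have "(1 - golden) ^ (2 * n) = (golden - 1) ^ (2 * n)"
    by (subst power_minus_even[symmetric]) simp_all
  then show ?thesis
    using fib_golden[of "2 * n"] by (simp del: power_Suc power_add)
qed

definition psi :: real where
  "psi = golden - 1"

lemma psi_bounds: "0 < psi ^ j" "psi ^ Suc j < psi ^ j"
  using golden_bounds by (simp_all add: psi_def)

lemma psi_mono: "i \<le> j \<Longrightarrow> psi ^ j \<le> psi ^ i"
  using golden_bounds by (simp add: psi_def power_decreasing)

lemma psi_strict_mono: "i < j \<Longrightarrow> psi ^ j < psi ^ i"
  using golden_bounds by (simp add: psi_def power_strict_decreasing)

lemma psi_powers: "psi ^ 3 = 2 * golden - 3" "psi ^ 4 = 5 - 3 * golden"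
proof -
  show "psi ^ 3 = 2 * golden - 3"
    by (simp add: psi_def golden_powers)
  have "psi ^ 4 = (psi ^ 2) ^ 2"
    by simp
  also have "\<dots> = 5 - 3 * golden"
    unfolding psi_def golden_powers by (simp add: power2_eq_square algebra_simps golden_square)
  finally show "psi ^ 4 = 5 - 3 * golden" .
qed

lemma pos_eqI:
  assumes "real (h + 1) * golden = of_int p + a" "0 \<le> a" "a < 1"
  shows "pos h = a"
  unfolding pos_def using assms by (rule frac_eqI)

definition fib_odd_point :: "nat \<Rightarrow> nat" where
  "fib_odd_point n = fib (2 * n + 3) - 2"

definition fib_even_point :: "nat \<Rightarrow> nat" where
  "fib_even_point n = fib (2 * n + 4) - 2"

lemma pos_fib_odd_point: "pos (fib_odd_point n) = 2 - golden + psi ^ (2 * n + 3)"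
proof (rule pos_eqI)
  have "real (fib (2 * n + 3)) * golden = real (fib (2 * n + 4)) + psi ^ (2 * n + 3)"
    using fib_odd_golden[of "n + 1"] by (simp add: psi_def eval_nat_numeral)
  then show "real (fib_odd_point n + 1) * golden = of_int (int (fib (2 * n + 4)) - 2) + (2 - golden + psi ^ (2 * n + 3))"
    using fib_odd_ge_2[of n] by (simp add: fib_odd_point_def of_nat_diff algebra_simps)
  show "0 \<le> 2 - golden + psi ^ (2 * n + 3)" "2 - golden + psi ^ (2 * n + 3) < 1"
    using psi_bounds(1)[of "2 * n + 3"] psi_mono[of 3 "2 * n + 3"] psi_powers golden_bounds by simp_all
qed

lemma pos_fib_odd_point_Suc: "pos (fib_odd_point n + 1) = psi ^ (2 * n + 3)"
proof (rule pos_eqI)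
  have "real (fib (2 * n + 3)) * golden = real (fib (2 * n + 4)) + psi ^ (2 * n + 3)"
    using fib_odd_golden[of "n + 1"] by (simp add: psi_def eval_nat_numeral)
  then show "real (fib_odd_point n + 1 + 1) * golden = of_int (int (fib (2 * n + 4))) + psi ^ (2 * n + 3)"
    using fib_odd_ge_2[of n] by (simp add: fib_odd_point_def of_nat_diff algebra_simps)
  show "0 \<le> psi ^ (2 * n + 3)" "psi ^ (2 * n + 3) < 1"
    using psi_bounds(1)[of "2 * n + 3"] psi_mono[of 3 "2 * n + 3"] psi_powers golden_bounds by simp_all
qed

lemma pos_fib_even_point: "pos (fib_even_point n) = 2 - golden - psi ^ (2 * n + 4)"
proof (rule pos_eqI)
  have "real (fib (2 * n + 4)) * golden = real (fib (2 * n + 5)) - psi ^ (2 * n + 4)"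
    using fib_even_golden[of "n + 2"] by (simp add: psi_def eval_nat_numeral)
  moreover have "2 \<le> fib (2 * n + 4)"
    using fib_mono[of 3 "2 * n + 4"] by (simp add: eval_nat_numeral)
  ultimately show "real (fib_even_point n + 1) * golden = of_int (int (fib (2 * n + 5)) - 2) + (2 - golden - psi ^ (2 * n + 4))"
    by (simp add: fib_even_point_def of_nat_diff algebra_simps)
  show "0 \<le> 2 - golden - psi ^ (2 * n + 4)" "2 - golden - psi ^ (2 * n + 4) < 1"
    using psi_bounds(1)[of "2 * n + 4"] psi_mono[of 4 "2 * n + 4"] psi_powers golden_bounds by simp_all
qed

lemma pos_0: "pos 0 = golden - 1"
  using pos_fib_odd_point[of 0] psi_powers by (simp add: fib_odd_point_def eval_nat_numeral)

lemma pos_1: "pos 1 = 2 * golden - 3"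
  using pos_fib_odd_point_Suc[of 0] psi_powers by (simp add: fib_odd_point_def eval_nat_numeral)

lemma pos_shift: "real (h + 2) * golden - of_int (\<lfloor>real (h + 1) * golden\<rfloor> + 2) = pos h - (2 - golden)"
  by (simp add: pos_def frac_def algebra_simps)

lemma pos_neq: "pos h \<noteq> 2 - golden"
  using pos_shift[of h] golden_irrational[of "h + 2"] by (metis add_gr_0 eq_iff_diff_eq_0 zero_less_numeral)

lemma pos_gap_odd:
  assumes "h + 2 < fib (2 * n + 3)"
  shows "pos h \<le> 2 - golden - psi ^ (2 * n + 2) \<or> 2 - golden + psi ^ (2 * n + 1) \<le> pos h"
  using golden_best_approximation_odd[of "h + 2" n "\<lfloor>real (h + 1) * golden\<rfloor> + 2"] assms
  unfolding pos_shift psi_def by linarith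

lemma pos_gap_even:
  assumes "h + 2 < fib (2 * n + 2)"
  shows "pos h \<le> 2 - golden - psi ^ (2 * n) \<or> 2 - golden + psi ^ (2 * n + 1) \<le> pos h"
  using golden_best_approximation_even[of "h + 2" n "\<lfloor>real (h + 1) * golden\<rfloor> + 2"] assms
  unfolding pos_shift psi_def by linarith

lemma pos_gap_fib_odd_point:
  assumes "h < fib_odd_point (Suc n)"
  shows "pos h \<le> pos (fib_even_point n) \<or> pos (fib_odd_point n) \<le> pos h"
proof -
  have "h + 2 < fib (2 * Suc n + 3)"
    using assms by (simp add: fib_odd_point_def)
  moreover have "2 * Suc n + 2 = 2 * n + 4" "2 * Suc n + 1 = 2 * n + 3"
    by simp_all
  ultimately show ?thesis
    using pos_gap_odd[of h "Suc n"] unfolding pos_fib_even_point pos_fib_odd_point by metis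
qed

lemma pos_gap_fib_even_point:
  assumes "h < fib_even_point (Suc n)"
  shows "pos h \<le> pos (fib_even_point n) \<or> pos (fib_odd_point (Suc n)) \<le> pos h"
proof -
  have "h + 2 < fib (2 * Suc n + 4)"
    using assms unfolding fib_even_point_def by linarith
  moreover have "2 * Suc (Suc n) + 2 = 2 * Suc n + 4"
    by simp
  moreover have "2 * Suc (Suc n) = 2 * n + 4" "2 * Suc (Suc n) + 1 = 2 * Suc n + 3"
    by simp_all
  ultimately show ?thesis
    using pos_gap_even[of h "Suc (Suc n)"] unfolding pos_fib_even_point pos_fib_odd_point by metis
qed

lemma pos_ge_before_fib_odd_point:
  assumes "h < fib_odd_point n"
  shows "psi ^ (2 * n + 1) \<le> pos h"
proof -
  have "real (h + 1) * golden - of_int \<lfloor>real (h + 1) * golden\<rfloor> = pos h"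
    by (simp add: pos_def frac_def)
  moreover have "h + 1 < fib (2 * n + 3)"
    using assms by (simp add: fib_odd_point_def)
  ultimately show ?thesis
    using golden_best_approximation_odd[of "h + 1" n "\<lfloor>real (h + 1) * golden\<rfloor>"]
      pos_bounds[of h] psi_bounds(1)[of "2 * n + 2"]
    unfolding psi_def by auto
qed

text \<open>The index is shifted: the arc \<open>in_G_zone n\<close> belongs to \<open>G_set (n + 1)\<close>.\<close>

definition in_G_zone :: "nat \<Rightarrow> nat \<Rightarrow> bool" where
  "in_G_zone n h \<longleftrightarrow> pos (fib_odd_point (Suc n)) < pos h \<and> pos h < pos (fib_odd_point n)"

lemma in_G_zone_gt:
  assumes "in_G_zone n h"
  shows "fib_odd_point (Suc n) + 1 < h"
proof -
  have "\<not> h < fib_odd_point (Suc n)"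
  proof
    assume "h < fib_odd_point (Suc n)"
    then have "pos h \<le> pos (fib_even_point n)"
      using assms pos_gap_fib_odd_point[of h n] by (auto simp: in_G_zone_def)
    then show False
      using assms psi_bounds(1)[of "2 * n + 4"] psi_bounds(1)[of "2 * Suc n + 3"]
      unfolding in_G_zone_def pos_fib_even_point pos_fib_odd_point by linarith
  qed
  moreover have "h \<noteq> fib_odd_point (Suc n)"
    using assms by (auto simp: in_G_zone_def)
  moreover have "h \<noteq> fib_odd_point (Suc n) + 1"
  proof
    assume "h = fib_odd_point (Suc n) + 1"
    then have "pos h = psi ^ (2 * Suc n + 3)"
      by (simp only: pos_fib_odd_point_Suc)
    also have "\<dots> \<le> 2 * golden - 3"
      unfolding psi_powers(1)[symmetric] by (rule psi_mono) simp
    finally show False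
      using assms golden_bounds psi_bounds(1)[of "2 * Suc n + 3"]
      unfolding in_G_zone_def pos_fib_odd_point by argo
  qed
  ultimately show ?thesis
    by linarith
qed

definition in_Q :: "nat \<Rightarrow> bool" where
  "in_Q h \<longleftrightarrow> (2 * golden - 3 < pos h \<and> pos h < 2 - golden) \<or> (\<exists>n. h = fib_odd_point n)"

lemma zone_cases:
  obtains (hat) "pos h \<le> 2 * golden - 3" | (Q) "in_Q h" | (G) n where "in_G_zone n h"
    | (B) "golden - 1 < pos h"
proof -
  consider "pos h \<le> 2 * golden - 3" | "2 * golden - 3 < pos h" "pos h < 2 - golden"
    | "2 - golden < pos h" "pos h \<le> golden - 1" | "golden - 1 < pos h"
    using pos_neq[of h] by linarith
  then show thesis
  proof cases
    case 3
    define d where "d = pos h - (2 - golden)"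
    have "d > 0"
      using 3 by (simp add: d_def)
    have "psi < 1"
      using golden_bounds by (simp add: psi_def)
    then obtain j where "psi ^ j < d"
      using \<open>d > 0\<close> real_arch_pow_inv by blast
    moreover have "psi ^ (2 * j + 3) \<le> psi ^ j"
      by (rule psi_mono) simp
    ultimately have ex: "\<exists>n. psi ^ (2 * n + 3) \<le> d"
      by (meson less_imp_le order_trans)
    define n where "n = (LEAST n. psi ^ (2 * n + 3) \<le> d)"
    have n: "psi ^ (2 * n + 3) \<le> d"
      unfolding n_def using ex by (rule LeastI_ex)
    show thesis
    proof (cases "psi ^ (2 * n + 3) = d")
      case True
      then have "pos h = pos (fib_odd_point n)"
        by (simp add: pos_fib_odd_point d_def)
      then show thesis
        using Q pos_inj by (auto simp: in_Q_def)
    next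
      case False
      then have less: "psi ^ (2 * n + 3) < d"
        using n by simp
      have "n \<noteq> 0"
      proof
        assume "n = 0"
        then show False
          using less 3 psi_powers by (simp add: d_def)
      qed
      then obtain m where m: "n = Suc m"
        using not0_implies_Suc by blast
      have "\<not> psi ^ (2 * m + 3) \<le> d"
        using not_less_Least[of m "\<lambda>n. psi ^ (2 * n + 3) \<le> d"] m by (simp add: n_def)
      then have "in_G_zone m h"
        using less unfolding in_G_zone_def pos_fib_odd_point d_def m by linarith
      then show thesis
        by (rule G)
    qed
  qed (use hat Q B in \<open>auto simp: in_Q_def\<close>)
qed

lemma pos_eq_frac:
  "pos h = (if frac (real h * golden) < 2 - golden then frac (real h * golden) + (golden - 1)
     else frac (real h * golden) + (golden - 2))"
proof -
  have eq: "real (h + 1) * golden = of_int (\<lfloor>real h * golden\<rfloor> + 1) + (frac (real h * golden) + (golden - 1))"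
    by (simp add: frac_def algebra_simps)
  then have eq': "real (h + 1) * golden = of_int (\<lfloor>real h * golden\<rfloor> + 2) + (frac (real h * golden) + (golden - 2))"
    by simp
  show ?thesis
    using pos_eqI[OF eq] pos_eqI[OF eq'] golden_bounds frac_ge_0[of "real h * golden"] frac_lt_1[of "real h * golden"]
    by (cases "frac (real h * golden) < 2 - golden") simp_all
qed

lemma B_set_zone: "h \<in> B_set \<Longrightarrow> golden - 1 < pos h"
proof -
  assume "h \<in> B_set"
  then obtain n where n: "n \<ge> 1" "B n = h"
    by (auto simp: B_set_def)
  then have "h > 0"
    using B_pos[of n] by simp
  then have "0 < frac (real h * golden)" "frac (real h * golden) < 2 - golden"
    using frac_mult_golden_pos B_image_iff[of h] n by auto
  then show ?thesis
    by (simp add: pos_eq_frac)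
qed

lemma AB0_hat_zone: "h \<in> AB0_hat \<Longrightarrow> pos h \<le> 2 * golden - 3"
proof -
  assume "h \<in> AB0_hat"
  then obtain n where h: "h = A (B n) + 1"
    by (auto simp: AB0_hat_def)
  show ?thesis
  proof (cases "n = 0")
    case True
    then show ?thesis
      using pos_1 by (simp add: h A_def B_def)
  next
    case False
    define d where "d = frac (real n * golden)"
    define c where "c = d * (2 * golden - 3)"
    have "B n > 0"
      using B_pos[of n] False by simp
    have d: "0 < d" "d < 1"
      using frac_mult_golden_pos[of n] False frac_lt_1 by (auto simp: d_def)
    have "(2 - golden) * (golden - 1) = 2 * golden - 3"
      by (simp add: algebra_simps golden_square)
    then have split: "d * (2 - golden) * (golden - 1) = c"
      unfolding c_def by (simp only: mult.assoc)
    have "d * (2 * golden - 3) \<le> 1 * (2 * golden - 3)" "0 < d * (2 * golden - 3)"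
      using d golden_bounds by (intro mult_right_mono mult_pos_pos; simp)+
    then have c: "c \<le> 2 * golden - 3" "0 < c"
      unfolding c_def by simp_all
    have "frac (real (A (B n)) * golden) = 1 - c"
      using frac_A[OF \<open>B n > 0\<close>] unfolding frac_B d_def[symmetric] split .
    then have "pos (A (B n)) = golden - 1 - c"
      using golden_bounds c by (simp add: pos_eq_frac)
    then have "real (A (B n) + 1) * golden = of_int \<lfloor>real (A (B n) + 1) * golden\<rfloor> + (golden - 1 - c)"
      by (simp add: pos_def frac_def)
    then have "real (h + 1) * golden = of_int (\<lfloor>real (A (B n) + 1) * golden\<rfloor> + 2) + (2 * golden - 3 - c)"
      by (simp add: h algebra_simps)
    then have "pos h = 2 * golden - 3 - c"
      by (rule pos_eqI) (use golden_bounds c in linarith)+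
    then show ?thesis
      using c by simp
  qed
qed

lemma BB_hat_zone: "h \<in> BB_hat \<Longrightarrow> 2 * golden - 3 < pos h \<and> pos h < 2 - golden"
proof -
  assume "h \<in> BB_hat"
  then obtain n where n: "n \<ge> 1" and h: "h = B (B n) + 1"
    by (auto simp: BB_hat_def)
  define d where "d = frac (real n * golden)"
  define c where "c = d * (5 - 3 * golden)"
  have d: "0 < d" "d < 1"
    using frac_mult_golden_pos[of n] n frac_lt_1 by (auto simp: d_def)
  have "(2 - golden) * (2 - golden) = 5 - 3 * golden"
    by (simp add: algebra_simps golden_square)
  then have frac: "frac (real (B (B n)) * golden) = c"
    unfolding frac_B d_def[symmetric] c_def by (simp only: mult.assoc)
  have "d * (5 - 3 * golden) < 1 * (5 - 3 * golden)" "0 < d * (5 - 3 * golden)"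
    using d golden_bounds by (intro mult_strict_right_mono mult_pos_pos; simp)+
  then have c: "c < 5 - 3 * golden" "0 < c"
    unfolding c_def by simp_all
  then have "pos (B (B n)) = c + golden - 1"
    using golden_bounds by (simp add: pos_eq_frac frac)
  then have "real (B (B n) + 1) * golden = of_int \<lfloor>real (B (B n) + 1) * golden\<rfloor> + (c + golden - 1)"
    by (simp add: pos_def frac_def)
  then have "real (h + 1) * golden = of_int (\<lfloor>real (B (B n) + 1) * golden\<rfloor> + 2) + (c + 2 * golden - 3)"
    by (simp add: h algebra_simps)
  then have "pos h = c + 2 * golden - 3"
    by (rule pos_eqI) (use c golden_bounds in linarith)+
  then show ?thesis
    using c by simp
qed

lemma Q_set_in_Q: "h \<in> Q_set \<Longrightarrow> in_Q h"
  using BB_hat_zone by (auto simp: Q_set_def in_Q_def fib_odd_point_def)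

lemma AB0_if_zone:
  assumes "2 - golden < pos h" "pos h < golden - 1"
  shows "h \<in> AB0"
proof -
  have "h > 0"
    using assms pos_0 by (cases h) auto
  let ?f = "frac (real h * golden)"
  have f: "4 - 2 * golden < ?f"
  proof (cases "?f < 2 - golden")
    case True
    then have "pos h = ?f + (golden - 1)"
      by (simp add: pos_eq_frac)
    with assms(2) frac_ge_0[of "real h * golden"] show ?thesis
      by linarith
  next
    case False
    then have "pos h = ?f + (golden - 2)"
      by (simp add: pos_eq_frac)
    with assms(1) show ?thesis
      by linarith
  qed
  then obtain i where i: "i \<ge> 1" "A i = h"
    using A_image_iff[OF \<open>h > 0\<close>] golden_bounds by auto
  have "frac (real i * golden) * (golden - 1) < (2 - golden) * (golden - 1)"
    using f frac_A[of i] i by (simp add: algebra_simps golden_square)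
  then have "frac (real i * golden) < 2 - golden"
    using golden_bounds by (simp add: mult_less_cancel_right_pos)
  then obtain j where "B j = i"
    using B_image_iff[of i] i by auto
  then show ?thesis
    using i by (auto simp: AB0_def)
qed

lemma pos_G_elem:
  assumes "i > 0"
  shows "pos (G_elem i n) = 2 - golden + psi ^ (2 * n + 3) + psi ^ (2 * n + 2) * frac (real i * golden)"
proof (rule pos_eqI)
  let ?d = "frac (real i * golden)"
  have psi: "psi * golden = 1"
    by (simp add: psi_def algebra_simps golden_square)
  have G: "real (G_elem i n + 1) = real (A i) * fib (2 * n + 2) + real i * fib (2 * n + 1) + real (fib (2 * n + 3)) - 1"
    using fib_odd_ge_2[of n] by (simp add: G_elem_def A_def of_nat_diff)
  have F: "real (fib (2 * n + 3)) * golden = real (fib (2 * n + 4)) + psi ^ (2 * n + 3)"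
    "real (fib (2 * n + 2)) * golden = real (fib (2 * n + 3)) - psi ^ (2 * n + 2)"
    "real (fib (2 * n + 1)) * golden = real (fib (2 * n + 2)) + psi ^ (2 * n + 1)"
    using fib_odd_golden[of "n + 1"] fib_even_golden[of "n + 1"] fib_odd_golden[of n]
    by (simp_all add: psi_def eval_nat_numeral)
  have "psi ^ (2 * n + 2) * golden = psi ^ (2 * n + 1) * (psi * golden)"
    by simp
  then have psi_golden: "psi ^ (2 * n + 1) = psi ^ (2 * n + 2) * golden"
    unfolding psi by simp
  have "real (G_elem i n + 1) * golden = real (A i) * (real (fib (2 * n + 2)) * golden) +
      real i * (real (fib (2 * n + 1)) * golden) + real (fib (2 * n + 3)) * golden - golden"
    unfolding G by (simp add: algebra_simps)
  also have "\<dots> = real (A i) * fib (2 * n + 3) + real i * fib (2 * n + 2) + fib (2 * n + 4) - golden +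
      psi ^ (2 * n + 3) + psi ^ (2 * n + 2) * (real i * golden - real (A i))"
    unfolding F psi_golden by (simp only: ring_distribs) (simp add: algebra_simps del: power_Suc power_add)
  also have "real i * golden - real (A i) = ?d"
    using golden_floor_split[of i] by simp
  finally show "real (G_elem i n + 1) * golden =
      of_int (int (A i) * fib (2 * n + 3) + int i * fib (2 * n + 2) + fib (2 * n + 4) - 2) +
      (2 - golden + psi ^ (2 * n + 3) + psi ^ (2 * n + 2) * ?d)"
    by simp
  have "psi ^ (2 * n + 2) * ?d < psi ^ (2 * n + 2) * 1"
    using psi_bounds(1)[of "2 * n + 2"] frac_lt_1[of "real i * golden"]
    by (rule mult_strict_left_mono[rotated])
  moreover have "0 \<le> psi ^ (2 * n + 2) * ?d"
    using psi_bounds(1)[of "2 * n + 2"] frac_ge_0[of "real i * golden"] by (intro mult_nonneg_nonneg) linarith+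
  moreover have "psi ^ (2 * n + 2) \<le> psi ^ 2" "psi ^ (2 * n + 3) \<le> psi ^ 3"
    by (rule psi_mono; simp)+
  moreover have "psi ^ 2 = 2 - golden"
    by (simp add: psi_def golden_powers)
  ultimately show "0 \<le> 2 - golden + psi ^ (2 * n + 3) + psi ^ (2 * n + 2) * ?d"
    "2 - golden + psi ^ (2 * n + 3) + psi ^ (2 * n + 2) * ?d < 1"
    unfolding mult_1_right using psi_powers(1) psi_bounds(1)[of "2 * n + 3"] golden_bounds by linarith+
qed

lemma G_set_zone:
  assumes "h \<in> G_set (Suc n)"
  shows "in_G_zone n h"
proof -
  obtain i where i: "i > 0" "h = G_elem i (Suc n)"
    using assms by (auto simp: G_set_def)
  let ?d = "frac (real i * golden)"
  have d: "0 < ?d" "?d < 1"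
    using frac_mult_golden_pos[OF i(1)] frac_lt_1 by auto
  have "0 < psi ^ (2 * Suc n + 2) * ?d" "psi ^ (2 * Suc n + 2) * ?d < psi ^ (2 * Suc n + 2) * 1"
    using d psi_bounds(1)[of "2 * Suc n + 2"] by (intro mult_pos_pos mult_strict_left_mono; simp)+
  moreover have "psi ^ (2 * Suc n + 3) + psi ^ (2 * Suc n + 2) = psi ^ (2 * n + 3)"
  proof -
    have "psi ^ (2 * Suc n + 3) + psi ^ (2 * Suc n + 2) = psi ^ (2 * n + 3) * (psi ^ 2 + psi)"
      by (simp add: eval_nat_numeral algebra_simps)
    also have "psi ^ 2 + psi = 1"
      by (simp add: psi_def golden_powers)
    finally show ?thesis
      by simp
  qed
  ultimately show ?thesis
    unfolding in_G_zone_def pos_fib_odd_point i(2) pos_G_elem[OF i(1)] by (intro conjI; linarith)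
qed

lemma in_G_zone_AB0: "in_G_zone n h \<Longrightarrow> h \<in> AB0"
proof (rule AB0_if_zone)
  assume h: "in_G_zone n h"
  then show "2 - golden < pos h"
    using psi_bounds(1)[of "2 * Suc n + 3"] unfolding in_G_zone_def pos_fib_odd_point by linarith
  show "pos h < golden - 1"
    using h psi_mono[of 3 "2 * n + 3"] psi_powers unfolding in_G_zone_def pos_fib_odd_point by simp
qed

section \<open>Values of the heaps\<close>

lemma left_opts_heap: "g |\<in>| left_opts (heap h) \<longleftrightarrow> (\<exists>k\<in>left_heaps h. g = heap k)"
  by (subst heap.simps) (auto simp: Abs_fset_inverse finite_left_heaps)

lemma right_opts_heap: "g |\<in>| right_opts (heap h) \<longleftrightarrow> (\<exists>k\<in>right_heaps h. g = heap k)"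
  by (subst heap.simps) (auto simp: Abs_fset_inverse finite_right_heaps)

lemma heap_left_opt: "k \<in> left_heaps h \<Longrightarrow> heap k |\<in>| left_opts (heap h)"
  by (auto simp: left_opts_heap)

lemma heap_right_opt: "k \<in> right_heaps h \<Longrightarrow> heap k |\<in>| right_opts (heap h)"
  by (auto simp: right_opts_heap)

lemma pred_in_left_heaps: "h \<ge> 1 \<Longrightarrow> h - 1 \<in> left_heaps h"
proof -
  have "A 1 = 1"
    using golden_bounds by (simp add: A_def floor_eq_iff nat_eq_iff)
  then show "h \<ge> 1 \<Longrightarrow> h - 1 \<in> left_heaps h"
    unfolding left_heaps_def by (intro CollectI exI[of _ 1]) simp
qed

lemma pred2_in_right_heaps: "h \<ge> 2 \<Longrightarrow> h - 2 \<in> right_heaps h"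
proof -
  have "A 1 = 1"
    using golden_bounds by (simp add: A_def floor_eq_iff nat_eq_iff)
  then show "h \<ge> 2 \<Longrightarrow> h - 2 \<in> right_heaps h"
    unfolding right_heaps_def by (intro CollectI exI[of _ 1]) (simp add: B_eq)
qed

lemma heap_0: "heap 0 = num 0"
proof (rule game_eqI)
  show "left_opts (heap 0) = left_opts (num 0)"
    using left_heaps_less by (intro fset_eqI) (fastforce simp: left_opts_heap)
  show "right_opts (heap 0) = right_opts (num 0)"
    using right_heaps_less by (intro fset_eqI) (fastforce simp: right_opts_heap)
qed

lemma heap_1: "heap 1 = num 1"
proof (rule game_eqI)
  have "num 1 = dyadic_game 0 1"
    by (simp only: dyadic_game_eq_num of_int_1 power_0 div_by_1)
  then have num_1: "num 1 = Game {|0|} {||}"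
    by (simp add: int_game_def)
  have "left_heaps 1 = {0}"
    using left_heaps_less[of _ 1] pred_in_left_heaps[of 1] by fastforce
  then show "left_opts (heap 1) = left_opts (num 1)"
    unfolding num_1 by (intro fset_eqI) (simp add: left_opts_heap heap_0)
  have "k \<notin> right_heaps 1" for k
  proof
    assume "k \<in> right_heaps 1"
    then have "pos 0 \<le> pos 1 \<or> golden - 1 < pos 0 - pos 1"
      using right_heaps_less[of k 1] by (auto simp: right_heaps_iff)
    then show False
      using golden_bounds unfolding pos_0 pos_1 by linarith
  qed
  then show "right_opts (heap 1) = right_opts (num 1)"
    unfolding num_1 by (intro fset_eqI) (auto simp: right_opts_heap)
qed

lemma num_0_inf_le_heap: "gv (num 0) \<lesssim> gv (heap h)"
proof (induction h rule: less_induct)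
  case (less h)
  show ?case
  proof (rule num_inf_le_if_opts)
    show "gv (num 0) \<unlhd> gv g" if "g |\<in>| right_opts (heap h)" for g
      using that less right_heaps_less by (auto simp: right_opts_heap intro: inf_le_imp_fuzzy)
    show "gv (num 0) \<unlhd> gv (heap h)"
    proof (cases "h = 0")
      case True
      then show ?thesis
        using heap_0 by (simp add: inf_le_imp_fuzzy)
    next
      case False
      then show ?thesis
        using pred_in_left_heaps[of h] less[of "h - 1"]
        by (intro inf_fuzzy_le_left_opt[of _ "heap (h - 1)"] heap_left_opt) simp_all
    qed
  qed simp
qed

lemma heap_inf_le_num_1: "gv (heap h) \<lesssim> gv (num 1)"
proof (induction h rule: less_induct)
  case (less h)
  show ?case
  proof (rule inf_le_num_if_opts)
    show "gv g \<unlhd> gv (num 1)" if "g |\<in>| left_opts (heap h)" for g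
      using that less left_heaps_less by (auto simp: left_opts_heap intro: inf_le_imp_fuzzy)
    consider "h = 0" | "h = 1" | "h \<ge> 2"
      by linarith
    then show "gv (heap h) \<unlhd> gv (num 1)"
    proof cases
      case 1
      then show ?thesis
        by (simp only: heap_0) (simp only: inf_le_num_iff dyadic_0_1 zero_le_one)
    next
      case 2
      then show ?thesis
        by (simp only: heap_1) (simp add: inf_le_imp_fuzzy)
    next
      case 3
      then show ?thesis
        using pred2_in_right_heaps[of h] less[of "h - 2"]
        by (intro inf_fuzzy_le_right_opt[of "heap (h - 2)"] heap_right_opt) simp_all
    qed
  qed simp
qed

lemma one_in_left_heaps:
  assumes "golden - 1 < pos h"
  shows "1 \<in> left_heaps h"
proof -
  have "h \<noteq> 0" "h \<noteq> 1"
    by (rule notI, use assms golden_bounds pos_0 pos_1 in simp)+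
  then show ?thesis
    using assms unfolding left_heaps_iff pos_1 by linarith
qed

lemma num_1_inf_le_heap: "pos h \<le> 2 * golden - 3 \<Longrightarrow> gv (num 1) \<lesssim> gv (heap h)"
proof (induction h rule: less_induct)
  case (less h)
  have "h \<noteq> 0"
    by (rule notI) (use less.prems golden_bounds pos_0 in simp)
  show ?case
  proof (cases "h = 1")
    case True
    then show ?thesis
      using heap_1 by simp
  next
    case False
    have left_1: "gv (num 1) \<unlhd> gv (heap k)" if "1 \<in> left_heaps k" for k
      using heap_left_opt[OF that] heap_1 by (intro inf_fuzzy_le_left_opt[of _ "heap 1"]) simp_all
    show ?thesis
    proof (rule num_inf_le_if_opts)
      fix g assume "g |\<in>| right_opts (heap h)"
      then obtain k where k: "k \<in> right_heaps h" "g = heap k"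
        by (auto simp: right_opts_heap)
      then consider "k < h" "pos k \<le> pos h" | "golden - 1 < pos k - pos h"
        by (auto simp: right_heaps_iff)
      then show "gv (num 1) \<unlhd> gv g"
      proof cases
        case 1
        then show ?thesis
          using less.IH[of k] less.prems unfolding k(2) by (intro inf_le_imp_fuzzy) simp
      next
        case 2
        then have "golden - 1 < pos k"
          using pos_bounds(1)[of h] by linarith
        then show ?thesis
          unfolding k(2) by (intro left_1 one_in_left_heaps)
      qed
    next
      have "pos h \<noteq> pos 1"
        using False pos_inj by blast
      then have "1 \<in> left_heaps h"
        using less.prems pos_bounds(1)[of h] golden_bounds False \<open>h \<noteq> 0\<close> pos_1
        by (auto simp: left_heaps_iff)
      then show "gv (num 1) \<unlhd> gv (heap h)"
        by (rule left_1)
    qed simp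
  qed
qed

lemma in_G_zone_left_heap:
  assumes "in_G_zone n h"
  obtains k where "k \<in> left_heaps h" "pos k \<le> 2 * golden - 3"
proof
  let ?k = "fib_odd_point (Suc n) + 1"
  show "?k \<in> left_heaps h"
    using assms in_G_zone_gt[OF assms]
    unfolding left_heaps_iff pos_fib_odd_point_Suc in_G_zone_def pos_fib_odd_point by auto
  show "pos ?k \<le> 2 * golden - 3"
    unfolding pos_fib_odd_point_Suc psi_powers(1)[symmetric] by (rule psi_mono) simp
qed

lemma not_in_Q_cases:
  assumes "\<not> in_Q h"
  shows "gv (num 1) \<lesssim> gv (heap h) \<or> (\<exists>k. k |\<in>| left_opts (heap h) \<and> gv (num 1) \<lesssim> gv k)"
proof (cases h rule: zone_cases)
  case hat
  then show ?thesis
    using num_1_inf_le_heap by blast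
next
  case (G n)
  obtain k where "k \<in> left_heaps h" "pos k \<le> 2 * golden - 3"
    using G by (rule in_G_zone_left_heap)
  then show ?thesis
    using num_1_inf_le_heap heap_left_opt by blast
next
  case B
  then show ?thesis
    using heap_left_opt[OF one_in_left_heaps] heap_1 by (metis inf_le_refl)
qed (use assms in simp)

lemma num_1_fuzzy_le_heap: "\<not> in_Q h \<Longrightarrow> gv (num 1) \<unlhd> gv (heap h)"
  using not_in_Q_cases inf_le_imp_fuzzy inf_fuzzy_le_left_opt by blast

lemma pos_fib_odd_point_less_iff: "pos (fib_odd_point m) < pos (fib_odd_point n) \<longleftrightarrow> n < m"
proof -
  have "pos (fib_odd_point i) < pos (fib_odd_point j)" if "j < i" for i j
    using that psi_strict_mono[of "2 * j + 3" "2 * i + 3"] by (simp add: pos_fib_odd_point)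
  then show ?thesis
    by (metis less_asym less_irrefl linorder_neqE_nat)
qed

lemma in_Q_pos: "in_Q h \<Longrightarrow> 2 * golden - 3 < pos h" "in_Q h \<Longrightarrow> pos h \<le> golden - 1"
proof -
  have "2 * golden - 3 < pos h \<and> pos h \<le> golden - 1" if "in_Q h"
  proof (cases "\<exists>n. h = fib_odd_point n")
    case True
    then obtain n where "h = fib_odd_point n" by blast
    then show ?thesis
      using psi_bounds(1)[of "2 * n + 3"] psi_mono[of 3 "2 * n + 3"] psi_powers golden_bounds
      by (simp add: pos_fib_odd_point)
  next
    case False
    then show ?thesis
      using that golden_bounds by (auto simp: in_Q_def)
  qed
  then show "in_Q h \<Longrightarrow> 2 * golden - 3 < pos h" "in_Q h \<Longrightarrow> pos h \<le> golden - 1"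
    by blast+
qed

lemma fib_odd_point_0: "fib_odd_point 0 = 0"
  by (simp add: fib_odd_point_def eval_nat_numeral)

lemma in_Q_fib_odd_point: "in_Q (fib_odd_point n)"
  by (auto simp: in_Q_def)

lemma in_Q_0: "in_Q 0"
  unfolding in_Q_def using fib_odd_point_0 by metis

lemma in_Q_pos_less: "in_Q h \<Longrightarrow> h \<noteq> 0 \<Longrightarrow> pos h < golden - 1"
  using in_Q_pos(2)[of h] pos_inj[of h 0] pos_0 by fastforce

lemma in_Q_gt_1: "in_Q h \<Longrightarrow> h \<noteq> 0 \<Longrightarrow> 1 < h"
  using in_Q_pos(1)[of h] pos_1 by (cases "h = 1") auto

lemma in_Q_between_points:
  assumes "in_Q h" "pos h < pos (fib_odd_point n)"
  shows "pos h \<le> pos (fib_odd_point (Suc n))"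
proof (cases "\<exists>m. h = fib_odd_point m")
  case True
  then obtain m where m: "h = fib_odd_point m" by blast
  with assms(2) have "\<not> m < Suc n"
    by (simp add: pos_fib_odd_point_less_iff)
  then show ?thesis
    unfolding m using pos_fib_odd_point_less_iff[of "Suc n" m] by linarith
next
  case False
  then show ?thesis
    using assms(1) psi_bounds(1)[of "2 * Suc n + 3"] unfolding in_Q_def pos_fib_odd_point by auto
qed

lemma in_Q_left_heaps:
  assumes h: "in_Q h" and k: "k \<in> left_heaps h"
  obtains g where "g < h" "in_Q g" "pos h < pos g" "g = k \<or> g \<in> right_heaps k"
proof -
  have less: "k < h"
    using k by (simp add: left_heaps_iff)
  then have "h \<noteq> 0"
    by simp
  have "\<not> 2 - golden < pos h - pos k"
  proof
    assume wrap: "2 - golden < pos h - pos k"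
    then have "2 - golden < pos h"
      using pos_bounds(1)[of k] by linarith
    then obtain n where n: "h = fib_odd_point n"
      using h by (auto simp: in_Q_def)
    have "psi ^ (2 * n + 1) \<le> pos k"
      using less unfolding n by (rule pos_ge_before_fib_odd_point)
    moreover have "psi ^ (2 * n + 3) < psi ^ (2 * n + 1)"
      by (rule psi_strict_mono) simp
    ultimately show False
      using wrap unfolding n pos_fib_odd_point by linarith
  qed
  then have pos_less: "pos h < pos k" "pos k - pos h < golden - 1"
    using k by (auto simp: left_heaps_iff)
  show thesis
  proof (cases k rule: zone_cases)
    case hat
    then show ?thesis
      using in_Q_pos(1)[OF h] pos_less by linarith
  next
    case Q
    then show ?thesis
      using that[of k] less pos_less by blast
  next
    case (G n)
    let ?g = "fib_odd_point (Suc n)"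
    have g: "in_Q ?g" "?g < k" "pos ?g < pos k"
      using in_G_zone_gt[OF G] G by (auto simp: in_Q_def in_G_zone_def)
    have "pos k - pos ?g < 2 - golden"
      using G in_Q_pos(2)[OF in_Q_fib_odd_point[of n]] in_Q_pos(1)[OF g(1)] golden_bounds
      by (simp add: in_G_zone_def)
    then have "?g \<in> right_heaps k"
      using g by (simp add: right_heaps_iff)
    moreover have "pos h \<le> pos ?g"
      using h pos_less(1) G by (intro in_Q_between_points) (auto simp: in_G_zone_def)
    then have "pos h < pos ?g"
      using pos_inj[of h ?g] g(2) less by fastforce
    ultimately show ?thesis
      using that[of ?g] g less by simp
  next
    case B
    then have "0 \<in> right_heaps k"
      using pos_0 pos_bounds(2)[of k] golden_bounds by (cases "k = 0") (auto simp: right_heaps_iff)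
    then show ?thesis
      using that[of 0] in_Q_0 in_Q_pos_less[OF h \<open>h \<noteq> 0\<close>] pos_0 \<open>h \<noteq> 0\<close> by simp
  qed
qed

lemma in_Q_right_heaps:
  assumes "in_Q h" "k \<in> right_heaps h"
  shows "(k < h \<and> in_Q k \<and> pos k < pos h) \<or> gv (num 1) \<unlhd> gv (heap k)"
proof (cases "in_Q k")
  case True
  then have "pos k \<le> golden - 1"
    by (rule in_Q_pos)
  then have "k < h" "pos k \<le> pos h"
    using assms(2) pos_bounds(1)[of h] by (auto simp: right_heaps_iff)
  then show ?thesis
    using True pos_inj[of k h] by fastforce
next
  case False
  then show ?thesis
    using num_1_fuzzy_le_heap by blast
qed

lemma in_Q_heap_moves:
  assumes "in_Q g" "in_Q h" "g < h"
  shows "pos h < pos g \<Longrightarrow> g \<in> left_heaps h" "pos g < pos h \<Longrightarrow> g \<in> right_heaps h"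
  using assms in_Q_pos[OF assms(1)] in_Q_pos[OF assms(2)] golden_bounds
  unfolding left_heaps_iff right_heaps_iff by linarith+

lemma in_Q_one_right_heap: "in_Q h \<Longrightarrow> h \<noteq> 0 \<Longrightarrow> 1 \<in> right_heaps h"
  using in_Q_gt_1[of h] in_Q_pos[of h] in_Q_pos_less[of h] pos_1 by (auto simp: right_heaps_iff)

lemma in_Q_left_opt_not_ge:
  assumes h: "in_Q h" and l: "l |\<in>| left_opts (heap h)"
    and less: "\<And>g. g < h \<Longrightarrow> in_Q g \<Longrightarrow> pos h < pos g \<Longrightarrow> gv (heap g) < y"
  shows "\<not> y \<le> gv l"
proof
  assume y: "y \<le> gv l"
  obtain k where k: "k \<in> left_heaps h" "l = heap k"
    using l by (auto simp: left_opts_heap)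
  obtain g where g: "g < h" "in_Q g" "pos h < pos g" "g = k \<or> g \<in> right_heaps k"
    using h k(1) by (rule in_Q_left_heaps)
  have "gv (heap g) < gv l"
    using less[OF g(1,2,3)] y by (rule less_le_trans)
  with g(4) show False
    using gv_not_right_opt_le[OF heap_right_opt, of g k] by (auto simp: k(2) less_le_not_le)
qed

lemma heap_in_Q:
  "in_Q h \<Longrightarrow> \<exists>x. dyadic x \<and> 0 \<le> x \<and> x < 1 \<and> gv (heap h) = gv (num x) \<and>
    (\<forall>g<h. in_Q g \<longrightarrow> (pos h < pos g \<longrightarrow> gv (heap g) < gv (heap h)) \<and>
      (pos g < pos h \<longrightarrow> gv (heap h) < gv (heap g)))"
proof (induction h rule: less_induct)
  case (less h)
  show ?case
  proof (cases "h = 0")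
    case True
    then show ?thesis
      by (intro exI[of _ 0]) (simp add: heap_0[simplified])
  next
    case False
    define v where "v g = number_value (heap g)" for g
    have v: "dyadic (v g)" "0 \<le> v g" "v g < 1" "gv (heap g) = gv (num (v g))" if "g < h" "in_Q g" for g
      using less.IH[OF that] number_value_eq[of _ "heap g"] by (auto simp: v_def)
    have mono: "v g < v g'" if "g < h" "g' < h" "in_Q g" "in_Q g'" "pos g' < pos g" for g g'
    proof -
      have "g \<noteq> g'"
        using that(5) by auto
      then have "gv (heap g) < gv (heap g')"
        using less.IH[OF that(1,3)] less.IH[OF that(2,4)] that(3-5) by (meson linorder_neqE_nat)
      then show ?thesis
        using v[OF that(1,3)] v[OF that(2,4)] by (simp add: gv_num_less_iff)
    qed
    define L where "L = v ` {g. g < h \<and> in_Q g \<and> pos h < pos g}"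
    define R where "R = insert 1 (v ` {g. g < h \<and> in_Q g \<and> pos g < pos h})"
    have fin: "finite L" "finite R"
      by (simp_all add: L_def R_def)
    have "v 0 \<in> L"
      using False in_Q_0 in_Q_pos_less[OF less.prems False] pos_0 by (auto simp: L_def)
    then have ne: "L \<noteq> {}" "R \<noteq> {}"
      by (auto simp: R_def)
    have less_LR: "x < y" if "x \<in> L" "y \<in> R" for x y
      using that v(3) mono by (auto simp: L_def R_def)
    define y where "y = (Max L + Min R) / 2"
    have "Max L < Min R"
      using less_LR fin ne by simp
    then have "Max L < y" "y < Min R"
      by (simp_all add: y_def)
    have dyadic: "dyadic x" if "x \<in> L \<union> R" for x
      using that v(1) by (auto simp: L_def R_def)
    have "dyadic (Max L)" "dyadic (Min R)"
      by (rule dyadic; use Max_in[OF fin(1) ne(1)] Min_in[OF fin(2) ne(2)] in blast)+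
    then have "dyadic y"
      unfolding y_def by (intro dyadic_half dyadic_add)
    have L_less: "x < y" if "x \<in> L" for x
      using Max_ge[OF fin(1) that] \<open>Max L < y\<close> by linarith
    have R_gr: "y < x" if "x \<in> R" for x
      using Min_le[OF fin(2) that] \<open>y < Min R\<close> by linarith
    have "is_number (heap h)"
    proof (rule is_numberI_between)
      show "dyadic y" by fact
      show "\<not> gv (num y) \<le> gv g" if "g |\<in>| left_opts (heap h)" for g
      proof (rule in_Q_left_opt_not_ge[OF less.prems that])
        fix g assume g: "g < h" "in_Q g" "pos h < pos g"
        then have "v g < y"
          by (intro L_less) (auto simp: L_def)
        then show "gv (heap g) < gv (num y)"
          using v[OF g(1,2)] \<open>dyadic y\<close> by (simp add: gv_num_less_iff)
      qed
      fix g assume "g |\<in>| right_opts (heap h)"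
      then obtain k where k: "k \<in> right_heaps h" "g = heap k"
        by (auto simp: right_opts_heap)
      from in_Q_right_heaps[OF less.prems k(1)] show "\<not> gv g \<le> gv (num y)"
      proof
        assume k': "k < h \<and> in_Q k \<and> pos k < pos h"
        then have "y < v k"
          by (intro R_gr) (auto simp: R_def)
        then show ?thesis
          using v[of k] k' \<open>dyadic y\<close> by (simp add: k(2) gv_num_le_iff)
      next
        assume "gv (num 1) \<unlhd> gv (heap k)"
        then show ?thesis
          unfolding k(2) using R_gr[of 1] \<open>dyadic y\<close> by (intro num_inf_fuzzy_leD) (auto simp: R_def)
      qed
    qed
    then obtain x where x: "dyadic x" "gv (heap h) = gv (num x)"
      by (rule is_numberE)
    have left: "gv (heap g) < gv (heap h)" if "g < h" "in_Q g" "pos h < pos g" for g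
      using gv_not_left_opt_ge[OF heap_left_opt[OF in_Q_heap_moves(1)[OF that(2) less.prems that(1,3)]]]
        v[OF that(1,2)] x by (simp add: gv_num_le_iff gv_num_less_iff)
    have right: "gv (heap h) < gv (heap g)" if "g < h" "in_Q g" "pos g < pos h" for g
      using gv_not_right_opt_le[OF heap_right_opt[OF in_Q_heap_moves(2)[OF that(2) less.prems that(1,3)]]]
        v[OF that(1,2)] x by (simp add: gv_num_le_iff gv_num_less_iff)
    have "gv (heap 0) < gv (heap h)"
      using left[of 0] False in_Q_0 in_Q_pos_less[OF less.prems False] pos_0 by simp
    then have "0 \<le> x"
      unfolding heap_0 x(2) using x(1) by (simp only: gv_num_less_iff dyadic_0_1 less_imp_le)
    have "\<not> gv (heap 1) \<le> gv (heap h)"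
      by (rule gv_not_right_opt_le heap_right_opt in_Q_one_right_heap less.prems False)+
    then have "x < 1"
      unfolding heap_1 x(2) using x(1) by (simp add: gv_num_le_iff)
    show ?thesis
      using x \<open>0 \<le> x\<close> \<open>x < 1\<close> left right by blast
  qed
qed

lemma heap_in_Q_less:
  assumes "in_Q g" "in_Q h" "pos h < pos g"
  shows "gv (heap g) < gv (heap h)"
  using heap_in_Q[OF assms(1)] heap_in_Q[OF assms(2)] assms by (metis less_irrefl linorder_neqE_nat)

lemma heap_in_Q_le:
  assumes "in_Q g" "in_Q h" "pos h \<le> pos g"
  shows "gv (heap g) \<le> gv (heap h)"
  using heap_in_Q_less[OF assms(1,2)] pos_inj[of h g] assms(3) by fastforce

text \<open>
  If \<open>g\<^sub>1\<close> and \<open>g\<^sub>2\<close> are the neighbours of \<open>h\<close> on the circle among the smaller heaps, then the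
  value of \<open>h\<close> is the simplest number between their values.
\<close>

lemma heap_in_Q_midpoint:
  assumes h: "in_Q h" "h \<noteq> 0"
    and g\<^sub>1: "in_Q g\<^sub>1" "g\<^sub>1 < h" "pos h < pos g\<^sub>1" "gv (heap g\<^sub>1) = gv (num a)"
    and g\<^sub>2: "in_Q g\<^sub>2 \<or> g\<^sub>2 = 1" "g\<^sub>2 < h" "pos g\<^sub>2 < pos h" "gv (heap g\<^sub>2) = gv (num b)"
    and gap: "\<And>k. k < h \<Longrightarrow> pos k \<le> pos g\<^sub>2 \<or> pos g\<^sub>1 \<le> pos k"
    and y: "num y = Game {|num a|} {|num b|}" "dyadic y" "dyadic a" "dyadic b" "a < y" "y < b" "b \<le> 1"
  shows "gv (heap h) = gv (num y)"
proof (rule antisym)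
  have "g\<^sub>2 \<in> right_heaps h"
    using g\<^sub>2 h in_Q_heap_moves(2)[of g\<^sub>2 h] in_Q_one_right_heap by blast
  then have not_ge_b: "\<not> gv (num b) \<le> gv (heap h)"
    using gv_not_right_opt_le[OF heap_right_opt] g\<^sub>2(4) by metis
  have "g\<^sub>1 \<in> left_heaps h"
    using in_Q_heap_moves(1) g\<^sub>1 h by blast
  then have not_le_a: "\<not> gv (heap h) \<le> gv (num a)"
    using gv_not_left_opt_ge[OF heap_left_opt] g\<^sub>1(4) by metis
  show "gv (heap h) \<le> gv (num y)"
  proof (subst gv_le_rec, intro conjI allI impI)
    show "\<not> gv (num y) \<le> gv l" if "l |\<in>| left_opts (heap h)" for l
    proof (rule in_Q_left_opt_not_ge[OF h(1) that])
      fix g assume g: "g < h" "in_Q g" "pos h < pos g"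
      then have "gv (heap g) \<le> gv (num a)"
        using gap[of g] g\<^sub>2(3) heap_in_Q_le[OF g(2) g\<^sub>1(1)] unfolding g\<^sub>1(4)[symmetric] by auto
      also have "\<dots> < gv (num y)"
        using y(2-) by (simp add: gv_num_less_iff)
      finally show "gv (heap g) < gv (num y)" .
    qed
    show "\<not> gv r \<le> gv (heap h)" if "r |\<in>| right_opts (num y)" for r
      using that not_ge_b unfolding y(1) by simp
  qed
  show "gv (num y) \<le> gv (heap h)"
  proof (subst gv_le_rec, intro conjI allI impI)
    show "\<not> gv (heap h) \<le> gv l" if "l |\<in>| left_opts (num y)" for l
      using that not_le_a unfolding y(1) by simp
    fix r assume "r |\<in>| right_opts (heap h)"
    then obtain k where k: "k \<in> right_heaps h" "r = heap k"
      by (auto simp: right_opts_heap)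
    from in_Q_right_heaps[OF h(1) k(1)] show "\<not> gv r \<le> gv (num y)"
    proof
      assume k': "k < h \<and> in_Q k \<and> pos k < pos h"
      then have "pos k \<le> pos g\<^sub>2"
        using gap[of k] g\<^sub>1(3) by auto
      then have "in_Q g\<^sub>2"
        using g\<^sub>2(1) in_Q_pos(1)[of k] k' pos_1 by auto
      then have "gv (num b) \<le> gv (heap k)"
        using heap_in_Q_le[of g\<^sub>2 k] k' \<open>pos k \<le> pos g\<^sub>2\<close> unfolding g\<^sub>2(4)[symmetric] by blast
      moreover have "gv (num y) < gv (num b)"
        using y(2-) by (simp add: gv_num_less_iff)
      ultimately show ?thesis
        unfolding k(2) by (meson less_le_not_le less_le_trans)
    next
      assume "gv (num 1) \<unlhd> gv (heap k)"
      then show ?thesis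
        unfolding k(2) by (rule num_inf_fuzzy_leD) (use y(2-) in auto)
    qed
  qed
qed

lemma fib_points_less:
  "fib_odd_point n < fib_even_point n"
  "fib_even_point n < fib_odd_point (Suc n)"
  "fib_odd_point n < fib_odd_point (Suc n)"
  "fib_even_point n < fib_even_point (Suc n)"
proof -
  have pos: "0 < fib (2 * n + 2)" "2 \<le> fib (2 * n + 3)"
    using fib_odd_ge_2 by (simp_all add: fib_neq_0_nat)
  have fibs: "fib (2 * Suc n + 4) = fib (2 * Suc n + 3) + fib (2 * n + 4)"
    "fib (2 * Suc n + 3) = fib (2 * n + 4) + fib (2 * n + 3)"
    "fib (2 * n + 4) = fib (2 * n + 3) + fib (2 * n + 2)"
    by (simp_all add: eval_nat_numeral)
  show "fib_odd_point n < fib_even_point n" "fib_even_point n < fib_odd_point (Suc n)"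
    "fib_odd_point n < fib_odd_point (Suc n)" "fib_even_point n < fib_even_point (Suc n)"
    unfolding fib_odd_point_def fib_even_point_def fibs using pos by linarith+
qed

lemma in_Q_fib_even_point: "in_Q (fib_even_point (Suc n))"
proof -
  have "psi ^ (2 * Suc n + 4) < psi ^ 4"
    by (rule psi_strict_mono) simp
  then show ?thesis
    using psi_bounds(1)[of "2 * Suc n + 4"] psi_powers(2) unfolding in_Q_def pos_fib_even_point by auto
qed

lemma s_q_dyadic:
  obtains m where "s n = of_int m / 2 ^ (2 * n)" "q n = of_int (m + 1) / 2 ^ (2 * n)"
    "s (Suc n) = (2 * of_int m + 1) / 2 ^ Suc (2 * n)"
    "q (Suc n) = (2 * of_int (2 * m + 1) + 1) / 2 ^ Suc (Suc (2 * n))"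
    "of_int (2 * m + 1 + 1) / 2 ^ Suc (2 * n) = q n"
proof -
  have "\<exists>m. s n = of_int m / 4 ^ n"
  proof (induction n)
    case 0
    show ?case
      by (rule exI[of _ 0]) (simp add: s_def)
  next
    case (Suc n)
    then obtain m where "s n = of_int m / 4 ^ n" by blast
    moreover have "s (Suc n) = s n + 2 / 4 ^ Suc n"
      by (simp add: s_def field_simps)
    ultimately have "s (Suc n) = of_int (4 * m + 2) / 4 ^ Suc n"
      by (simp add: field_simps)
    then show ?case
      by blast
  qed
  then obtain m where m: "s n = of_int m / 4 ^ n"
    by blast
  have four: "(4 :: rat) ^ n = 2 ^ (2 * n)"
    by (simp add: power_mult)
  have q: "q n = s n + 1 / 4 ^ n" "s (Suc n) = s n + 1 / (2 * 4 ^ n)" "q (Suc n) = s n + 3 / (4 * 4 ^ n)"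
    by (simp_all add: q_def s_def field_simps)
  show thesis
    by (rule that[of m]) (simp_all add: q m four[symmetric] add_divide_distrib)
qed

lemma dyadic_s_q: "dyadic (s n)" "dyadic (q n)"
proof -
  obtain m where "s n = of_int m / 2 ^ (2 * n)" "q n = of_int (m + 1) / 2 ^ (2 * n)"
    by (rule s_q_dyadic)
  then show "dyadic (s n)" "dyadic (q n)"
    unfolding dyadic_def by blast+
qed

lemma heap_fib_points:
  "gv (heap (fib_odd_point n)) = gv (num (s n)) \<and> gv (heap (fib_even_point n)) = gv (num (q n))"
proof (induction n)
  case 0
  have "fib_even_point 0 = 1" "s 0 = 0" "q 0 = 1"
    by (simp_all add: fib_even_point_def eval_nat_numeral s_def q_def)
  then show ?case
    using fib_odd_point_0 heap_0 heap_1 by simp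
next
  case (Suc n)
  obtain m where m: "s n = of_int m / 2 ^ (2 * n)" "q n = of_int (m + 1) / 2 ^ (2 * n)"
    "s (Suc n) = (2 * of_int m + 1) / 2 ^ Suc (2 * n)"
    "q (Suc n) = (2 * of_int (2 * m + 1) + 1) / 2 ^ Suc (Suc (2 * n))"
    "of_int (2 * m + 1 + 1) / 2 ^ Suc (2 * n) = q n"
    by (rule s_q_dyadic)
  have s_Suc: "s (Suc n) = of_int (2 * m + 1) / 2 ^ Suc (2 * n)"
    using m(3) by simp
  note dyadic = dyadic_s_q[of n] dyadic_s_q[of "Suc n"]
  have less: "s n < s (Suc n)" "s (Suc n) < q (Suc n)" "q (Suc n) < q n" "q n \<le> 1"
    by (simp_all add: s_def q_def field_simps)
  have num_s: "num (s (Suc n)) = Game {|num (s n)|} {|num (q n)|}"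
    unfolding m(3) num_midpoint m(1,2) ..
  have num_q: "num (q (Suc n)) = Game {|num (s (Suc n))|} {|num (q n)|}"
    unfolding m(4) num_midpoint m(5) s_Suc ..
  have even: "in_Q (fib_even_point n) \<or> fib_even_point n = 1"
    using in_Q_fib_even_point by (cases n) (simp_all add: fib_even_point_def eval_nat_numeral)
  have pos_less: "pos (fib_even_point n) < pos (fib_odd_point (Suc n))"
    "pos (fib_odd_point (Suc n)) < pos (fib_odd_point n)"
    "pos (fib_even_point n) < pos (fib_even_point (Suc n))"
    "pos (fib_even_point (Suc n)) < pos (fib_odd_point (Suc n))"
    using psi_bounds(1)[of "2 * n + 4"] psi_bounds(1)[of "2 * Suc n + 3"] psi_bounds(1)[of "2 * Suc n + 4"]
      psi_strict_mono[of "2 * n + 3" "2 * Suc n + 3"] psi_strict_mono[of "2 * n + 4" "2 * Suc n + 4"]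
    unfolding pos_fib_even_point pos_fib_odd_point by auto
  have odd: "gv (heap (fib_odd_point (Suc n))) = gv (num (s (Suc n)))"
    by (rule heap_in_Q_midpoint[of _ "fib_odd_point n" "s n" "fib_even_point n" "q n"])
       (use Suc num_s dyadic less even pos_less fib_points_less[of n] in_Q_fib_odd_point
          pos_gap_fib_odd_point[of _ n] in auto)
  have "gv (heap (fib_even_point (Suc n))) = gv (num (q (Suc n)))"
    by (rule heap_in_Q_midpoint[of _ "fib_odd_point (Suc n)" "s (Suc n)" "fib_even_point n" "q n"])
       (use Suc odd num_q dyadic less even pos_less fib_points_less[of n] fib_points_less[of "Suc n"]
          in_Q_fib_odd_point in_Q_fib_even_point pos_gap_fib_even_point[of _ n] in auto)
  with odd show ?case ..
qed

lemma heap_B_set: "h \<in> B_set \<Longrightarrow> rcf_heap h = Game {|num 1|} {|num 0|}"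
proof -
  assume "h \<in> B_set"
  then have B: "golden - 1 < pos h"
    by (rule B_set_zone)
  have "0 < h"
    using B pos_0 by (cases "h = 0") auto
  then have "0 \<in> right_heaps h"
    using B pos_0 pos_bounds(2)[of h] golden_bounds by (simp add: right_heaps_iff)
  have "heap h =\<^sub>I switch 1 0"
  proof (rule inf_eq_switchI)
    show "heap 1 |\<in>| left_opts (heap h)"
      by (rule heap_left_opt one_in_left_heaps B)+
    show "gv (num 1) \<lesssim> gv (heap 1)"
      unfolding heap_1 by simp
    show "heap 0 |\<in>| right_opts (heap h)"
      by (rule heap_right_opt) fact
    show "gv (heap 0) \<lesssim> gv (num 0)"
      unfolding heap_0 by simp
    show "gv (num 0) \<lesssim> gv g \<or> (\<exists>k. k |\<in>| left_opts g \<and> gv (num 1) \<lesssim> gv k)"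
      if "g |\<in>| right_opts (heap h)" for g
      using that num_0_inf_le_heap by (auto simp only: right_opts_heap)
  qed (use num_0_inf_le_heap heap_inf_le_num_1 in \<open>auto simp only: left_opts_heap dyadic_0_1\<close>)
  then show ?thesis
    unfolding rcf_heap_def by (intro rcf_eq_switch) simp_all
qed

lemma heap_AB0_hat: "h \<in> AB0_hat \<Longrightarrow> rcf_heap h = num 1"
  unfolding rcf_heap_def
  using num_1_inf_le_heap[OF AB0_hat_zone] heap_inf_le_num_1
  by (intro rcf_eq_num) (simp_all add: inf_eq_iff)

lemma val_in_Q:
  assumes "in_Q h"
  obtains x where "dyadic x" "x < 1" "gv (heap h) = gv (num x)" "val h = num x"
  using heap_in_Q[OF assms] canonical_form_eq_num unfolding val_def by metis

lemma val_in_Q_bounds: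
  assumes "in_Q h" "h \<noteq> 0"
  shows "is_number (val h)" "num (1/2) \<le> val h" "val h < num 1"
proof -
  obtain x where x: "dyadic x" "x < 1" "gv (heap h) = gv (num x)" "val h = num x"
    using assms(1) by (rule val_in_Q)
  show "is_number (val h)"
    unfolding x(4) using x(1) by (rule is_number_num)
  show "val h < num 1"
    using x(1,2) unfolding x(4) gv_less_iff[symmetric] by (simp add: gv_num_less_iff)
  have "pos h < pos (fib_odd_point 0)"
    using in_Q_pos_less[OF assms] pos_0 by (simp add: fib_odd_point_0)
  then have "pos h \<le> pos (fib_odd_point 1)"
    using in_Q_between_points[OF assms(1)] by simp
  then have "gv (heap (fib_odd_point 1)) \<le> gv (heap h)"
    using heap_in_Q_le[OF in_Q_fib_odd_point assms(1)] by blast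
  moreover have "s 1 = 1 / 2"
    by (simp add: s_def)
  ultimately show "num (1/2) \<le> val h"
    using heap_fib_points[of 1] unfolding x(3,4) gv_le_iff[symmetric] by metis
qed

lemma val_fib_points: "val (fib (2 * n + 3) - 2) = num (s n)" "val (fib (2 * n + 4) - 2) = num (q n)"
  using heap_fib_points[of n] dyadic_s_q[of n] unfolding val_def fib_odd_point_def fib_even_point_def
  by (blast intro: canonical_form_eq_num)+

lemma heap_in_G_zone:
  assumes "in_G_zone n h"
  shows "rcf_heap h = Game {|num 1|} {|num (s (Suc n))|}"
proof -
  let ?g = "fib_odd_point (Suc n)" and ?b = "s (Suc n)"
  have g: "gv (heap ?g) = gv (num ?b)"
    using heap_fib_points by blast
  have b: "dyadic ?b" "?b < 1"
    by (rule dyadic_s_q) (simp add: s_def field_simps add_pos_pos)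
  obtain l where "l \<in> left_heaps h" "pos l \<le> 2 * golden - 3"
    using assms by (rule in_G_zone_left_heap)
  then have l: "heap l |\<in>| left_opts (heap h)" "gv (num 1) \<lesssim> gv (heap l)"
    by (simp_all only: heap_left_opt num_1_inf_le_heap)
  have b_le_1: "gv (num ?b) \<lesssim> gv (num 1)"
    using b by (simp add: inf_le_num_iff)
  have pos_h: "2 - golden < pos ?g" "pos ?g < pos h" "pos h < pos (fib_odd_point n)" "?g < h"
    using assms in_G_zone_gt[OF assms] psi_bounds(1)[of "2 * Suc n + 3"]
    by (simp_all add: in_G_zone_def pos_fib_odd_point)
  have right: "gv (num ?b) \<lesssim> gv r \<or> (\<exists>k. k |\<in>| left_opts r \<and> gv (num 1) \<lesssim> gv k)"
    if "r |\<in>| right_opts (heap h)" for r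
  proof -
    obtain k where k: "k \<in> right_heaps h" "r = heap k"
      using \<open>r |\<in>| right_opts (heap h)\<close> by (auto simp: right_opts_heap)
    show ?thesis
    proof (cases "in_Q k")
      case True
      have "pos k \<le> pos h"
        using k(1) in_Q_pos(2)[OF True] pos_bounds(1)[of h] by (auto simp: right_heaps_iff)
      then have "pos k \<le> pos ?g"
        using pos_h(3) True by (intro in_Q_between_points) simp_all
      then have "gv (num ?b) \<le> gv r"
        using heap_in_Q_le[OF in_Q_fib_odd_point True] unfolding g[symmetric] k(2) by blast
      then show ?thesis
        by (blast intro: le_imp_inf_le)
    next
      case False
      then show ?thesis
        using not_in_Q_cases[OF False] b_le_1 inf_le_trans unfolding k(2) by blast
    qed
  qed
  have "heap h =\<^sub>I switch 1 ?b"
  proof (rule inf_eq_switchI[OF _ b _ _ l _ _ _ right])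
    show "gv (num ?b) \<lesssim> gv (heap h)"
    proof (rule num_inf_le_if_opts[OF b(1)])
      show "gv (num ?b) \<unlhd> gv r" if "r |\<in>| right_opts (heap h)" for r
        using right[OF that] b_le_1 inf_fuzzy_le_left_opt inf_le_imp_fuzzy inf_le_trans by blast
      show "gv (num ?b) \<unlhd> gv (heap h)"
        using inf_le_trans[OF b_le_1 l(2)] l(1) by (rule inf_fuzzy_le_left_opt)
    qed
    have "pos h - pos ?g < 2 - golden"
      using pos_h in_Q_pos(2)[OF in_Q_fib_odd_point[of n]] golden_bounds by simp
    then show "heap ?g |\<in>| right_opts (heap h)"
      using pos_h by (intro heap_right_opt) (simp add: right_heaps_iff)
    show "gv (heap ?g) \<lesssim> gv (num ?b)"
      using g by simp
  qed (use heap_inf_le_num_1 in \<open>auto simp: left_opts_heap\<close>)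
  then show ?thesis
    unfolding rcf_heap_def using b by (intro rcf_eq_switch) simp_all
qed

theorem theorem2p2:
  "(\<forall>h. h \<in> B_set \<longrightarrow> rcf_heap h = Game {|num 1|} {|num 0|}) \<and>
   (\<forall>h. h \<in> AB0_hat \<longrightarrow> rcf_heap h = num 1) \<and>
   ((\<forall>h. h \<in> Q_set - {0} \<longrightarrow>
       is_number (val h) \<and> num (1/2) \<le> val h \<and> val h < num 1) \<and>
    (\<forall>n. val (fib (2 * n + 3) - 2) = num (s n) \<and>
         val (fib (2 * n + 4) - 2) = num (q n))) \<and>
   (\<forall>n. n \<ge> 1 \<longrightarrow> G_set n \<subseteq> AB0 \<and>
      (\<forall>h. h \<in> G_set n \<longrightarrow> rcf_heap h = Game {|num 1|} {|num (s n)|}))"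
proof (intro conjI allI impI)
  fix h
  show "h \<in> B_set \<Longrightarrow> rcf_heap h = Game {|num 1|} {|num 0|}"
    by (rule heap_B_set)
  show "h \<in> AB0_hat \<Longrightarrow> rcf_heap h = num 1"
    by (rule heap_AB0_hat)
  assume "h \<in> Q_set - {0}"
  then show "is_number (val h)" "num (1/2) \<le> val h" "val h < num 1"
    using val_in_Q_bounds[of h] Q_set_in_Q by auto
next
  fix n
  show "val (fib (2 * n + 3) - 2) = num (s n)" "val (fib (2 * n + 4) - 2) = num (q n)"
    by (rule val_fib_points)+
next
  fix n :: nat
  assume "n \<ge> 1"
  then obtain m where n: "n = Suc m"
    by (cases n) auto
  show "G_set n \<subseteq> AB0"
    unfolding n using G_set_zone in_G_zone_AB0 by blast
  show "rcf_heap h = Game {|num 1|} {|num (s n)|}" if "h \<in> G_set n" for h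
    using that heap_in_G_zone[OF G_set_zone] unfolding n by blast
qed

end
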